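(* Let $\Omega\subset\mathbb R^n$ be a bounded Lipschitz domain and let $\{\Omega_h\}_{h>0}$ be a family of polytopal domains with uniformly bounded Lipschitz character, such that there is a fixed bounded convex region $K$ with $\Omega\subset\Omega_h\subset K$ for all $h>0$. For each $h$ and each form degree $k$, let $\Lambda_h^k(\Omega_h)\subset H\Lambda^k(\Omega_h)$ be a discrete differential form space (associated with a mesh of $\Omega_h$) and let $\Pi_h^k:H\Lambda^k(\Omega_h)\to\Lambda_h^k(\Omega_h)$ be a projection onto $\Lambda_h^k(\Omega_h)$ satisfying $d\circ\Pi_h^k=\Pi_h^{k+1}\circ d$ and $\|\Pi_h^k\tau\|_{H\Lambda^k(\Omega_h)}\le C_{\mathrm{proj}}\|\tau\|_{H\Lambda^k(\Omega_h)}$ for all $\tau\in H\Lambda^k(\Omega_h)$, with a constant $C_{\mathrm{proj}}$ independent of $h$. Let $k\in\{0,\dots,n-1\}$. Then for any $\Omega_h$ in the family and every discrete form $\omega_h\in\Lambda_h^k(\Omega_h)$ there exists a discrete potential $\tau_h\in\Lambda_h^k(\Omega_h)$ such that $d\tau_h=d\omega_h$ and $$\|\tau_h\|_{L^2\Lambda^k(\Omega_h)}\le C_{\mathrm{DP}}\,\|d\omega_h\|_{L^2\Lambda^{k+1}(\Omega_h)},$$ where the constant $C_{\mathrm{DP}}$ depends only on the set $K$, on the extension constant $\tilde C$ (see context), and on the projection bound $C_{\mathrm{proj}}$, but is independent of $h$ and of the specific domain $\Omega_h$.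
   Context: For a bounded Lipschitz domain $D$, $L^2\Lambda^k(D)$ is the space of square-integrable differential $k$-forms, and $H\Lambda^k(D)=\{\omega\in L^2\Lambda^k(D): d\omega\in L^2\Lambda^{k+1}(D)\}$ with the graph norm $\|\omega\|_{H\Lambda^k(D)}^2=\|\omega\|_{L^2}^2+\|d\omega\|_{L^2}^2$. The Lipschitz character of a domain is the quantitative data of a Lipschitz boundary atlas: the number of local Lipschitz charts needed to cover the boundary, the maximal Lipschitz constant of the local graphs, and the minimal chart radius. Extension constant $\tilde C$: it is the constant in the stability bound, for exact data, of a cochain extension without boundary condition on $\partial K$. That is, there are bounded linear operators $E^k:H\Lambda^k(\Omega_h)\cap\mathfrak H^k(\Omega_h)^\perp\to H\Lambda^k(K)$ with $E^k\omega|_{\Omega_h}=\omega$ and $dE^k\omega=E^{k+1}(d\omega)$ in $K$, and for exact $\omega$ one has $\|E^k\omega\|_{H\Lambda^k(K)}\le(1+\tilde C)\|\omega\|_{H\Lambda^k(\Omega_h)}$. The stability constant of this extension depends on the Lipschitz characters of $\partial\Omega_h$ and $\partial K$ and, $K$ being convex, on $\mathrm{diam}(K)$. Here $\mathfrak H^k(\Omega_h)$ is the space of $L^2$ $k$-forms $\omega$ with $d\omega=0$, $\delta\omega=0$ ($\delta$ the codifferential) and vanishing normal trace on $\partial\Omega_h$, and $\perp$ is taken in $L^2\Lambda^k(\Omega_h)$. *)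

theory Defs
  imports "HOL-Analysis.Analysis"
begin

text \<open>A differential form assigns to each point a function of a list of tangent vectors. A
  \<open>k\<close>-form is multilinear and alternating on lists of length \<open>k\<close> and zero on lists of any other
  length, so that the alternating \<open>k\<close>-linear maps are represented uniquely. In particular every
  form of degree \<open>k > DIM('a)\<close> vanishes, and no upper limit on \<open>k\<close> is needed anywhere below.\<close>

type_synonym 'a form = "'a \<Rightarrow> 'a list \<Rightarrow> real"

definition alternating :: "nat \<Rightarrow> ('a::euclidean_space list \<Rightarrow> real) \<Rightarrow> bool" where
  "alternating k f \<longleftrightarrow>
     (\<forall>vs. length vs \<noteq> k \<longrightarrow> f vs = 0) \<and>
     (\<forall>vs i. length vs = k \<and> i < k \<longrightarrow> linear (\<lambda>v. f (vs[i := v]))) \<and>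
     (\<forall>vs. length vs = k \<and> \<not> distinct vs \<longrightarrow> f vs = 0)"

text \<open>The inner product for which the \<open>dx\<^sub>I\<close> with increasing \<open>I\<close> are orthonormal. Summing over all
  \<open>k\<close>-tuples of basis vectors counts each \<open>I\<close> exactly \<open>k!\<close> times.\<close>

definition form_inner ::
    "nat \<Rightarrow> ('a::euclidean_space list \<Rightarrow> real) \<Rightarrow> ('a list \<Rightarrow> real) \<Rightarrow> real" where
  "form_inner k f g = (\<Sum>vs | length vs = k \<and> set vs \<subseteq> Basis. f vs * g vs) / fact k"

text \<open>Elements of \<open>L\<^sup>2\<Lambda>\<^sup>k(D)\<close> are represented by functions, and equality in \<open>L\<^sup>2\<Lambda>\<^sup>k(D)\<close> is
  \<open>form_eq D\<close>. Values outside \<open>D\<close> are irrelevant, so a form on a larger set is its own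
  restriction to \<open>D\<close>.\<close>

definition form_eq :: "'a::euclidean_space set \<Rightarrow> 'a form \<Rightarrow> 'a form \<Rightarrow> bool" where
  "form_eq D \<omega> \<eta> \<longleftrightarrow> (AE x in lborel. x \<in> D \<longrightarrow> \<omega> x = \<eta> x)"

definition zero_form :: "'a form" where
  "zero_form = (\<lambda>x vs. 0)"

definition lincomb :: "real \<Rightarrow> 'a form \<Rightarrow> real \<Rightarrow> 'a form \<Rightarrow> 'a form" where
  "lincomb a \<omega> b \<eta> = (\<lambda>x vs. a * \<omega> x vs + b * \<eta> x vs)"

definition L2_form :: "'a::euclidean_space set \<Rightarrow> nat \<Rightarrow> 'a form set" where
  "L2_form D k = {\<omega>. (\<forall>x\<in>D. alternating k (\<omega> x)) \<and>
     (\<forall>vs. set_borel_measurable lborel D (\<lambda>x. \<omega> x vs) \<and>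
           set_integrable lborel D (\<lambda>x. (\<omega> x vs)\<^sup>2))}"

definition L2_inner :: "'a::euclidean_space set \<Rightarrow> nat \<Rightarrow> 'a form \<Rightarrow> 'a form \<Rightarrow> real" where
  "L2_inner D k \<omega> \<eta> = (LINT x:D|lborel. form_inner k (\<omega> x) (\<eta> x))"

definition L2_norm :: "'a::euclidean_space set \<Rightarrow> nat \<Rightarrow> 'a form \<Rightarrow> real" where
  "L2_norm D k \<omega> = sqrt (L2_inner D k \<omega> \<omega>)"

primrec C_diff :: "nat \<Rightarrow> ('a::euclidean_space \<Rightarrow> real) \<Rightarrow> bool" where
  "C_diff 0 f \<longleftrightarrow> continuous_on UNIV f"
| "C_diff (Suc m) f \<longleftrightarrow> (\<forall>x. f differentiable (at x)) \<and>
     (\<forall>v. C_diff m (\<lambda>x. frechet_derivative f (at x) v))"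

definition test_function :: "'a::euclidean_space set \<Rightarrow> ('a \<Rightarrow> real) \<Rightarrow> bool" where
  "test_function D \<phi> \<longleftrightarrow> (\<forall>m. C_diff m \<phi>) \<and>
     compact (closure {x. \<phi> x \<noteq> 0}) \<and> closure {x. \<phi> x \<noteq> 0} \<subseteq> D"

text \<open>\<open>\<eta> = d\<omega>\<close> in the sense of distributions, for a \<open>k\<close>-form \<open>\<omega>\<close>, where
  \<open>d\<omega>(v\<^sub>0,\<dots>,v\<^sub>k) = (\<Sum>i\<le>k. (-1)\<^sup>i \<partial>\<^bsub>v\<^sub>i\<^esub> \<omega>(v\<^sub>0,\<dots>,v\<^sub>k without v\<^sub>i))\<close>.\<close>

definition weak_d :: "'a::euclidean_space set \<Rightarrow> nat \<Rightarrow> 'a form \<Rightarrow> 'a form \<Rightarrow> bool" where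
  "weak_d D k \<omega> \<eta> \<longleftrightarrow> (\<forall>\<phi> vs. test_function D \<phi> \<and> length vs = Suc k \<longrightarrow>
     (LINT x:D|lborel. \<eta> x vs * \<phi> x) =
     - (\<Sum>i\<le>k. (-1) ^ i *
          (LINT x:D|lborel. \<omega> x (take i vs @ drop (Suc i) vs) * frechet_derivative \<phi> (at x) (vs ! i))))"

definition H_form :: "'a::euclidean_space set \<Rightarrow> nat \<Rightarrow> 'a form set" where
  "H_form D k = {\<omega> \<in> L2_form D k. \<exists>\<eta> \<in> L2_form D (Suc k). weak_d D k \<omega> \<eta>}"

text \<open>For open \<open>D\<close> and \<open>\<omega> \<in> H_form D k\<close> the choice below is unique up to \<open>form_eq D\<close>.\<close>

definition ext_d :: "'a::euclidean_space set \<Rightarrow> nat \<Rightarrow> 'a form \<Rightarrow> 'a form" where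
  "ext_d D k \<omega> = (SOME \<eta>. \<eta> \<in> L2_form D (Suc k) \<and> weak_d D k \<omega> \<eta>)"

definition H_norm :: "'a::euclidean_space set \<Rightarrow> nat \<Rightarrow> 'a form \<Rightarrow> real" where
  "H_norm D k \<omega> = sqrt ((L2_norm D k \<omega>)\<^sup>2 + (L2_norm D (Suc k) (ext_d D k \<omega>))\<^sup>2)"

text \<open>\<open>\<zeta> = \<delta>\<omega>\<close> in the sense of distributions, for a \<open>k\<close>-form \<open>\<omega>\<close>, where \<open>\<delta>\<close> is the formal adjoint
  of \<open>d\<close>, that is \<open>\<delta>\<omega>(u\<^sub>2,\<dots>,u\<^sub>k) = - (\<Sum>e\<in>Basis. \<partial>\<^sub>e \<omega>(e,u\<^sub>2,\<dots>,u\<^sub>k))\<close>. For \<open>k = 0\<close> the condition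
  is void.\<close>

definition weak_codiff :: "'a::euclidean_space set \<Rightarrow> nat \<Rightarrow> 'a form \<Rightarrow> 'a form \<Rightarrow> bool" where
  "weak_codiff D k \<omega> \<zeta> \<longleftrightarrow> (\<forall>\<phi> us. test_function D \<phi> \<and> Suc (length us) = k \<longrightarrow>
     (LINT x:D|lborel. \<zeta> x us * \<phi> x) =
     (\<Sum>e\<in>Basis. LINT x:D|lborel. \<omega> x (e # us) * frechet_derivative \<phi> (at x) e))"

text \<open>The normal trace of \<open>\<omega>\<close> on \<open>\<partial>D\<close>, with \<open>\<zeta> = \<delta>\<omega> \<in> L\<^sup>2\<close>, is the functional
  \<open>\<mu> \<mapsto> \<langle>\<omega>, d\<mu>\<rangle> - \<langle>\<delta>\<omega>, \<mu>\<rangle>\<close> on \<open>H\<Lambda>\<^sup>k\<^sup>-\<^sup>1(D)\<close>. By Green's formula it is the boundary integral of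
  \<open>tr \<mu> \<and> tr \<star>\<omega>\<close> whenever the traces exist classically.\<close>

definition vanishing_normal_trace ::
    "'a::euclidean_space set \<Rightarrow> nat \<Rightarrow> 'a form \<Rightarrow> 'a form \<Rightarrow> bool" where
  "vanishing_normal_trace D k \<omega> \<zeta> \<longleftrightarrow> (\<forall>j \<mu>. k = Suc j \<and> \<mu> \<in> H_form D j \<longrightarrow>
     L2_inner D k \<omega> (ext_d D j \<mu>) - L2_inner D j \<zeta> \<mu> = 0)"

definition harmonic_form :: "'a::euclidean_space set \<Rightarrow> nat \<Rightarrow> 'a form set" where
  "harmonic_form D k = {\<omega> \<in> L2_form D k. weak_d D k \<omega> zero_form \<and>
     weak_codiff D k \<omega> zero_form \<and> vanishing_normal_trace D k \<omega> zero_form}"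

definition H_perp_form :: "'a::euclidean_space set \<Rightarrow> nat \<Rightarrow> 'a form set" where
  "H_perp_form D k = {\<omega> \<in> H_form D k. \<forall>\<eta> \<in> harmonic_form D k. L2_inner D k \<omega> \<eta> = 0}"

definition exact_form :: "'a::euclidean_space set \<Rightarrow> nat \<Rightarrow> 'a form set" where
  "exact_form D k = {\<omega> \<in> H_form D k.
     (case k of 0 \<Rightarrow> form_eq D \<omega> zero_form
      | Suc j \<Rightarrow> \<exists>\<mu> \<in> H_form D j. form_eq D (ext_d D j \<mu>) \<omega>)}"

text \<open>An operator into forms on \<open>D'\<close> acts on representatives. Linearity up to \<open>form_eq D'\<close> together
  with a norm bound makes it well defined on equivalence classes.\<close>

definition linear_forms :: "'a::euclidean_space set \<Rightarrow> 'a form set \<Rightarrow> ('a form \<Rightarrow> 'a form) \<Rightarrow> bool" where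
  "linear_forms D' S A \<longleftrightarrow> (\<forall>\<omega>\<in>S. \<forall>\<eta>\<in>S. \<forall>a b.
     form_eq D' (A (lincomb a \<omega> b \<eta>)) (lincomb a (A \<omega>) b (A \<eta>)))"

definition cochain_extension ::
    "'a::euclidean_space set \<Rightarrow> 'a set \<Rightarrow> (nat \<Rightarrow> 'a form \<Rightarrow> 'a form) \<Rightarrow> bool" where
  "cochain_extension D K E \<longleftrightarrow> (\<forall>k.
     E k ` H_perp_form D k \<subseteq> H_form K k \<and>
     linear_forms K (H_perp_form D k) (E k) \<and>
     (\<exists>B. \<forall>\<omega> \<in> H_perp_form D k. H_norm K k (E k \<omega>) \<le> B * H_norm D k \<omega>) \<and>
     (\<forall>\<omega> \<in> H_perp_form D k. form_eq D (E k \<omega>) \<omega> \<and>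
        form_eq K (ext_d K k (E k \<omega>)) (E (Suc k) (ext_d D k \<omega>))))"

definition extension_constant :: "'a::euclidean_space set \<Rightarrow> 'a set \<Rightarrow> real \<Rightarrow> bool" where
  "extension_constant D K C \<longleftrightarrow> (\<exists>E. cochain_extension D K E \<and>
     (\<forall>k. \<forall>\<omega> \<in> exact_form D k. H_norm K k (E k \<omega>) \<le> (1 + C) * H_norm D k \<omega>))"

text \<open>Near the boundary point \<open>p\<close>, the set \<open>D\<close> is the part above the graph of \<open>\<gamma>\<close> in direction \<open>\<nu>\<close>
  over the hyperplane orthogonal to \<open>\<nu>\<close>.\<close>

definition lipschitz_chart :: "'a::euclidean_space set \<Rightarrow> real \<Rightarrow> 'a \<Rightarrow> real \<Rightarrow> bool" where
  "lipschitz_chart D L p s \<longleftrightarrow> p \<in> frontier D \<and>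
     (\<exists>\<nu> \<gamma>. norm \<nu> = 1 \<and> L-lipschitz_on {y. y \<bullet> \<nu> = 0} \<gamma> \<and>
        (\<forall>x \<in> ball p s. x \<in> D \<longleftrightarrow> \<gamma> ((x - p) - ((x - p) \<bullet> \<nu>) *\<^sub>R \<nu>) < (x - p) \<bullet> \<nu>))"

definition lipschitz_character :: "'a::euclidean_space set \<Rightarrow> nat \<Rightarrow> real \<Rightarrow> real \<Rightarrow> bool" where
  "lipschitz_character D N L r \<longleftrightarrow> (\<exists>A. finite A \<and> card A \<le> N \<and>
     (\<forall>(p, s) \<in> A. r \<le> s \<and> lipschitz_chart D L p s) \<and>
     frontier D \<subseteq> (\<Union>(p, s) \<in> A. ball p s))"

definition bounded_lipschitz_domain :: "'a::euclidean_space set \<Rightarrow> bool" where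
  "bounded_lipschitz_domain D \<longleftrightarrow> D \<noteq> {} \<and> open D \<and> connected D \<and> bounded D \<and>
     (\<exists>N L r. 0 < r \<and> lipschitz_character D N L r)"

definition uniform_lipschitz_character :: "(real \<Rightarrow> 'a::euclidean_space set) \<Rightarrow> bool" where
  "uniform_lipschitz_character D \<longleftrightarrow>
     (\<exists>N L r. 0 < r \<and> (\<forall>h>0. lipschitz_character (D h) N L r))"

definition polytopal_mesh :: "'a::euclidean_space set \<Rightarrow> 'a set set \<Rightarrow> bool" where
  "polytopal_mesh D T \<longleftrightarrow> finite T \<and> (\<forall>P\<in>T. polytope P \<and> interior P \<noteq> {}) \<and>
     (\<forall>P\<in>T. \<forall>Q\<in>T. P \<noteq> Q \<longrightarrow> interior P \<inter> interior Q = {}) \<and> \<Union>T = closure D"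

definition polytopal_domain :: "'a::euclidean_space set \<Rightarrow> bool" where
  "polytopal_domain D \<longleftrightarrow> D \<noteq> {} \<and> open D \<and> connected D \<and> (\<exists>T. polytopal_mesh D T)"

text \<open>No particular shape functions on the mesh cells are prescribed.\<close>

definition discrete_form_space ::
    "'a::euclidean_space set \<Rightarrow> 'a set set \<Rightarrow> nat \<Rightarrow> 'a form set \<Rightarrow> bool" where
  "discrete_form_space D T k \<Lambda> \<longleftrightarrow> polytopal_mesh D T \<and> \<Lambda> \<subseteq> H_form D k \<and>
     zero_form \<in> \<Lambda> \<and> (\<forall>\<omega>\<in>\<Lambda>. \<forall>\<eta>\<in>\<Lambda>. \<forall>a b. lincomb a \<omega> b \<eta> \<in> \<Lambda>) \<and>
     (\<exists>B. finite B \<and> B \<subseteq> \<Lambda> \<and>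
        (\<forall>\<omega>\<in>\<Lambda>. \<exists>c. form_eq D \<omega> (\<lambda>x vs. \<Sum>\<beta>\<in>B. c \<beta> * \<beta> x vs)))"

definition bounded_cochain_projection ::
    "'a::euclidean_space set \<Rightarrow> (nat \<Rightarrow> 'a form set) \<Rightarrow> real \<Rightarrow> (nat \<Rightarrow> 'a form \<Rightarrow> 'a form) \<Rightarrow> bool" where
  "bounded_cochain_projection D \<Lambda> C P \<longleftrightarrow> (\<forall>k.
     P k ` H_form D k \<subseteq> \<Lambda> k \<and>
     linear_forms D (H_form D k) (P k) \<and>
     (\<forall>\<omega> \<in> \<Lambda> k. form_eq D (P k \<omega>) \<omega>) \<and>
     (\<forall>\<tau> \<in> H_form D k. form_eq D (ext_d D k (P k \<tau>)) (P (Suc k) (ext_d D k \<tau>)) \<and>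
        H_norm D k (P k \<tau>) \<le> C * H_norm D k \<tau>))"

end

theory Submission
  imports Defs "HOL-Computational_Algebra.Polynomial"
begin

text \<open>The form \<open>\<eta> = d \<omega>\<^sub>h\<close> is exact, hence orthogonal to the harmonic forms, and its extension \<open>E \<eta>\<close> is a
  closed form on the convex set \<open>K\<close>. On \<open>K\<close> a potential \<open>\<tau>\<close> of \<open>E \<eta>\<close> is given by the homotopy operator
  \<open>\<tau>(x)(us) = \<integral>\<^sub>0\<^sup>1 t\<^sup>k (E \<eta>)(y + t (x - y))(x - y, us) dt\<close>. For a fixed base point \<open>y\<close> it need not be bounded in
  \<open>L\<^sup>2\<close>, but the average over \<open>y \<in> K\<close> of the squared norm of \<open>\<tau>\<close> is at most a constant times that of \<open>E \<eta>\<close>, so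
  some \<open>y\<close>, depending on \<open>\<eta>\<close>, is good enough. The discrete potential is \<open>\<tau>\<^sub>h = \<Pi>\<^sub>h \<tau>\<close>, and
  \<open>d \<tau>\<^sub>h = \<Pi>\<^sub>h d \<tau> = \<Pi>\<^sub>h d \<omega>\<^sub>h = d \<Pi>\<^sub>h \<omega>\<^sub>h = d \<omega>\<^sub>h\<close>.\<close>

section \<open>Smooth functions and test functions\<close>

text \<open>For a fixed base point the substitution \<open>z = y + t (x - y)\<close> costs a
  Jacobian t^(-n), which the factor t^(2k) of the squared kernel does not absorb when 2k < n; this
  is the obstacle that averaging over y removes. The price is that tau no longer depends linearly on
  eta, which is harmless as only the existence of a discrete potential is claimed. A second obstacle
  is regularity: E eta is merely square integrable, so the homotopy formula cannot be differentiated
  under the integral sign. The equation d tau = E eta is checked against test functions instead: for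
  each t the dilation is moved onto the test function, where closedness of E eta turns the
  contraction with x - y into a total derivative in t. All operators act on representatives, so d
  eta = 0 and d tau = eta hold only up to null sets; they pass through E and Pi_h because a linear
  operator with a norm bound sends null forms to null forms. The projection is bounded in the graph
  norm, so d tau = eta contributes a term of its own to the constant.\<close>

lemma frechet_derivative_eqI:
  "(f has_derivative f') (at x) \<Longrightarrow> frechet_derivative f (at x) = f'"
  using frechet_derivative_at by metis

lemma C_diff_Suc_imp: "C_diff (Suc m) f \<Longrightarrow> C_diff m f"
proof (induction m arbitrary: f)
  case 0
  then show ?case
    by (auto intro!: continuous_at_imp_continuous_on differentiable_imp_continuous_within)
next
  case (Suc m)
  then show ?case by (metis C_diff.simps(2))
qed

lemma C_diff_const: "C_diff m (\<lambda>x. c)"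
  by (induction m arbitrary: c) (auto simp: frechet_derivative_const)

lemma C_diff_add: "C_diff m f \<Longrightarrow> C_diff m g \<Longrightarrow> C_diff m (\<lambda>x. f x + g x)"
proof (induction m arbitrary: f g)
  case (Suc m)
  have "frechet_derivative (\<lambda>x. f x + g x) (at x) v =
      frechet_derivative f (at x) v + frechet_derivative g (at x) v" for x v
    using Suc.prems
    by (subst frechet_derivative_eqI[OF has_derivative_add[of f "frechet_derivative f (at x)" _ g]])
      (auto simp: frechet_derivative_works)
  with Suc show ?case by auto
qed (auto intro: continuous_intros)

lemma C_diff_mult: "C_diff m f \<Longrightarrow> C_diff m g \<Longrightarrow> C_diff m (\<lambda>x. f x * g x)"
proof (induction m arbitrary: f g)
  case (Suc m)
  have "frechet_derivative (\<lambda>x. f x * g x) (at x) v =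
      f x * frechet_derivative g (at x) v + frechet_derivative f (at x) v * g x" for x v
    using Suc.prems
    by (subst frechet_derivative_eqI[OF has_derivative_mult[of f "frechet_derivative f (at x)" _ _ g]])
      (auto simp: frechet_derivative_works)
  with Suc C_diff_Suc_imp[OF Suc.prems(1)] C_diff_Suc_imp[OF Suc.prems(2)] show ?case
    by (auto intro!: C_diff_add)
qed (auto intro: continuous_intros)

lemma C_diff_prod:
  "(\<And>i. i \<in> I \<Longrightarrow> C_diff m (f i)) \<Longrightarrow> C_diff m (\<lambda>x. \<Prod>i\<in>I. f i x)"
  by (induction I rule: infinite_finite_induct) (auto intro: C_diff_const C_diff_mult)

lemma frechet_derivative_affine:
  assumes "bounded_linear h" "f differentiable at (a + h x)"
  shows "((\<lambda>x. f (a + h x)) has_derivative (\<lambda>v. frechet_derivative f (at (a + h x)) (h v))) (at x)"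
proof -
  have "((\<lambda>x. a + h x) has_derivative h) (at x)"
    using bounded_linear_imp_has_derivative[OF assms(1)] by (auto intro!: derivative_eq_intros)
  from diff_chain_at[OF this, of f] assms(2) show ?thesis
    by (auto simp: o_def frechet_derivative_works)
qed

lemma C_diff_affine:
  assumes "bounded_linear h"
  shows "C_diff m f \<Longrightarrow> C_diff m (\<lambda>x. f (a + h x))"
proof (induction m arbitrary: f)
  case 0
  then show ?case
    using linear_continuous_on[OF assms]
    by (auto intro!: continuous_on_compose2[of UNIV f] continuous_intros)
next
  case (Suc m)
  note D = frechet_derivative_affine[OF assms, of f a]
  have "frechet_derivative (\<lambda>x. f (a + h x)) (at x) v = frechet_derivative f (at (a + h x)) (h v)" for x v
    using Suc.prems by (subst frechet_derivative_eqI[OF D]) auto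
  moreover have "C_diff m (\<lambda>x. frechet_derivative f (at (a + h x)) (h v))" for v
    using Suc.IH[of "\<lambda>x. frechet_derivative f (at x) (h v)"] Suc.prems by simp
  moreover have "(\<lambda>x. f (a + h x)) differentiable (at x)" for x
    using D[of x] Suc.prems by (auto simp: differentiable_def)
  ultimately show ?case by simp
qed

lemma C_diff_inner: "C_diff m (\<lambda>x. (x - y) \<bullet> u)"
proof (cases m)
  case (Suc l)
  have D: "((\<lambda>x. (x - y) \<bullet> u) has_derivative (\<lambda>v. v \<bullet> u)) (at x)" for x
    by (auto intro!: derivative_eq_intros)
  with Suc show ?thesis
    using D by (auto simp: differentiable_def frechet_derivative_eqI[OF D] C_diff_const)
qed (auto intro!: continuous_intros)

text \<open>The classical smooth function exp(-1/t) for t > 0, continued by 0, with a polynomial in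
  1/t as a factor. The factor makes the family closed under differentiation, so smoothness of all
  members follows by one induction.\<close>

definition flat :: "real poly \<Rightarrow> real \<Rightarrow> real" where
  "flat p t = (if 0 < t then poly p (1 / t) * exp (- (1 / t)) else 0)"

text \<open>With s = 1/t the exponential beats every polynomial as s tends to infinity; from the
  left the function is 0.\<close>

lemma flat_tendsto: "(flat p \<longlongrightarrow> 0) (at 0)"
proof -
  have "((\<lambda>s. poly p s / exp s) \<longlongrightarrow> 0) at_top"
  proof -
    have "((\<lambda>s. \<Sum>i\<le>degree p. coeff p i * (s ^ i / exp s)) \<longlongrightarrow> (\<Sum>i\<le>degree p. coeff p i * 0)) at_top"
      by (intro tendsto_intros tendsto_power_div_exp_0)
    then show ?thesis by (simp add: poly_altdef sum_divide_distrib)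
  qed
  from filterlim_compose[OF this filterlim_inverse_at_top_right]
  have "((\<lambda>t. poly p (1 / t) * exp (- (1 / t))) \<longlongrightarrow> 0) (at_right (0::real))"
    by (simp add: o_def exp_minus field_simps)
  then have "(flat p \<longlongrightarrow> 0) (at_right 0)"
    by (rule Lim_transform_eventually) (auto simp: flat_def eventually_at_filter)
  moreover have "(flat p \<longlongrightarrow> 0) (at_left 0)"
    by (rule tendsto_eventually) (auto simp: flat_def eventually_at_filter)
  ultimately show ?thesis by (simp add: filterlim_at_split)
qed

text \<open>With s = 1/t the product rule gives s^2 (p(s) - p'(s)) exp(-s), and
  \<open>[:0, 0, 1:]\<close> is the monomial s^2.\<close>

lemma flat_has_derivative:
  "(flat p has_field_derivative flat ([:0, 0, 1:] * (p - pderiv p)) t) (at t)"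
proof -
  consider "t > 0" | "t = 0" | "t < 0" by linarith
  then show ?thesis
  proof cases
    case 1
    have "((\<lambda>t. poly p (1 / t) * exp (- (1 / t))) has_field_derivative
        flat ([:0, 0, 1:] * (p - pderiv p)) t) (at t)"
      using 1 by (auto intro!: derivative_eq_intros simp: flat_def)
        (simp add: field_simps power2_eq_square)
    then show ?thesis
      by (rule has_field_derivative_transform_within_open[of _ _ _ "{0<..}"])
        (use 1 in \<open>auto simp: flat_def\<close>)
  next
    case 2
    \<comment> \<open>The difference quotient at 0 is again a member of the family, for the
      polynomial s p(s), which is \<open>pCons 0 p\<close>.\<close>
    have "((\<lambda>h. (flat p (0 + h) - flat p 0) / h) \<longlongrightarrow> 0) (at 0)"
      by (rule Lim_transform_eventually[OF flat_tendsto[of "pCons 0 p"]])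
        (auto simp: flat_def eventually_at_filter)
    then show ?thesis using 2 by (simp add: DERIV_def flat_def)
  next
    case 3
    have "((\<lambda>t. 0) has_field_derivative flat ([:0, 0, 1:] * (p - pderiv p)) t) (at t)"
      using 3 by (simp add: flat_def)
    then show ?thesis
      by (rule has_field_derivative_transform_within_open[of _ _ _ "{..<0}"])
        (use 3 in \<open>auto simp: flat_def\<close>)
  qed
qed

lemma C_diff_flat: "C_diff m (flat p)"
proof (induction m arbitrary: p)
  case 0
  show ?case
    using flat_has_derivative[of p]
    by (auto intro!: continuous_at_imp_continuous_on DERIV_isCont)
next
  case (Suc m)
  have D: "(flat p has_derivative (\<lambda>v. flat ([:0, 0, 1:] * (p - pderiv p)) t * v)) (at t)" for t
    using flat_has_derivative[of p t] by (simp add: has_field_derivative_def)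
  show ?case
    using D Suc
    by (auto simp: differentiable_def frechet_derivative_eqI[OF D] intro!: C_diff_mult C_diff_const)
qed

section \<open>Test functions and their derivatives\<close>

lemma test_functionD:
  assumes "test_function D \<phi>"
  shows "C_diff m \<phi>" "\<phi> differentiable at x" "continuous_on UNIV \<phi>"
    "continuous_on UNIV (\<lambda>x. frechet_derivative \<phi> (at x) v)" "\<phi> x \<noteq> 0 \<Longrightarrow> x \<in> D"
    "compact (closure {x. \<phi> x \<noteq> 0})"
proof -
  have C: "C_diff m \<phi>" for m using assms by (auto simp: test_function_def)
  show "C_diff m \<phi>" by fact
  from C[of "Suc 0"] show "\<phi> differentiable at x" "continuous_on UNIV (\<lambda>x. frechet_derivative \<phi> (at x) v)"
    by auto
  from C[of 0] show "continuous_on UNIV \<phi>" by auto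
  show "\<phi> x \<noteq> 0 \<Longrightarrow> x \<in> D"
    using assms closure_subset[of "{x. \<phi> x \<noteq> 0}"] by (auto simp: test_function_def)
  show "compact (closure {x. \<phi> x \<noteq> 0})" using assms by (auto simp: test_function_def)
qed

lemma frechet_derivative_eq_0_outside:
  assumes "x \<notin> closure {x. \<phi> x \<noteq> 0}"
  shows "frechet_derivative \<phi> (at x) v = (0::real)"
proof -
  have "(\<phi> has_derivative (\<lambda>v. 0)) (at x)"
    by (rule has_derivative_transform_within_open[of "\<lambda>x. 0" _ _ _ "- closure {x. \<phi> x \<noteq> 0}"])
      (use assms closure_subset[of "{x. \<phi> x \<noteq> 0}"] in auto)
  from frechet_derivative_eqI[OF this] show ?thesis by simp
qed

lemma test_function_frechet_derivative:
  assumes "test_function D \<phi>"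
  shows "test_function D (\<lambda>x. frechet_derivative \<phi> (at x) v)"
proof -
  have sub: "closure {x. frechet_derivative \<phi> (at x) v \<noteq> 0} \<subseteq> closure {x. \<phi> x \<noteq> 0}"
    by (rule closure_minimal) (use frechet_derivative_eq_0_outside in auto)
  moreover have "compact (closure {x. frechet_derivative \<phi> (at x) v \<noteq> 0})"
    using compact_Int_closed[OF test_functionD(6)[OF assms], of "closure {x. frechet_derivative \<phi> (at x) v \<noteq> 0}"]
      sub by (simp add: Int_absorb1)
  moreover have "C_diff m (\<lambda>x. frechet_derivative \<phi> (at x) v)" for m
    using test_functionD(1)[OF assms, of "Suc m"] by simp
  ultimately show ?thesis
    using assms by (auto simp: test_function_def)
qed

lemma test_function_subset: "test_function D \<phi> \<Longrightarrow> D \<subseteq> D' \<Longrightarrow> test_function D' \<phi>"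
  by (auto simp: test_function_def)

lemma test_function_bounded:
  assumes "test_function D \<phi>"
  shows "\<exists>B. \<forall>x. \<bar>\<phi> x\<bar> \<le> B"
proof -
  have "compact (\<phi> ` closure {x. \<phi> x \<noteq> 0})"
    using test_functionD[OF assms] by (metis compact_continuous_image continuous_on_subset subset_UNIV)
  then obtain B where B: "\<And>x. x \<in> closure {x. \<phi> x \<noteq> 0} \<Longrightarrow> \<bar>\<phi> x\<bar> \<le> B"
    using compact_imp_bounded by (force simp: bounded_iff)
  have "\<bar>\<phi> x\<bar> \<le> max B 0" for x
    using B[of x] closure_subset[of "{x. \<phi> x \<noteq> 0}"] by (cases "\<phi> x = 0") auto
  then show ?thesis by blast
qed

lemma test_function_measurable:
  assumes "test_function D \<phi>"
  shows "\<phi> \<in> borel_measurable borel" "(\<lambda>x. frechet_derivative \<phi> (at x) v) \<in> borel_measurable borel"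
  using test_functionD(3,4)[OF assms] by (auto intro: borel_measurable_continuous_onI)

text \<open>Two applications of the mean value theorem, in direction u to the increment along v and
  then in direction v to the u-derivative, turn the quotient into the mixed derivative at a nearby
  point; continuity of that derivative gives the limit.\<close>

lemma second_difference_tendsto:
  fixes \<phi> :: "'a::euclidean_space \<Rightarrow> real"
  assumes C: "C_diff 2 \<phi>"
  shows "((\<lambda>h. (\<phi> (x + h *\<^sub>R u + h *\<^sub>R v) - \<phi> (x + h *\<^sub>R u) - \<phi> (x + h *\<^sub>R v) + \<phi> x) / h\<^sup>2)
    \<longlongrightarrow> frechet_derivative (\<lambda>x. frechet_derivative \<phi> (at x) u) (at x) v) (at_right 0)"
proof -
  define \<phi>u where "\<phi>u = (\<lambda>x. frechet_derivative \<phi> (at x) u)"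
  define \<phi>uv where "\<phi>uv = (\<lambda>x. frechet_derivative \<phi>u (at x) v)"
  from C have d1: "\<And>x. \<phi> differentiable at x" and d2: "\<And>x. \<phi>u differentiable at x"
    and c: "continuous_on UNIV \<phi>uv"
    by (auto simp: numeral_2_eq_2 \<phi>u_def \<phi>uv_def)
  have line: "((\<lambda>s. f (a + s *\<^sub>R w)) has_real_derivative frechet_derivative f (at (a + s *\<^sub>R w)) w) (at s)"
    if "\<And>x. f differentiable at x" for f and a w :: 'a and s :: real
  proof -
    have "bounded_linear (\<lambda>s::real. s *\<^sub>R w)" by (rule bounded_linear_scaleR_left)
    from frechet_derivative_affine[OF this, of f a s] that
    have "((\<lambda>s. f (a + s *\<^sub>R w)) has_derivative (\<lambda>r. frechet_derivative f (at (a + s *\<^sub>R w)) (r *\<^sub>R w))) (at s)"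
      by auto
    moreover have "frechet_derivative f (at (a + s *\<^sub>R w)) (r *\<^sub>R w) =
        frechet_derivative f (at (a + s *\<^sub>R w)) w * r" for r
      using linear_frechet_derivative[OF that] by (simp add: linear_cmul)
    ultimately show ?thesis by (simp add: has_field_derivative_def)
  qed
  have mvt: "\<exists>\<xi> \<theta>. 0 < \<xi> \<and> \<xi> < h \<and> 0 < \<theta> \<and> \<theta> < h \<and>
      (\<phi> (x + h *\<^sub>R u + h *\<^sub>R v) - \<phi> (x + h *\<^sub>R u) - \<phi> (x + h *\<^sub>R v) + \<phi> x) / h\<^sup>2 =
      \<phi>uv (x + \<xi> *\<^sub>R u + \<theta> *\<^sub>R v)" if h: "h > 0" for h
  proof -
    define F where "F s = \<phi> ((x + h *\<^sub>R v) + s *\<^sub>R u) - \<phi> (x + s *\<^sub>R u)" for s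
    have "(F has_real_derivative \<phi>u ((x + h *\<^sub>R v) + s *\<^sub>R u) - \<phi>u (x + s *\<^sub>R u)) (at s)" for s
      unfolding F_def \<phi>u_def by (intro DERIV_diff line d1)
    from MVT2[OF h this] obtain \<xi> where \<xi>: "0 < \<xi>" "\<xi> < h"
      and F: "F h - F 0 = (h - 0) * (\<phi>u ((x + h *\<^sub>R v) + \<xi> *\<^sub>R u) - \<phi>u (x + \<xi> *\<^sub>R u))" by blast
    have "((\<lambda>s. \<phi>u ((x + \<xi> *\<^sub>R u) + s *\<^sub>R v)) has_real_derivative
        \<phi>uv ((x + \<xi> *\<^sub>R u) + s *\<^sub>R v)) (at s)" for s
      unfolding \<phi>uv_def by (intro line d2)
    from MVT2[OF h this] obtain \<theta> where \<theta>: "0 < \<theta>" "\<theta> < h"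
      and G: "\<phi>u ((x + \<xi> *\<^sub>R u) + h *\<^sub>R v) - \<phi>u ((x + \<xi> *\<^sub>R u) + 0 *\<^sub>R v) =
        (h - 0) * \<phi>uv ((x + \<xi> *\<^sub>R u) + \<theta> *\<^sub>R v)" by blast
    have "\<phi> (x + h *\<^sub>R u + h *\<^sub>R v) - \<phi> (x + h *\<^sub>R u) - \<phi> (x + h *\<^sub>R v) + \<phi> x = F h - F 0"
      by (simp add: F_def algebra_simps)
    also have "\<dots> = h\<^sup>2 * \<phi>uv (x + \<xi> *\<^sub>R u + \<theta> *\<^sub>R v)"
      using F G by (simp add: algebra_simps power2_eq_square)
    finally show ?thesis using \<xi> \<theta> h by auto
  qed
  have "((\<lambda>h. (\<phi> (x + h *\<^sub>R u + h *\<^sub>R v) - \<phi> (x + h *\<^sub>R u) - \<phi> (x + h *\<^sub>R v) + \<phi> x) / h\<^sup>2)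
    \<longlongrightarrow> \<phi>uv x) (at_right 0)"
  proof (rule tendstoI)
    fix e :: real assume "e > 0"
    with c obtain d where d: "d > 0" "\<And>y. dist y x < d \<Longrightarrow> dist (\<phi>uv y) (\<phi>uv x) < e"
      by (force simp: continuous_on_iff)
    \<comment> \<open>For h < d / N the intermediate point stays within d of x; the summand 1 keeps
      N positive when u = v = 0.\<close>
    define N where "N = norm u + norm v + 1"
    have N: "N > 0" by (simp add: N_def add_nonneg_pos)
    have "dist ((\<phi> (x + h *\<^sub>R u + h *\<^sub>R v) - \<phi> (x + h *\<^sub>R u) - \<phi> (x + h *\<^sub>R v) + \<phi> x) / h\<^sup>2) (\<phi>uv x) < e"
      if h: "0 < h" "h < d / N" for h
    proof -
      from mvt[OF h(1)] obtain \<xi> \<theta> where *: "0 < \<xi>" "\<xi> < h" "0 < \<theta>" "\<theta> < h"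
        "(\<phi> (x + h *\<^sub>R u + h *\<^sub>R v) - \<phi> (x + h *\<^sub>R u) - \<phi> (x + h *\<^sub>R v) + \<phi> x) / h\<^sup>2 =
          \<phi>uv (x + \<xi> *\<^sub>R u + \<theta> *\<^sub>R v)" by blast
      have "dist (x + \<xi> *\<^sub>R u + \<theta> *\<^sub>R v) x \<le> \<xi> * norm u + \<theta> * norm v"
        using norm_triangle_ineq[of "\<xi> *\<^sub>R u" "\<theta> *\<^sub>R v"] * by (simp add: dist_norm)
      also have "\<dots> \<le> h * norm u + h * norm v"
        using * by (intro add_mono mult_right_mono) auto
      also have "\<dots> \<le> h * N" using h by (simp add: N_def algebra_simps)
      also have "\<dots> < d" using h N by (simp add: field_simps)
      finally show ?thesis using d(2) *(5) by simp
    qed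
    moreover have "d / N > 0" using d N by simp
    ultimately show "\<forall>\<^sub>F h in at_right 0. dist ((\<phi> (x + h *\<^sub>R u + h *\<^sub>R v) - \<phi> (x + h *\<^sub>R u)
        - \<phi> (x + h *\<^sub>R v) + \<phi> x) / h\<^sup>2) (\<phi>uv x) < e"
      by (auto simp: eventually_at_right)
  qed
  then show ?thesis by (simp add: \<phi>uv_def \<phi>u_def)
qed

text \<open>The second difference is symmetric in u and v, so both mixed derivatives are limits of
  the same quotient.\<close>

lemma frechet_derivative_commute:
  fixes \<phi> :: "'a::euclidean_space \<Rightarrow> real"
  assumes "C_diff 2 \<phi>"
  shows "frechet_derivative (\<lambda>x. frechet_derivative \<phi> (at x) u) (at x) v =
    frechet_derivative (\<lambda>x. frechet_derivative \<phi> (at x) v) (at x) u"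
  using second_difference_tendsto[OF assms, of x u v] second_difference_tendsto[OF assms, of x v u]
  by (intro tendsto_unique[OF trivial_limit_at_right_real]) (auto simp: algebra_simps)

section \<open>Alternating forms\<close>

text \<open>The index set of the sum in \<open>form_inner\<close>. Working with all k-tuples rather
  than increasing ones lets the head be split off freely in inductions on k.\<close>

definition basis_lists :: "nat \<Rightarrow> 'a::euclidean_space list set" where
  "basis_lists k = {vs. length vs = k \<and> set vs \<subseteq> Basis}"

lemma finite_basis_lists [simp]: "finite (basis_lists k)"
  using finite_lists_length_eq[OF finite_Basis, of k] by (simp add: basis_lists_def conj_commute)

lemma basis_lists_0 [simp]: "basis_lists 0 = {[]}"
  by (auto simp: basis_lists_def)

lemma sum_basis_lists_Suc:
  fixes g :: "'a::euclidean_space list \<Rightarrow> real"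
  shows "(\<Sum>vs\<in>basis_lists (Suc k). g vs) = (\<Sum>b\<in>Basis. \<Sum>vs\<in>basis_lists k. g (b # vs))"
proof -
  have "basis_lists (Suc k) = (\<lambda>(b, vs). b # vs) ` (Basis \<times> (basis_lists k :: 'a list set))"
    by (auto simp: basis_lists_def length_Suc_conv image_def)
  moreover have "inj_on (\<lambda>(b, vs). b # vs) (Basis \<times> (basis_lists k :: 'a list set))"
    by (auto simp: inj_on_def)
  ultimately have "(\<Sum>vs\<in>basis_lists (Suc k). g vs) =
      (\<Sum>p\<in>Basis \<times> basis_lists k. g ((\<lambda>(b, vs). b # vs) p))"
    by (simp only: sum.reindex o_def)
  then show ?thesis by (simp add: sum.cartesian_product case_prod_unfold)
qed

lemma form_inner_eq: "form_inner k f g = (\<Sum>vs\<in>basis_lists k. f vs * g vs) / fact k"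
  by (simp add: form_inner_def basis_lists_def)

lemma form_inner_commute: "form_inner k f g = form_inner k g f"
  by (simp add: form_inner_def mult.commute)

lemma form_inner_nonneg: "0 \<le> form_inner k f f"
  by (simp add: form_inner_def sum_nonneg)

lemma alternating_length: "alternating k f \<Longrightarrow> length vs \<noteq> k \<Longrightarrow> f vs = 0"
  by (simp add: alternating_def)

lemma alternating_linear:
  assumes "alternating k f" "Suc (length us + length ws) = k"
  shows "linear (\<lambda>v. f (us @ v # ws))"
proof -
  have "\<forall>vs i. length vs = k \<and> i < k \<longrightarrow> linear (\<lambda>v. f (vs[i := v]))"
    using assms(1) by (simp add: alternating_def)
  from this[rule_format, of "us @ 0 # ws" "length us"] assms(2) show ?thesis by simp
qed

text \<open>For \<open>us\<close> of the wrong length the form is 0, hence linear as well;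
  expansions in the first slot thus hold for all lists.\<close>

lemma alternating_linear_Cons:
  assumes "alternating (Suc k) f"
  shows "linear (\<lambda>v. f (v # us))"
proof (cases "length us = k")
  case True
  with alternating_linear[OF assms, of "[]" us] show ?thesis by simp
next
  case False
  then have "(\<lambda>v. f (v # us)) = (\<lambda>v. 0)" using assms by (auto simp: alternating_def)
  then show ?thesis by (simp add: linear_zero)
qed

lemma alternating_expand:
  assumes "alternating (Suc k) f"
  shows "f (v # us) = (\<Sum>b\<in>Basis. (v \<bullet> b) * f (b # us))"
proof -
  have "f (v # us) = f ((\<Sum>b\<in>Basis. (v \<bullet> b) *\<^sub>R b) # us)" by (subst euclidean_representation) (rule refl)
  also have "\<dots> = (\<Sum>b\<in>Basis. (v \<bullet> b) * f (b # us))"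
    by (subst linear_sum[OF alternating_linear_Cons[OF assms, of us]])
      (simp add: linear_cmul[OF alternating_linear_Cons[OF assms, of us]])
  finally show ?thesis .
qed

text \<open>Polarisation: expand the vanishing value at a + b in both slots.\<close>

lemma alternating_swap:
  assumes f: "alternating k f" and len: "Suc (Suc (length us + length ws)) = k"
  shows "f (us @ a # b # ws) = - f (us @ b # a # ws)"
proof -
  have lin1: "linear (\<lambda>v. f (us @ v # c # ws))" for c
    using alternating_linear[OF f, of us "c # ws"] len by simp
  have lin2: "linear (\<lambda>v. f (us @ c # v # ws))" for c
    using alternating_linear[OF f, of "us @ [c]" ws] len by simp
  have zero: "f (us @ c # c # ws) = 0" for c
    using f len by (simp add: alternating_def)
  have "0 = f (us @ (a + b) # (a + b) # ws)" by (simp add: zero)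
  also have "\<dots> = f (us @ a # b # ws) + f (us @ b # a # ws)"
    using linear_add[OF lin1] linear_add[OF lin2] zero[of a] zero[of b] by simp
  finally show ?thesis by simp
qed

text \<open>One transposition for each entry that v passes; the induction hands the last entry of
  \<open>us\<close> over to \<open>ws\<close>.\<close>

lemma alternating_move:
  assumes f: "alternating k f"
  shows "Suc (length us + length ws) = k \<Longrightarrow> f (v # us @ ws) = (-1) ^ length us * f (us @ v # ws)"
proof (induction us arbitrary: ws rule: rev_induct)
  case (snoc a us)
  from snoc.IH[of "a # ws"] snoc.prems alternating_swap[OF f, of us ws v a] show ?case by simp
qed simp

lemma alternating_move_nth:
  assumes "alternating k f" "length vs = k" "i < k"
  shows "f (vs ! i # take i vs @ drop (Suc i) vs) = (-1) ^ i * f vs"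
proof -
  have "f (vs ! i # take i vs @ drop (Suc i) vs) = (-1) ^ i * f (take i vs @ vs ! i # drop (Suc i) vs)"
    using alternating_move[OF assms(1), of "take i vs" "drop (Suc i) vs" "vs ! i"] assms by auto
  then show ?thesis using assms by (simp add: id_take_nth_drop[symmetric])
qed

lemma alternating_Cons:
  assumes "alternating (Suc k) f"
  shows "alternating k (\<lambda>us. f (v # us))"
proof -
  have "linear (\<lambda>w. f (v # vs[i := w]))" if "length vs = k" "i < k" for vs i
  proof -
    have "\<forall>vs i. length vs = Suc k \<and> i < Suc k \<longrightarrow> linear (\<lambda>w. f (vs[i := w]))"
      using assms by (simp add: alternating_def)
    from this[rule_format, of "v # vs" "Suc i"] that show ?thesis by simp
  qed
  moreover have "f (v # us) = 0" if "length us \<noteq> k \<or> \<not> distinct us" for us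
    using that assms by (auto simp: alternating_def)
  ultimately show ?thesis unfolding alternating_def by simp
qed

lemma alternating_zero: "alternating k (\<lambda>vs. 0)"
  by (simp add: alternating_def linear_zero)

lemma alternating_lincomb:
  assumes "alternating k f" "alternating k g"
  shows "alternating k (\<lambda>vs. a * f vs + b * g vs)"
proof -
  have "linear (\<lambda>v. a * f (vs[i := v]) + b * g (vs[i := v]))" if "length vs = k" "i < k" for vs i
  proof -
    have "linear (\<lambda>v. f (vs[i := v]))" "linear (\<lambda>v. g (vs[i := v]))"
      using assms that by (auto simp: alternating_def)
    then show ?thesis
      using linear_add[of "\<lambda>v. f (vs[i := v])"] linear_add[of "\<lambda>v. g (vs[i := v])"]
        linear_cmul[of "\<lambda>v. f (vs[i := v])"] linear_cmul[of "\<lambda>v. g (vs[i := v])"]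
      by (intro linearI) (simp_all add: algebra_simps)
  qed
  then show ?thesis using assms by (simp add: alternating_def)
qed

text \<open>Expanding one slot after another in the basis. \<open>L2_form\<close> asks for square
  integrability at every list of vectors, and this reduces such demands to the finitely many basis
  components.\<close>

lemma alternating_bound:
  assumes "alternating k f"
  shows "\<bar>f ws\<bar> \<le> prod_list (map norm ws) * (\<Sum>bs\<in>basis_lists k. \<bar>f bs\<bar>)"
proof (cases "length ws = k")
  case True
  then show ?thesis using assms
  proof (induction k arbitrary: ws f)
    case (Suc k)
    then obtain v us where ws: "ws = v # us" "length us = k" by (auto simp: length_Suc_conv)
    have "\<bar>f ws\<bar> \<le> (\<Sum>b\<in>Basis. \<bar>(v \<bullet> b) * f (b # us)\<bar>)"
      unfolding ws alternating_expand[OF Suc.prems(2), of v us] by (rule sum_abs)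
    also have "\<dots> \<le> (\<Sum>b\<in>Basis. norm v * (prod_list (map norm us) * (\<Sum>bs\<in>basis_lists k. \<bar>f (b # bs)\<bar>)))"
    proof (rule sum_mono)
      fix b :: 'a assume "b \<in> Basis"
      then show "\<bar>(v \<bullet> b) * f (b # us)\<bar> \<le>
          norm v * (prod_list (map norm us) * (\<Sum>bs\<in>basis_lists k. \<bar>f (b # bs)\<bar>))"
        unfolding abs_mult
        by (intro mult_mono Basis_le_norm Suc.IH[OF ws(2) alternating_Cons[OF Suc.prems(2)]]) auto
    qed
    also have "\<dots> = prod_list (map norm ws) * (\<Sum>bs\<in>basis_lists (Suc k). \<bar>f bs\<bar>)"
      by (simp add: sum_basis_lists_Suc ws sum_distrib_left mult.assoc)
    finally show ?case .
  qed simp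
next
  case False
  have "prod_list (map norm ws) \<ge> 0" by (induction ws) auto
  with False show ?thesis using alternating_length[OF assms, of ws] by (simp add: sum_nonneg)
qed

lemma alternating_eqI:
  assumes "alternating k f" "alternating k g" "\<And>bs. bs \<in> basis_lists k \<Longrightarrow> f bs = g bs"
  shows "f = g"
proof
  fix ws
  from alternating_bound[OF alternating_lincomb[OF assms(1,2), of 1 "-1"], of ws] assms(3)
  show "f ws = g ws" by simp
qed

section \<open>The fundamental lemma of the calculus of variations\<close>

lemma tendsto_flat_one: "(\<lambda>n. flat 1 (real n * t)) \<longlonglongrightarrow> (if 0 < t then 1 else 0)"
proof (cases "0 < t")
  case True
  have "(\<lambda>n. exp (- (inverse (real n) * (1 / t)))) \<longlonglongrightarrow> exp (- (0 * (1 / t)))"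
    by (intro tendsto_intros lim_inverse_n)
  moreover have "\<forall>\<^sub>F n in sequentially. exp (- (inverse (real n) * (1 / t))) = flat 1 (real n * t)"
    using eventually_gt_at_top[of 0] by eventually_elim (use True in \<open>simp add: flat_def field_simps\<close>)
  ultimately show ?thesis using True by (auto intro: Lim_transform_eventually)
next
  case False
  then have "flat 1 (real n * t) = 0" for n
    by (simp add: flat_def not_less mult_nonneg_nonpos)
  then show ?thesis using False by simp
qed

lemma flat_one_bounds: "0 \<le> flat 1 t" "flat 1 t \<le> 1"
  by (auto simp: flat_def)

text \<open>The functions \<open>flat 1 (n t)\<close> increase to the indicator of \<open>t > 0\<close>, so products of them are test
  functions converging to the indicator of a box.\<close>

lemma box_integral_eq_0:
  fixes f :: "'a::euclidean_space \<Rightarrow> real"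
  assumes f: "integrable lborel f"
    and test: "\<And>\<phi>. test_function D \<phi> \<Longrightarrow> (\<integral>x. f x * \<phi> x \<partial>lborel) = 0"
    and sub: "cbox p q \<subseteq> D"
  shows "(\<integral>x. f x * indicator (box p q) x \<partial>lborel) = 0"
proof -
  \<comment> \<open>One factor for each face of the box: for n > 0 the product is positive exactly
    on the open box.\<close>
  define \<phi> where "\<phi> n x = (\<Prod>b\<in>Basis. flat 1 (real n * ((x - p) \<bullet> b)) * flat 1 (real n * ((q - x) \<bullet> b)))"
    for n x
  have [measurable]: "f \<in> borel_measurable borel" using f by auto
  have smooth: "C_diff m (\<phi> n)" for m n
  proof -
    have "C_diff m (\<lambda>x. flat 1 (- (real n * (p \<bullet> b)) + real n * (x \<bullet> b)))"
      "C_diff m (\<lambda>x. flat 1 (real n * (q \<bullet> b) + (- real n) * (x \<bullet> b)))" for b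
      by (intro C_diff_affine[OF _ C_diff_flat] bounded_linear_const_mult bounded_linear_inner_left)+
    then show ?thesis unfolding \<phi>_def by (intro C_diff_prod C_diff_mult) (simp_all add: algebra_simps)
  qed
  have [measurable]: "\<phi> n \<in> borel_measurable borel" for n
    using smooth[of 0] by (auto intro: borel_measurable_continuous_onI)
  have supp: "x \<in> box p q" if "\<phi> n x \<noteq> 0" for n x
  proof (rule ccontr)
    assume "x \<notin> box p q"
    then obtain b where b: "b \<in> Basis" "(x - p) \<bullet> b \<le> 0 \<or> (q - x) \<bullet> b \<le> 0"
      by (auto simp: mem_box inner_diff_left not_less)
    then have "real n * ((x - p) \<bullet> b) \<le> 0 \<or> real n * ((q - x) \<bullet> b) \<le> 0"
      by (auto intro: mult_nonneg_nonpos)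
    then have "flat 1 (real n * ((x - p) \<bullet> b)) * flat 1 (real n * ((q - x) \<bullet> b)) = 0"
      by (auto simp: flat_def)
    then have "\<phi> n x = 0"
      unfolding \<phi>_def using b(1) by (intro prod_zero) auto
    with that show False by simp
  qed
  have test_\<phi>: "test_function D (\<phi> n)" for n
  proof -
    have "closure {x. \<phi> n x \<noteq> 0} \<subseteq> cbox p q"
      by (rule closure_minimal) (use supp box_subset_cbox[of p q] in auto)
    then show ?thesis
      using smooth sub compact_Int_closed[OF compact_cbox[of p q] closed_closure[of "{x. \<phi> n x \<noteq> 0}"]]
      by (auto simp: test_function_def Int_absorb1)
  qed
  have bound: "\<bar>\<phi> n x\<bar> \<le> 1" for n x
  proof -
    have "0 \<le> flat 1 s * flat 1 t \<and> flat 1 s * flat 1 t \<le> 1" for s t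
      using flat_one_bounds[of s] flat_one_bounds[of t] mult_mono[of "flat 1 s" 1 "flat 1 t" 1] by auto
    then show ?thesis
      unfolding \<phi>_def by (subst abs_of_nonneg) (auto intro!: prod_nonneg prod_le_1)
  qed
  have lim: "(\<lambda>n. \<phi> n x) \<longlonglongrightarrow> indicator (box p q) x" for x
  proof -
    have "(\<lambda>n. \<phi> n x) \<longlonglongrightarrow> (\<Prod>b\<in>Basis. (if 0 < (x - p) \<bullet> b then 1 else 0) * (if 0 < (q - x) \<bullet> b then 1 else 0))"
      unfolding \<phi>_def by (intro tendsto_intros tendsto_flat_one)
    also have "(\<Prod>b\<in>Basis. (if 0 < (x - p) \<bullet> b then 1 else 0) * (if 0 < (q - x) \<bullet> b then 1 else 0)) =
        (indicator (box p q) x :: real)"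
    proof (cases "x \<in> box p q")
      case True
      then show ?thesis by (auto simp: mem_box inner_diff_left intro!: prod.neutral)
    next
      case False
      then obtain b where "b \<in> Basis" "\<not> (0 < (x - p) \<bullet> b \<and> 0 < (q - x) \<bullet> b)"
        by (auto simp: mem_box inner_diff_left)
      with False show ?thesis by (auto intro!: prod_zero)
    qed
    finally show ?thesis .
  qed
  have "(\<lambda>n. \<integral>x. f x * \<phi> n x \<partial>lborel) \<longlonglongrightarrow> (\<integral>x. f x * indicator (box p q) x \<partial>lborel)"
  proof (rule integral_dominated_convergence)
    show "integrable lborel (\<lambda>x. \<bar>f x\<bar>)" using f by simp
    show "AE x in lborel. (\<lambda>n. f x * \<phi> n x) \<longlonglongrightarrow> f x * indicator (box p q) x"
      by (intro AE_I2 tendsto_intros lim)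
    show "AE x in lborel. norm (f x * \<phi> n x) \<le> \<bar>f x\<bar>" for n
    proof (rule AE_I2)
      fix x show "norm (f x * \<phi> n x) \<le> \<bar>f x\<bar>"
        using mult_left_mono[OF bound[of n x], of "\<bar>f x\<bar>"] by (simp add: abs_mult)
    qed
  qed auto
  then show ?thesis unfolding test[OF test_\<phi>] by (simp add: LIMSEQ_const_iff)
qed

text \<open>The positive and negative parts of f are densities of two measures that agree on boxes.
  Boxes are stable under intersection and generate the Borel sets, so the measures coincide, and
  densities are unique almost everywhere.\<close>

lemma AE_eq_0_of_box_integrals:
  fixes f :: "'a::euclidean_space \<Rightarrow> real"
  assumes f: "integrable lborel f"
    and box: "\<And>a b. (\<integral>x. f x * indicator (box a b) x \<partial>lborel) = 0"
  shows "AE x in lborel. f x = 0"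
proof -
  let ?E = "range (\<lambda>(a, b). box a b :: 'a set)"
  let ?M = "density lborel (\<lambda>x. ennreal (f x))" and ?N = "density lborel (\<lambda>x. ennreal (- f x))"
  have [measurable]: "f \<in> borel_measurable borel" using f by auto
  have fin: "(\<integral>\<^sup>+x. ennreal (f x) * indicator S x \<partial>lborel) < \<infinity>"
    "(\<integral>\<^sup>+x. ennreal (- f x) * indicator S x \<partial>lborel) < \<infinity>" if "S \<in> sets borel" for S
  proof -
    have "(\<integral>\<^sup>+x. ennreal (f x) * indicator S x \<partial>lborel) \<le> (\<integral>\<^sup>+x. ennreal (norm (f x)) \<partial>lborel)"
      "(\<integral>\<^sup>+x. ennreal (- f x) * indicator S x \<partial>lborel) \<le> (\<integral>\<^sup>+x. ennreal (norm (f x)) \<partial>lborel)"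
      by (intro nn_integral_mono; auto simp: indicator_def intro!: ennreal_leI)+
    with f show "(\<integral>\<^sup>+x. ennreal (f x) * indicator S x \<partial>lborel) < \<infinity>"
      "(\<integral>\<^sup>+x. ennreal (- f x) * indicator S x \<partial>lborel) < \<infinity>"
      by (auto simp: integrable_iff_bounded)
  qed
  have "?M = ?N"
  proof (rule measure_eqI_generator_eq)
    show "Int_stable ?E" by (auto simp: Int_stable_def box_Int_box)
    show "?E \<subseteq> Pow UNIV" "sets ?M = sigma_sets UNIV ?E" "sets ?N = sigma_sets UNIV ?E"
      by (simp_all add: borel_eq_box)
    let ?A = "\<lambda>n::nat. box (- (real n *\<^sub>R One)) (real n *\<^sub>R One) :: 'a set"
    show "range ?A \<subseteq> ?E" "(\<Union>i. ?A i) = UNIV" unfolding UN_box_eq_UNIV by auto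
    show "emeasure ?M (?A i) \<noteq> \<infinity>" for i
      using fin(1)[of "?A i"] by (simp add: emeasure_density)
    show "emeasure ?M X = emeasure ?N X" if "X \<in> ?E" for X
    proof -
      from that obtain a b where X: "X = box a b" by auto
      have "integrable lborel (\<lambda>x. f x * indicator X x)"
        using integrable_mult_indicator[of X lborel f] f X by (simp add: mult.commute)
      from real_lebesgue_integral_def[OF this] box[of a b]
      have "enn2real (\<integral>\<^sup>+x. ennreal (f x * indicator X x) \<partial>lborel) =
          enn2real (\<integral>\<^sup>+x. ennreal (- (f x * indicator X x)) \<partial>lborel)" by (simp add: X)
      moreover have "ennreal (f x * indicator X x) = ennreal (f x) * indicator X x"
        "ennreal (- (f x * indicator X x)) = ennreal (- f x) * indicator X x" for x
        by (auto simp: indicator_def)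
      ultimately show ?thesis
        using fin[of X] by (simp add: emeasure_density X) (metis ennreal_enn2real)
    qed
  qed
  then have "AE x in lborel. ennreal (f x) = ennreal (- f x)"
    by (intro sigma_finite_measure.density_unique[OF sigma_finite_lborel]) auto
  \<comment> \<open>\<open>ennreal\<close> truncates negative reals to 0, so the two sides are the
    positive and the negative part of f x, which are never both nonzero.\<close>
  then show ?thesis
    by eventually_elim (metis ennreal_eq_0_iff ennreal_neg le_cases neg_le_0_iff_le order_antisym)
qed

text \<open>An open set is a countable union of closed boxes. On each of them f, cut off by the open
  box, has vanishing integral over every further box, since the intersection is again a box whose
  closure lies in D.\<close>

lemma test_function_AE_eq_0:
  fixes f :: "'a::euclidean_space \<Rightarrow> real"
  assumes D: "open D" and f: "integrable lborel f"
    and test: "\<And>\<phi>. test_function D \<phi> \<Longrightarrow> (\<integral>x. f x * \<phi> x \<partial>lborel) = 0"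
  shows "AE x in lborel. x \<in> D \<longrightarrow> f x = 0"
proof -
  have box: "AE x in lborel. x \<in> cbox p q \<longrightarrow> f x = 0" if sub: "cbox p q \<subseteq> D" for p q
  proof -
    have "AE x in lborel. f x * indicator (box p q) x = 0"
    proof (rule AE_eq_0_of_box_integrals)
      show "integrable lborel (\<lambda>x. f x * indicator (box p q) x)"
        using integrable_mult_indicator[of "box p q" lborel f] f by (simp add: mult.commute)
      fix a b
      \<comment> \<open>The corners of the intersection of the two boxes.\<close>
      define r s where "r = (\<Sum>i\<in>Basis. max (p\<bullet>i) (a\<bullet>i) *\<^sub>R i)" "s = (\<Sum>i\<in>Basis. min (q\<bullet>i) (b\<bullet>i) *\<^sub>R i)"
      have "cbox r s \<subseteq> cbox p q" by (auto simp: r_s_def mem_box)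
      then have "(\<integral>x. f x * indicator (box r s) x \<partial>lborel) = 0"
        using sub by (intro box_integral_eq_0[where D = D, OF f test]) auto
      moreover have "box r s = box p q \<inter> box a b" by (simp add: r_s_def box_Int_box)
      ultimately show "(\<integral>x. f x * indicator (box p q) x * indicator (box a b) x \<partial>lborel) = 0"
        by (simp add: indicator_inter_arith mult.assoc)
    qed
    \<comment> \<open>The cut-off only sees the open box; the faces form a null set.\<close>
    moreover have "AE x in lborel. x \<notin> cbox p q - box p q"
      by (rule AE_not_in[OF null_sets_cbox_Diff_box])
    ultimately show ?thesis by eventually_elim (auto simp: indicator_def)
  qed
  from open_countable_Union_open_cbox[OF D] obtain \<D> where \<D>: "countable \<D>" "\<D> \<subseteq> Pow D"
    "\<And>X. X \<in> \<D> \<Longrightarrow> \<exists>a b. X = cbox a b" "\<Union>\<D> = D" by metis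
  have "AE x in lborel. x \<in> X \<longrightarrow> f x = 0" if "X \<in> \<D>" for X
    using box \<D>(3)[OF that] \<D>(2) that by blast
  then have "AE x in lborel. \<forall>X\<in>\<D>. x \<in> X \<longrightarrow> f x = 0"
    using AE_ball_countable[OF \<D>(1), of "\<lambda>x X. x \<in> X \<longrightarrow> f x = 0"] by blast
  then show ?thesis by eventually_elim (use \<D>(4) in auto)
qed

section \<open>The weak exterior derivative\<close>

text \<open>The combinatorics behind d d = 0: the index pair (i, j) with i \<le> j cancels against
  (j + 1, i), and these two kinds exhaust all pairs.\<close>

lemma antisymmetric_double_sum:
  fixes T :: "nat \<Rightarrow> nat \<Rightarrow> real"
  assumes "\<And>i j. i \<le> j \<Longrightarrow> j \<le> k \<Longrightarrow> T (Suc j) i = - T i j"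
  shows "(\<Sum>i\<le>Suc k. \<Sum>j\<le>k. T i j) = 0"
  using assms
proof (induction k)
  case (Suc k)
  have "(\<Sum>i\<le>Suc (Suc k). \<Sum>j\<le>Suc k. T i j) =
      (\<Sum>i\<le>Suc k. \<Sum>j\<le>k. T i j) + (\<Sum>i\<le>Suc k. T i (Suc k)) + (\<Sum>j\<le>Suc k. T (Suc (Suc k)) j)"
    by (simp add: sum.distrib)
  also have "(\<Sum>j\<le>Suc k. T (Suc (Suc k)) j) = - (\<Sum>i\<le>Suc k. T i (Suc k))"
    unfolding sum_negf[symmetric] by (intro sum.cong refl Suc.prems) auto
  finally show ?case using Suc by simp
qed simp

text \<open>Both K and the domains \<Omega>h are instances. Openness gives uniqueness of the weak
  derivative, boundedness gives integrability of square-integrable forms.\<close>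

locale bounded_open_set =
  fixes D :: "'a::euclidean_space set"
  assumes open_D: "open D" and bounded_D: "bounded D"
begin

section \<open>Square-integrable forms, their inner product and equality of classes\<close>

lemma D_sets [measurable]: "D \<in> sets borel"
  using open_D by simp

lemma emeasure_D_finite: "emeasure lborel D < \<infinity>"
  using emeasure_bounded_finite[OF bounded_D] by simp

lemma L2_form_alternating: "\<omega> \<in> L2_form D k \<Longrightarrow> x \<in> D \<Longrightarrow> alternating k (\<omega> x)"
  by (auto simp: L2_form_def)

lemma L2_form_measurable:
  "\<omega> \<in> L2_form D k \<Longrightarrow> (\<lambda>x. indicator D x * \<omega> x vs) \<in> borel_measurable borel"
  by (auto simp: L2_form_def set_borel_measurable_def)

lemma L2_form_integrable_square:
  "\<omega> \<in> L2_form D k \<Longrightarrow> integrable lborel (\<lambda>x. indicator D x * (\<omega> x vs)\<^sup>2)"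
  by (auto simp: L2_form_def set_integrable_def)

lemma L2_formI:
  assumes "\<And>x. x \<in> D \<Longrightarrow> alternating k (\<omega> x)"
    and "\<And>vs. (\<lambda>x. indicator D x * \<omega> x vs) \<in> borel_measurable borel"
    and "\<And>vs. integrable lborel (\<lambda>x. indicator D x * (\<omega> x vs)\<^sup>2)"
  shows "\<omega> \<in> L2_form D k"
  using assms by (auto simp: L2_form_def set_integrable_def set_borel_measurable_def)

lemma L2_form_integrable_mult:
  assumes \<omega>: "\<omega> \<in> L2_form D k" and \<eta>: "\<eta> \<in> L2_form D j"
  shows "integrable lborel (\<lambda>x. indicator D x * (\<omega> x vs * \<eta> x us))"
proof (rule Bochner_Integration.integrable_bound)
  show "integrable lborel (\<lambda>x. indicator D x * (\<omega> x vs)\<^sup>2 + indicator D x * (\<eta> x us)\<^sup>2)"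
    by (intro Bochner_Integration.integrable_add L2_form_integrable_square[OF \<omega>] L2_form_integrable_square[OF \<eta>])
  have "(\<lambda>x. (indicator D x * \<omega> x vs) * (indicator D x * \<eta> x us)) \<in> borel_measurable lborel"
    using L2_form_measurable[OF \<omega>] L2_form_measurable[OF \<eta>] by measurable
  also have "(\<lambda>x. (indicator D x * \<omega> x vs) * (indicator D x * \<eta> x us)) =
      (\<lambda>x. indicator D x * (\<omega> x vs * \<eta> x us))"
    by (auto simp: indicator_def)
  finally show "(\<lambda>x. indicator D x * (\<omega> x vs * \<eta> x us)) \<in> borel_measurable lborel" .
  have "\<bar>a * b\<bar> \<le> a\<^sup>2 + b\<^sup>2" for a b :: real
    using sum_squares_bound[of "\<bar>a\<bar>" "\<bar>b\<bar>"] mult_nonneg_nonneg[OF abs_ge_zero[of a] abs_ge_zero[of b]]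
    unfolding abs_mult power2_abs by linarith
  then show "AE x in lborel. norm (indicator D x * (\<omega> x vs * \<eta> x us)) \<le>
      norm (indicator D x * (\<omega> x vs)\<^sup>2 + indicator D x * (\<eta> x us)\<^sup>2)"
    by (intro AE_I2) (auto simp: indicator_def)
qed

text \<open>Pointwise |a| \<le> a^2 + 1, and the constant 1 is integrable on a bounded set.\<close>

lemma L2_form_integrable_times:
  assumes \<omega>: "\<omega> \<in> L2_form D k" and [measurable]: "g \<in> borel_measurable borel"
    and g: "\<And>x. \<bar>g x\<bar> \<le> B"
  shows "integrable lborel (\<lambda>x. indicator D x * (\<omega> x vs * g x))"
proof (rule Bochner_Integration.integrable_bound)
  show "integrable lborel (\<lambda>x. B * (indicator D x * (\<omega> x vs)\<^sup>2 + indicator D x))"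
    by (intro integrable_mult_right Bochner_Integration.integrable_add L2_form_integrable_square[OF \<omega>])
      (use emeasure_D_finite in \<open>auto intro!: integrable_real_indicator\<close>)
  have "(\<lambda>x. (indicator D x * \<omega> x vs) * g x) \<in> borel_measurable lborel"
    using L2_form_measurable[OF \<omega>] by measurable
  then show "(\<lambda>x. indicator D x * (\<omega> x vs * g x)) \<in> borel_measurable lborel"
    by (simp add: mult.assoc)
  have "\<bar>a * g x\<bar> \<le> \<bar>B * (a\<^sup>2 + 1)\<bar>" for a x
  proof -
    have "\<bar>a\<bar> \<le> a\<^sup>2 + 1"
      using zero_le_power2[of "\<bar>a\<bar> - 1 / 2"] by (simp add: power2_diff power_divide)
    then show ?thesis
      using mult_mono[OF g[of x], of "\<bar>a\<bar>" "a\<^sup>2 + 1"] g[of x] by (simp add: abs_mult mult.commute)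
  qed
  then show "AE x in lborel. norm (indicator D x * (\<omega> x vs * g x)) \<le>
      norm (B * (indicator D x * (\<omega> x vs)\<^sup>2 + indicator D x))"
    by (intro AE_I2) (auto simp: indicator_def)
qed

lemma L2_form_integrable:
  "\<omega> \<in> L2_form D k \<Longrightarrow> integrable lborel (\<lambda>x. indicator D x * \<omega> x vs)"
  using L2_form_integrable_times[of \<omega> k "\<lambda>x. 1" 1 vs] by simp

lemma L2_form_integrable_test:
  assumes "\<omega> \<in> L2_form D k" "test_function D' \<phi>"
  shows "integrable lborel (\<lambda>x. indicator D x * (\<omega> x vs * \<phi> x))"
    and "integrable lborel (\<lambda>x. indicator D x * (\<omega> x vs * frechet_derivative \<phi> (at x) v))"
  using assms test_function_bounded[OF assms(2)]
    test_function_bounded[OF test_function_frechet_derivative[OF assms(2), of v]]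
  by (auto intro: L2_form_integrable_times test_function_measurable)

lemma integrable_form_inner:
  assumes \<omega>: "\<omega> \<in> L2_form D k" and \<eta>: "\<eta> \<in> L2_form D k"
  shows "integrable lborel (\<lambda>x. indicator D x * form_inner k (\<omega> x) (\<eta> x))"
proof -
  have "integrable lborel (\<lambda>x. (\<Sum>vs\<in>basis_lists k. indicator D x * (\<omega> x vs * \<eta> x vs)) / fact k)"
    by (intro integrable_divide Bochner_Integration.integrable_sum L2_form_integrable_mult[OF \<omega> \<eta>])
  then show ?thesis by (simp add: form_inner_eq sum_distrib_left)
qed

lemma L2_inner_eq: "L2_inner D k \<omega> \<eta> = (\<integral>x. indicator D x * form_inner k (\<omega> x) (\<eta> x) \<partial>lborel)"
  by (simp add: L2_inner_def set_lebesgue_integral_def)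

lemma L2_inner_commute: "L2_inner D k \<omega> \<eta> = L2_inner D k \<eta> \<omega>"
  by (simp add: L2_inner_def form_inner_commute)

lemma L2_inner_nonneg: "0 \<le> L2_inner D k \<omega> \<omega>"
  unfolding L2_inner_eq by (intro integral_nonneg_AE AE_I2) (simp add: form_inner_nonneg)

lemma L2_norm_nonneg: "0 \<le> L2_norm D k \<omega>"
  by (simp add: L2_norm_def L2_inner_nonneg)

lemma form_eq_refl: "form_eq D \<omega> \<omega>"
  by (simp add: form_eq_def)

lemma form_eq_sym: "form_eq D \<omega> \<eta> \<Longrightarrow> form_eq D \<eta> \<omega>"
  unfolding form_eq_def by (rule AE_mp) auto

lemma form_eq_trans: "form_eq D \<omega> \<eta> \<Longrightarrow> form_eq D \<eta> \<zeta> \<Longrightarrow> form_eq D \<omega> \<zeta>"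
  unfolding form_eq_def by (elim AE_mp) (auto intro!: AE_I2)

lemma zero_form_L2: "zero_form \<in> L2_form D k"
  by (intro L2_formI) (auto simp: zero_form_def alternating_zero)

lemma lincomb_L2:
  assumes \<omega>: "\<omega> \<in> L2_form D k" and \<eta>: "\<eta> \<in> L2_form D k"
  shows "lincomb a \<omega> b \<eta> \<in> L2_form D k"
proof (rule L2_formI)
  show "x \<in> D \<Longrightarrow> alternating k (lincomb a \<omega> b \<eta> x)" for x
    using L2_form_alternating[OF \<omega>] L2_form_alternating[OF \<eta>]
    by (auto simp: lincomb_def intro: alternating_lincomb)
  fix vs
  have "(\<lambda>x. a * (indicator D x * \<omega> x vs) + b * (indicator D x * \<eta> x vs)) \<in> borel_measurable borel"
    using L2_form_measurable[OF \<omega>] L2_form_measurable[OF \<eta>] by measurable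
  then show "(\<lambda>x. indicator D x * lincomb a \<omega> b \<eta> x vs) \<in> borel_measurable borel"
    by (simp add: lincomb_def algebra_simps)
  have "integrable lborel (\<lambda>x. a\<^sup>2 * (indicator D x * (\<omega> x vs)\<^sup>2) + b\<^sup>2 * (indicator D x * (\<eta> x vs)\<^sup>2) +
      2 * a * b * (indicator D x * (\<omega> x vs * \<eta> x vs)))"
    by (intro Bochner_Integration.integrable_add integrable_mult_right L2_form_integrable_square[OF \<omega>]
        L2_form_integrable_square[OF \<eta>] L2_form_integrable_mult[OF \<omega> \<eta>])
  then show "integrable lborel (\<lambda>x. indicator D x * (lincomb a \<omega> b \<eta> x vs)\<^sup>2)"
    by (simp add: lincomb_def power2_eq_square algebra_simps)
qed

lemma L2_inner_cong:
  assumes "\<omega> \<in> L2_form D k" "\<eta> \<in> L2_form D k" "\<omega>' \<in> L2_form D k" "\<eta>' \<in> L2_form D k"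
    and "form_eq D \<omega> \<omega>'" "form_eq D \<eta> \<eta>'"
  shows "L2_inner D k \<omega> \<eta> = L2_inner D k \<omega>' \<eta>'"
  unfolding L2_inner_eq
proof (rule integral_cong_AE)
  show "AE x in lborel. indicator D x * form_inner k (\<omega> x) (\<eta> x) = indicator D x * form_inner k (\<omega>' x) (\<eta>' x)"
    using assms(5,6) unfolding form_eq_def by eventually_elim (auto simp: indicator_def)
qed (use integrable_form_inner assms in \<open>auto intro: borel_measurable_integrable\<close>)

lemma L2_norm_cong:
  "\<omega> \<in> L2_form D k \<Longrightarrow> \<eta> \<in> L2_form D k \<Longrightarrow> form_eq D \<omega> \<eta> \<Longrightarrow> L2_norm D k \<omega> = L2_norm D k \<eta>"
  using L2_inner_cong by (simp add: L2_norm_def)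

lemma L2_inner_zero: "L2_inner D k \<omega> zero_form = 0" "L2_inner D k zero_form \<omega> = 0"
  by (simp_all add: L2_inner_def form_inner_def zero_form_def)

lemma L2_norm_zero: "L2_norm D k zero_form = 0"
  by (simp add: L2_norm_def L2_inner_zero)

text \<open>\<open>form_eq\<close> demands equality at all lists simultaneously, an uncountable
  family. Off the union of finitely many null sets the basis components agree, and an alternating
  map is determined by these.\<close>

lemma form_eq_componentsI:
  assumes "\<omega> \<in> L2_form D k" "\<eta> \<in> L2_form D k"
    and "\<And>vs. vs \<in> basis_lists k \<Longrightarrow> AE x in lborel. x \<in> D \<longrightarrow> \<omega> x vs = \<eta> x vs"
  shows "form_eq D \<omega> \<eta>"
proof -
  have "AE x in lborel. \<forall>vs\<in>basis_lists k. x \<in> D \<longrightarrow> \<omega> x vs = \<eta> x vs"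
    by (intro AE_finite_allI) (use assms(3) in auto)
  then show ?thesis
    unfolding form_eq_def
    by eventually_elim (use L2_form_alternating assms(1,2) alternating_eqI in blast)
qed

lemma L2_norm_eq_0D:
  assumes \<omega>: "\<omega> \<in> L2_form D k" and "L2_norm D k \<omega> = 0"
  shows "form_eq D \<omega> zero_form"
proof (rule form_eq_componentsI[OF \<omega> zero_form_L2])
  fix vs :: "'a list" assume vs: "vs \<in> basis_lists k"
  have "(\<integral>x. indicator D x * form_inner k (\<omega> x) (\<omega> x) \<partial>lborel) = 0"
    using assms(2) by (simp add: L2_norm_def L2_inner_eq)
  then have "AE x in lborel. indicator D x * form_inner k (\<omega> x) (\<omega> x) = 0"
    using integral_nonneg_eq_0_iff_AE[OF integrable_form_inner[OF \<omega> \<omega>]] by (simp add: form_inner_nonneg)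
  then show "AE x in lborel. x \<in> D \<longrightarrow> \<omega> x vs = zero_form x vs"
  proof eventually_elim
    case (elim x)
    show ?case
    proof
      assume "x \<in> D"
      with elim have "(\<Sum>vs\<in>basis_lists k. \<omega> x vs * \<omega> x vs) = 0" by (simp add: form_inner_eq)
      with vs show "\<omega> x vs = zero_form x vs" by (simp add: sum_nonneg_eq_0_iff zero_form_def)
    qed
  qed
qed

lemma weak_d_eq: "weak_d D k \<omega> \<eta> \<longleftrightarrow> (\<forall>\<phi> vs. test_function D \<phi> \<and> length vs = Suc k \<longrightarrow>
     (\<integral>x. indicator D x * (\<eta> x vs * \<phi> x) \<partial>lborel) =
     - (\<Sum>i\<le>k. (-1) ^ i * (\<integral>x. indicator D x *
         (\<omega> x (take i vs @ drop (Suc i) vs) * frechet_derivative \<phi> (at x) (vs ! i)) \<partial>lborel)))"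
  by (simp add: weak_d_def set_lebesgue_integral_def)

lemma integral_form_cong:
  assumes "\<omega> \<in> L2_form D k" "\<omega>' \<in> L2_form D k" "form_eq D \<omega> \<omega>'" "g \<in> borel_measurable borel"
  shows "(\<integral>x. indicator D x * (\<omega> x vs * g x) \<partial>lborel) = (\<integral>x. indicator D x * (\<omega>' x vs * g x) \<partial>lborel)"
proof (rule integral_cong_AE)
  have "(\<lambda>x. (indicator D x * \<omega> x vs) * g x) \<in> borel_measurable borel"
    "(\<lambda>x. (indicator D x * \<omega>' x vs) * g x) \<in> borel_measurable borel"
    using L2_form_measurable[OF assms(1)] L2_form_measurable[OF assms(2)] assms(4) by measurable
  then show "(\<lambda>x. indicator D x * (\<omega> x vs * g x)) \<in> borel_measurable lborel"
    "(\<lambda>x. indicator D x * (\<omega>' x vs * g x)) \<in> borel_measurable lborel"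
    by (simp_all add: mult.assoc)
  show "AE x in lborel. indicator D x * (\<omega> x vs * g x) = indicator D x * (\<omega>' x vs * g x)"
    using assms(3) unfolding form_eq_def by eventually_elim (auto simp: indicator_def)
qed

text \<open>\<open>ext_d\<close> is a choice that is determined only up to null sets, so weak
  derivatives have to be transported along \<open>form_eq\<close>.\<close>

lemma weak_d_cong:
  assumes "\<omega> \<in> L2_form D k" "\<omega>' \<in> L2_form D k" "form_eq D \<omega> \<omega>'"
    and "\<eta> \<in> L2_form D (Suc k)" "\<eta>' \<in> L2_form D (Suc k)" "form_eq D \<eta> \<eta>'"
    and "weak_d D k \<omega> \<eta>"
  shows "weak_d D k \<omega>' \<eta>'"
  unfolding weak_d_eq
proof (intro allI impI, elim conjE)
  fix \<phi> and vs :: "'a list" assume \<phi>: "test_function D \<phi>" and vs: "length vs = Suc k"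
  from assms(7) \<phi> vs show "(\<integral>x. indicator D x * (\<eta>' x vs * \<phi> x) \<partial>lborel) =
     - (\<Sum>i\<le>k. (-1) ^ i * (\<integral>x. indicator D x *
         (\<omega>' x (take i vs @ drop (Suc i) vs) * frechet_derivative \<phi> (at x) (vs ! i)) \<partial>lborel))"
    unfolding weak_d_eq integral_form_cong[OF assms(1-3) test_function_measurable(2)[OF \<phi>], symmetric]
      integral_form_cong[OF assms(4-6) test_function_measurable(1)[OF \<phi>], symmetric] by blast
qed

lemma weak_d_zero: "weak_d D k zero_form zero_form"
  by (simp add: weak_d_eq zero_form_def)

text \<open>The fundamental lemma, applied to the difference of the candidates in each basis
  component.\<close>

lemma weak_d_unique:
  assumes \<eta>: "\<eta> \<in> L2_form D (Suc k)" and \<eta>': "\<eta>' \<in> L2_form D (Suc k)"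
    and "weak_d D k \<omega> \<eta>" "weak_d D k \<omega> \<eta>'"
  shows "form_eq D \<eta> \<eta>'"
proof (rule form_eq_componentsI[OF \<eta> \<eta>'])
  fix vs :: "'a list" assume "vs \<in> basis_lists (Suc k)"
  then have vs: "length vs = Suc k" by (simp add: basis_lists_def)
  let ?f = "\<lambda>x. indicator D x * \<eta> x vs - indicator D x * \<eta>' x vs"
  have "(\<integral>x. ?f x * \<phi> x \<partial>lborel) = 0" if \<phi>: "test_function D \<phi>" for \<phi>
  proof -
    have "(\<integral>x. ?f x * \<phi> x \<partial>lborel) =
      (\<integral>x. indicator D x * (\<eta> x vs * \<phi> x) - indicator D x * (\<eta>' x vs * \<phi> x) \<partial>lborel)"
      by (simp add: algebra_simps)
    also have "\<dots> = 0"
      using assms(3,4) \<phi> vs L2_form_integrable_test(1)[OF \<eta> \<phi>] L2_form_integrable_test(1)[OF \<eta>' \<phi>]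
      by (simp add: weak_d_eq)
    finally show ?thesis .
  qed
  then have "AE x in lborel. x \<in> D \<longrightarrow> ?f x = 0"
    by (intro test_function_AE_eq_0[OF open_D]) (simp_all add: L2_form_integrable[OF \<eta>] L2_form_integrable[OF \<eta>'])
  then show "AE x in lborel. x \<in> D \<longrightarrow> \<eta> x vs = \<eta>' x vs" by eventually_elim simp
qed

text \<open>A directional derivative of a test function is a test function, so the definition can be
  applied twice. The result is a double sum of second derivatives, which are symmetric, against the
  antisymmetric signs of deleting two entries.\<close>

lemma weak_d_weak_d:
  assumes d: "weak_d D k \<omega> \<eta>"
  shows "weak_d D (Suc k) \<eta> zero_form"
  unfolding weak_d_eq
proof (intro allI impI, elim conjE)
  fix \<phi> and vs :: "'a list" assume \<phi>: "test_function D \<phi>" and vs: "length vs = Suc (Suc k)"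
  define del where "del i us = take i us @ drop (Suc i) us" for i and us :: "'a list"
  define T where "T i j = (-1) ^ i * ((-1) ^ j * (\<integral>x. indicator D x * (\<omega> x (del j (del i vs)) *
      frechet_derivative (\<lambda>x. frechet_derivative \<phi> (at x) (vs ! i)) (at x) (del i vs ! j)) \<partial>lborel))" for i j
  have "(-1) ^ i * (\<integral>x. indicator D x * (\<eta> x (del i vs) * frechet_derivative \<phi> (at x) (vs ! i)) \<partial>lborel) =
      - (\<Sum>j\<le>k. T i j)" if "i \<le> Suc k" for i
    using d test_function_frechet_derivative[OF \<phi>, of "vs ! i"] that vs
    unfolding weak_d_eq T_def del_def by (simp add: sum_distrib_left)
  then have "(\<Sum>i\<le>Suc k. (-1) ^ i * (\<integral>x. indicator D x * (\<eta> x (del i vs) *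
      frechet_derivative \<phi> (at x) (vs ! i)) \<partial>lborel)) = - (\<Sum>i\<le>Suc k. \<Sum>j\<le>k. T i j)"
    by (simp del: sum.atMost_Suc add: sum_negf)
  also have "(\<Sum>i\<le>Suc k. \<Sum>j\<le>k. T i j) = 0"
  proof (rule antisymmetric_double_sum)
    fix i j assume ij: "i \<le> j" "j \<le> k"
    \<comment> \<open>Deleting entry i first shifts the later entry j + 1 to position j.\<close>
    have "del i (del (Suc j) vs) = del j (del i vs)"
      using ij vs by (auto intro!: nth_equalityI simp: del_def nth_append min_def)
    moreover have "del (Suc j) vs ! i = vs ! i" "del i vs ! j = vs ! Suc j"
      using ij vs by (auto simp: del_def nth_append min_def)
    moreover have "frechet_derivative (\<lambda>x. frechet_derivative \<phi> (at x) (vs ! i)) (at x) (vs ! Suc j) =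
      frechet_derivative (\<lambda>x. frechet_derivative \<phi> (at x) (vs ! Suc j)) (at x) (vs ! i)" for x
      by (rule frechet_derivative_commute[OF test_functionD(1)[OF \<phi>]])
    ultimately show "T (Suc j) i = - T i j" by (simp add: T_def)
  qed
  finally show "(\<integral>x. indicator D x * (zero_form x vs * \<phi> x) \<partial>lborel) =
     - (\<Sum>i\<le>Suc k. (-1) ^ i * (\<integral>x. indicator D x * (\<eta> x (take i vs @ drop (Suc i) vs) *
        frechet_derivative \<phi> (at x) (vs ! i)) \<partial>lborel))"
    by (simp add: zero_form_def del_def)
qed

section \<open>Forms with a weak exterior derivative and the graph norm\<close>

lemma H_form_L2: "\<omega> \<in> H_form D k \<Longrightarrow> \<omega> \<in> L2_form D k"
  by (simp add: H_form_def)

lemma H_formI: "\<omega> \<in> L2_form D k \<Longrightarrow> \<eta> \<in> L2_form D (Suc k) \<Longrightarrow> weak_d D k \<omega> \<eta> \<Longrightarrow> \<omega> \<in> H_form D k"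
  by (auto simp: H_form_def)

lemma ext_d_works:
  assumes "\<omega> \<in> H_form D k"
  shows ext_d_L2: "ext_d D k \<omega> \<in> L2_form D (Suc k)" and weak_d_ext_d: "weak_d D k \<omega> (ext_d D k \<omega>)"
proof -
  have "\<exists>\<eta>. \<eta> \<in> L2_form D (Suc k) \<and> weak_d D k \<omega> \<eta>" using assms by (auto simp: H_form_def)
  from someI_ex[OF this] show "ext_d D k \<omega> \<in> L2_form D (Suc k)" "weak_d D k \<omega> (ext_d D k \<omega>)"
    by (auto simp: ext_d_def)
qed

lemma ext_d_unique:
  assumes "\<omega> \<in> L2_form D k" "\<eta> \<in> L2_form D (Suc k)" "weak_d D k \<omega> \<eta>"
  shows "form_eq D (ext_d D k \<omega>) \<eta>"
  using weak_d_unique[OF ext_d_L2 assms(2) weak_d_ext_d assms(3)] H_formI[OF assms] by simp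

lemma ext_d_cong:
  assumes "\<omega> \<in> H_form D k" "\<eta> \<in> H_form D k" "form_eq D \<omega> \<eta>"
  shows "form_eq D (ext_d D k \<omega>) (ext_d D k \<eta>)"
proof -
  have "weak_d D k \<eta> (ext_d D k \<omega>)"
    using weak_d_cong[OF H_form_L2[OF assms(1)] H_form_L2[OF assms(2)] assms(3)
        ext_d_L2[OF assms(1)] ext_d_L2[OF assms(1)] form_eq_refl weak_d_ext_d[OF assms(1)]] .
  from ext_d_unique[OF H_form_L2[OF assms(2)] ext_d_L2[OF assms(1)] this] show ?thesis
    by (rule form_eq_sym)
qed

lemma ext_d_H_form: "\<omega> \<in> H_form D k \<Longrightarrow> ext_d D k \<omega> \<in> H_form D (Suc k)"
  using H_formI[OF ext_d_L2 zero_form_L2 weak_d_weak_d[OF weak_d_ext_d]] by blast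

lemma ext_d_ext_d: "\<omega> \<in> H_form D k \<Longrightarrow> form_eq D (ext_d D (Suc k) (ext_d D k \<omega>)) zero_form"
  using ext_d_unique[OF ext_d_L2 zero_form_L2 weak_d_weak_d[OF weak_d_ext_d]] by blast

lemma H_norm_nonneg: "0 \<le> H_norm D k \<omega>"
  by (simp add: H_norm_def)

lemma L2_norm_le_H_norm: "L2_norm D k \<omega> \<le> H_norm D k \<omega>"
  unfolding H_norm_def by (rule real_le_rsqrt) simp

lemma H_norm_closed:
  assumes "\<omega> \<in> H_form D k" "form_eq D (ext_d D k \<omega>) zero_form"
  shows "H_norm D k \<omega> = L2_norm D k \<omega>"
  using L2_norm_cong[OF ext_d_L2[OF assms(1)] zero_form_L2 assms(2)]
  by (simp add: H_norm_def L2_norm_zero L2_norm_nonneg)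

text \<open>The starting point for well-definedness on classes: a null form has graph norm 0, so a
  norm bound forces its image to be null.\<close>

lemma H_form_null:
  assumes \<omega>: "\<omega> \<in> L2_form D k" and "form_eq D \<omega> zero_form"
  shows "\<omega> \<in> H_form D k" "H_norm D k \<omega> = 0"
proof -
  have d: "weak_d D k \<omega> zero_form"
    using weak_d_cong[OF zero_form_L2 \<omega> form_eq_sym[OF assms(2)] zero_form_L2 zero_form_L2 form_eq_refl weak_d_zero] .
  show H: "\<omega> \<in> H_form D k" by (rule H_formI[OF \<omega> zero_form_L2 d])
  show "H_norm D k \<omega> = 0"
    using H_norm_closed[OF H ext_d_unique[OF \<omega> zero_form_L2 d]] L2_norm_cong[OF \<omega> zero_form_L2 assms(2)]
    by (simp add: L2_norm_zero)
qed

text \<open>For harmonic eta the vanishing normal trace, tested with \<mu>, reads <eta, d \<mu>> -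
  <0, \<mu>> = 0, which is the orthogonality.\<close>

lemma ext_d_H_perp:
  assumes "\<mu> \<in> H_form D k"
  shows "ext_d D k \<mu> \<in> H_perp_form D (Suc k)"
proof -
  have "L2_inner D (Suc k) (ext_d D k \<mu>) \<eta> = 0" if "\<eta> \<in> harmonic_form D (Suc k)" for \<eta>
    using that assms L2_inner_zero(2)[of k \<mu>]
    by (auto simp: harmonic_form_def vanishing_normal_trace_def L2_inner_commute)
  with ext_d_H_form[OF assms] show ?thesis by (simp add: H_perp_form_def)
qed

text \<open>Apply A to the difference of the representatives, which is null, and use
  linearity.\<close>

lemma bounded_linear_forms_cong:
  assumes A: "linear_forms D' S A" and "\<omega> \<in> S" "\<eta> \<in> S"
    and bound: "\<And>\<zeta>. \<zeta> \<in> L2_form D k \<Longrightarrow> form_eq D \<zeta> zero_form \<Longrightarrow> form_eq D' (A \<zeta>) zero_form"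
    and "\<omega> \<in> L2_form D k" "\<eta> \<in> L2_form D k" "form_eq D \<omega> \<eta>"
  shows "form_eq D' (A \<omega>) (A \<eta>)"
proof -
  have "form_eq D (lincomb 1 \<omega> (-1) \<eta>) zero_form"
    using assms(7) unfolding form_eq_def
    by eventually_elim (auto simp: lincomb_def zero_form_def)
  then have "form_eq D' (A (lincomb 1 \<omega> (-1) \<eta>)) zero_form"
    by (intro bound lincomb_L2 assms)
  moreover have "form_eq D' (A (lincomb 1 \<omega> (-1) \<eta>)) (lincomb 1 (A \<omega>) (-1) (A \<eta>))"
    using A assms(2,3) by (simp add: linear_forms_def)
  ultimately show ?thesis
    unfolding form_eq_def
    by eventually_elim (auto simp: lincomb_def zero_form_def fun_eq_iff)
qed

end

section \<open>The Poincare lemma on convex sets\<close>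

lemma nn_integral_lborel_affine:
  fixes f :: "'a::euclidean_space \<Rightarrow> ennreal"
  assumes [measurable]: "f \<in> borel_measurable borel" and "c \<noteq> 0"
  shows "(\<integral>\<^sup>+x. f x \<partial>lborel) = ennreal (\<bar>c\<bar> ^ DIM('a)) * (\<integral>\<^sup>+x. f (a + c *\<^sub>R x) \<partial>lborel)"
  by (subst lborel_affine[OF assms(2), of a])
    (simp add: nn_integral_density nn_integral_distr nn_integral_cmult)

lemma integral_lborel_affine:
  fixes f :: "'a::euclidean_space \<Rightarrow> real"
  assumes [measurable]: "f \<in> borel_measurable borel" and "c \<noteq> 0"
  shows "(\<integral>x. f x \<partial>lborel) = \<bar>c\<bar> ^ DIM('a) * (\<integral>x. f (a + c *\<^sub>R x) \<partial>lborel)"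
  by (subst lborel_affine[OF assms(2), of a])
    (simp add: integral_density integral_distr)

text \<open>The Jacobian c^(-n) is at most 2^n. This is the origin of the factor 2^n in the final
  constant.\<close>

lemma nn_integral_lborel_affine_le:
  fixes f :: "'a::euclidean_space \<Rightarrow> ennreal"
  assumes f: "f \<in> borel_measurable borel" and c: "1 / 2 \<le> c"
  shows "(\<integral>\<^sup>+x. f (a + c *\<^sub>R x) \<partial>lborel) \<le> 2 ^ DIM('a) * (\<integral>\<^sup>+x. f x \<partial>lborel)"
proof -
  have "1 \<le> (2 * c) ^ DIM('a)" using c by (intro one_le_power) simp
  then have "1 \<le> ennreal ((2 * c) ^ DIM('a))" by simp
  then have "1 * (\<integral>\<^sup>+x. f (a + c *\<^sub>R x) \<partial>lborel) \<le>
      ennreal ((2 * c) ^ DIM('a)) * (\<integral>\<^sup>+x. f (a + c *\<^sub>R x) \<partial>lborel)"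
    by (intro mult_right_mono) auto
  also have "\<dots> = 2 ^ DIM('a) * (ennreal (\<bar>c\<bar> ^ DIM('a)) * (\<integral>\<^sup>+x. f (a + c *\<^sub>R x) \<partial>lborel))"
    using c by (simp add: power_mult_distrib ennreal_mult mult.assoc flip: ennreal_power)
  also have "\<dots> = 2 ^ DIM('a) * (\<integral>\<^sup>+x. f x \<partial>lborel)"
    using c by (subst nn_integral_lborel_affine[OF f, of c a]) auto
  finally show ?thesis by simp
qed

lemma lborel_Fubini:
  fixes f :: "'a::euclidean_space \<Rightarrow> 'b::euclidean_space \<Rightarrow> ennreal"
  assumes "(\<lambda>(x, y). f x y) \<in> borel_measurable (lborel \<Otimes>\<^sub>M lborel)"
  shows "(\<integral>\<^sup>+x. \<integral>\<^sup>+y. f x y \<partial>lborel \<partial>lborel) = (\<integral>\<^sup>+y. \<integral>\<^sup>+x. f x y \<partial>lborel \<partial>lborel)"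
  using lborel_pair.Fubini'[of f] assms by simp

text \<open>Averaging over the base point \<open>y\<close> removes the singularity of the homotopy operator at \<open>t = 0\<close>:
  for \<open>t \<ge> 1/2\<close> substitute in \<open>x\<close>, for \<open>t \<le> 1/2\<close> substitute in \<open>y\<close>.\<close>

lemma good_base_point:
  fixes f :: "'a::euclidean_space \<Rightarrow> ennreal"
  assumes K: "open K" "bounded K" "K \<noteq> {}" and f [measurable]: "f \<in> borel_measurable borel"
    and fin: "(\<integral>\<^sup>+x. f x \<partial>lborel) < \<infinity>"
  shows "\<exists>y\<in>K. (\<integral>\<^sup>+x. indicator K x * (\<integral>\<^sup>+t. indicator {0<..<1} t * f (y + t *\<^sub>R (x - y)) \<partial>lborel) \<partial>lborel)
    \<le> 2 ^ DIM('a) * (\<integral>\<^sup>+x. f x \<partial>lborel)"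
proof (rule ccontr)
  have [measurable]: "K \<in> sets borel" using K by simp
  define c where "c = 2 ^ DIM('a) * (\<integral>\<^sup>+x. f x \<partial>lborel)"
  \<comment> \<open>If \<open>J\<close> exceeded \<open>c\<close> at every point of K, its integral
    over K would exceed c |K|. Integrating in the order with t outermost shows that it does
    not.\<close>
  define J where "J y = (\<integral>\<^sup>+x. indicator K x * (\<integral>\<^sup>+t. indicator {0<..<1::real} t * f (y + t *\<^sub>R (x - y)) \<partial>lborel) \<partial>lborel)" for y
  have J [measurable]: "J \<in> borel_measurable borel" unfolding J_def by measurable
  have c: "c < \<infinity>" using fin by (auto simp: c_def ennreal_mult_less_top power_less_top_ennreal)
  have Kfin: "emeasure lborel K < \<infinity>" using emeasure_bounded_finite[OF K(2)] by simp
  assume "\<not> ?thesis"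
  then have gt: "c < J y" if "y \<in> K" for y using that by (auto simp: c_def J_def not_le)
  have inner: "(\<integral>\<^sup>+y. indicator K y * (\<integral>\<^sup>+x. indicator K x * f (y + t *\<^sub>R (x - y)) \<partial>lborel) \<partial>lborel) \<le> c * emeasure lborel K"
    for t :: real
  proof (cases "1 / 2 \<le> t")
    case True
    have "(\<integral>\<^sup>+x. indicator K x * f (y + t *\<^sub>R (x - y)) \<partial>lborel) \<le> c" for y
    proof -
      have "(\<integral>\<^sup>+x. indicator K x * f (y + t *\<^sub>R (x - y)) \<partial>lborel) \<le> (\<integral>\<^sup>+x. f ((y - t *\<^sub>R y) + t *\<^sub>R x) \<partial>lborel)"
        by (intro nn_integral_mono) (auto simp: indicator_def algebra_simps)
      also have "\<dots> \<le> c" unfolding c_def by (rule nn_integral_lborel_affine_le[OF f True])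
      finally show ?thesis .
    qed
    then have "(\<integral>\<^sup>+y. indicator K y * (\<integral>\<^sup>+x. indicator K x * f (y + t *\<^sub>R (x - y)) \<partial>lborel) \<partial>lborel) \<le>
        (\<integral>\<^sup>+y. c * indicator K y \<partial>lborel)"
      by (intro nn_integral_mono) (auto simp: indicator_def)
    then show ?thesis by (simp add: nn_integral_cmult)
  next
    case False
    have "(\<integral>\<^sup>+y. indicator K y * f (y + t *\<^sub>R (x - y)) \<partial>lborel) \<le> c" for x
    proof -
      have "(\<integral>\<^sup>+y. indicator K y * f (y + t *\<^sub>R (x - y)) \<partial>lborel) \<le> (\<integral>\<^sup>+y. f (t *\<^sub>R x + (1 - t) *\<^sub>R y) \<partial>lborel)"
        by (intro nn_integral_mono) (auto simp: indicator_def algebra_simps)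
      also have "\<dots> \<le> c" unfolding c_def using False by (intro nn_integral_lborel_affine_le[OF f]) auto
      finally show ?thesis .
    qed
    then have "(\<integral>\<^sup>+x. indicator K x * (\<integral>\<^sup>+y. indicator K y * f (y + t *\<^sub>R (x - y)) \<partial>lborel) \<partial>lborel) \<le>
        (\<integral>\<^sup>+x. c * indicator K x \<partial>lborel)"
      by (intro nn_integral_mono) (auto simp: indicator_def)
    also have "\<dots> = c * emeasure lborel K" by (simp add: nn_integral_cmult)
    also have "(\<integral>\<^sup>+x. indicator K x * (\<integral>\<^sup>+y. indicator K y * f (y + t *\<^sub>R (x - y)) \<partial>lborel) \<partial>lborel) =
        (\<integral>\<^sup>+x. \<integral>\<^sup>+y. indicator K x * (indicator K y * f (y + t *\<^sub>R (x - y))) \<partial>lborel \<partial>lborel)"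
      by (simp add: nn_integral_cmult)
    also have "\<dots> = (\<integral>\<^sup>+y. \<integral>\<^sup>+x. indicator K x * (indicator K y * f (y + t *\<^sub>R (x - y))) \<partial>lborel \<partial>lborel)"
      by (rule lborel_Fubini) measurable
    also have "\<dots> = (\<integral>\<^sup>+y. indicator K y * (\<integral>\<^sup>+x. indicator K x * f (y + t *\<^sub>R (x - y)) \<partial>lborel) \<partial>lborel)"
      by (simp add: nn_integral_cmult[symmetric] mult.left_commute)
    finally show ?thesis .
  qed
  have "(\<integral>\<^sup>+y. indicator K y * J y \<partial>lborel) =
      (\<integral>\<^sup>+y. \<integral>\<^sup>+t. indicator K y * (indicator {0<..<1} t * (\<integral>\<^sup>+x. indicator K x * f (y + t *\<^sub>R (x - y)) \<partial>lborel)) \<partial>lborel \<partial>lborel)"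
  proof (intro nn_integral_cong)
    fix y
    have "J y = (\<integral>\<^sup>+x. \<integral>\<^sup>+t. indicator K x * (indicator {0<..<1::real} t * f (y + t *\<^sub>R (x - y))) \<partial>lborel \<partial>lborel)"
      unfolding J_def by (simp add: nn_integral_cmult)
    also have "\<dots> = (\<integral>\<^sup>+t. \<integral>\<^sup>+x. indicator K x * (indicator {0<..<1::real} t * f (y + t *\<^sub>R (x - y))) \<partial>lborel \<partial>lborel)"
      by (rule lborel_Fubini) measurable
    also have "\<dots> = (\<integral>\<^sup>+t. indicator {0<..<1} t * (\<integral>\<^sup>+x. indicator K x * f (y + t *\<^sub>R (x - y)) \<partial>lborel) \<partial>lborel)"
      by (simp add: nn_integral_cmult[symmetric] mult.left_commute)
    finally show "indicator K y * J y = (\<integral>\<^sup>+t. indicator K y * (indicator {0<..<1} t *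
        (\<integral>\<^sup>+x. indicator K x * f (y + t *\<^sub>R (x - y)) \<partial>lborel)) \<partial>lborel)"
      by (simp add: nn_integral_cmult)
  qed
  also have "\<dots> = (\<integral>\<^sup>+t. \<integral>\<^sup>+y. indicator K y * (indicator {0<..<1} t *
      (\<integral>\<^sup>+x. indicator K x * f (y + t *\<^sub>R (x - y)) \<partial>lborel)) \<partial>lborel \<partial>lborel)"
    by (rule lborel_Fubini) measurable
  also have "\<dots> = (\<integral>\<^sup>+t. indicator {0<..<1} t * (\<integral>\<^sup>+y. indicator K y *
      (\<integral>\<^sup>+x. indicator K x * f (y + t *\<^sub>R (x - y)) \<partial>lborel) \<partial>lborel) \<partial>lborel)"
    by (simp add: nn_integral_cmult[symmetric] mult.left_commute)
  also have "\<dots> \<le> (\<integral>\<^sup>+t. (c * emeasure lborel K) * indicator {0<..<1::real} t \<partial>lborel)"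
    using inner by (intro nn_integral_mono) (auto simp: indicator_def)
  also have "\<dots> = c * emeasure lborel K" by (simp add: nn_integral_cmult)
  finally have le: "(\<integral>\<^sup>+y. indicator K y * J y \<partial>lborel) \<le> c * emeasure lborel K" .
  have "(\<integral>\<^sup>+y. c * indicator K y \<partial>lborel) < (\<integral>\<^sup>+y. indicator K y * J y \<partial>lborel)"
  proof (rule nn_integral_less)
    show "(\<integral>\<^sup>+y. c * indicator K y \<partial>lborel) \<noteq> \<infinity>"
      using c Kfin by (auto simp: nn_integral_cmult ennreal_mult_eq_top_iff)
    show "AE y in lborel. c * indicator K y \<le> indicator K y * J y"
      using gt by (intro AE_I2) (auto simp: indicator_def less_imp_le)
    \<comment> \<open>Otherwise K would be a null set, which a nonempty open set is not.\<close>
    show "\<not> (AE y in lborel. indicator K y * J y \<le> c * indicator K y)"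
    proof
      assume "AE y in lborel. indicator K y * J y \<le> c * indicator K y"
      then have "AE y in lborel. y \<notin> K"
        by eventually_elim (use gt in \<open>force simp: indicator_def not_le[symmetric]\<close>)
      then have "K \<in> null_sets lborel" by (simp add: AE_iff_null_sets)
      then have "negligible K" by (simp add: negligible_iff_null_sets null_sets_completionI)
      with K(1,3) show False using open_not_negligible by blast
    qed
  qed measurable
  with le show False by (simp add: nn_integral_cmult)
qed

lemma alternating_integral:
  assumes alt: "\<And>t. alternating k (F t)" and int: "\<And>vs. integrable M (\<lambda>t. F t vs)"
  shows "alternating k (\<lambda>vs. \<integral>t. F t vs \<partial>M)"
proof -
  have "linear (\<lambda>v. \<integral>t. F t (vs[i := v]) \<partial>M)" if "length vs = k" "i < k" for vs i
  proof (rule linearI)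
    have lin: "linear (\<lambda>v. F t (vs[i := v]))" for t
      using alt[of t] that by (simp add: alternating_def)
    show "(\<integral>t. F t (vs[i := a + b]) \<partial>M) = (\<integral>t. F t (vs[i := a]) \<partial>M) + (\<integral>t. F t (vs[i := b]) \<partial>M)" for a b
      by (simp add: linear_add[OF lin] int)
    show "(\<integral>t. F t (vs[i := r *\<^sub>R a]) \<partial>M) = r *\<^sub>R (\<integral>t. F t (vs[i := a]) \<partial>M)" for r a
      by (simp add: linear_cmul[OF lin])
  qed
  moreover have "F t vs = 0" if "length vs \<noteq> k \<or> \<not> distinct vs" for t vs
    using alt[of t] that by (auto simp: alternating_def)
  ultimately show ?thesis unfolding alternating_def by simp
qed

text \<open>Nonnegativity of the variance of u on the unit interval, with m the mean.\<close>

lemma square_integral_unit_interval_le: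
  fixes u :: "real \<Rightarrow> real"
  assumes u: "integrable lborel (\<lambda>t. indicator {0<..<1} t * u t)"
    and u2: "integrable lborel (\<lambda>t. indicator {0<..<1} t * (u t)\<^sup>2)"
  shows "(\<integral>t. indicator {0<..<1} t * u t \<partial>lborel)\<^sup>2 \<le> (\<integral>t. indicator {0<..<1} t * (u t)\<^sup>2 \<partial>lborel)"
proof -
  define m where "m = (\<integral>t. indicator {0<..<1} t * u t \<partial>lborel)"
  have one: "integrable lborel (indicator {0<..<1::real} :: real \<Rightarrow> real)"
    "(\<integral>t. indicator {0<..<1::real} t \<partial>lborel) = (1::real)"
    by (auto intro: integrable_real_indicator)
  have "0 \<le> (\<integral>t. indicator {0<..<1} t * (u t - m)\<^sup>2 \<partial>lborel)"
    by (intro integral_nonneg_AE AE_I2) auto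
  also have "\<dots> = (\<integral>t. indicator {0<..<1} t * (u t)\<^sup>2 - 2 * m * (indicator {0<..<1} t * u t)
      + m\<^sup>2 * indicator {0<..<1} t \<partial>lborel)"
    by (simp add: power2_eq_square algebra_simps)
  also have "\<dots> = (\<integral>t. indicator {0<..<1} t * (u t)\<^sup>2 \<partial>lborel) - 2 * m * m + m\<^sup>2"
    using u u2 one by (simp add: m_def)
  finally show ?thesis by (simp add: m_def power2_eq_square)
qed

text \<open>The integrand is the t-derivative of -t^(-m) \<phi>(y + (z - y) / t). At t = 1 this
  primitive is -\<phi>(z); as t decreases to 0 the point runs off to infinity, as z differs from y,
  and leaves the compact support.\<close>

lemma FTC_inverse_dilation:
  fixes \<phi> :: "'a::euclidean_space \<Rightarrow> real"
  assumes \<phi>: "test_function D \<phi>" and z: "z \<noteq> y"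
  shows "(\<integral>t. indicator {0<..<1} t * (1 / t ^ Suc m * (m * \<phi> (y + (1 / t) *\<^sub>R (z - y)) +
      frechet_derivative \<phi> (at (y + (1 / t) *\<^sub>R (z - y))) ((1 / t) *\<^sub>R (z - y)))) \<partial>lborel) = - \<phi> z"
proof -
  define x where "x t = y + (1 / t) *\<^sub>R (z - y)" for t :: real
  define F where "F t = 1 / t ^ Suc m * (m * \<phi> (x t) + frechet_derivative \<phi> (at (x t)) ((1 / t) *\<^sub>R (z - y)))" for t
  have diff: "\<phi> differentiable at w" for w by (rule test_functionD(2)[OF \<phi>])
  have lin: "frechet_derivative \<phi> (at w) (r *\<^sub>R v) = r * frechet_derivative \<phi> (at w) v" for w r v
    using linear_cmul[OF linear_frechet_derivative[OF diff]] by simp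
  from compact_imp_bounded[OF test_functionD(6)[OF \<phi>]] obtain \<rho>' where
    \<rho>': "\<rho>' > 0" "\<And>w. w \<in> closure {x. \<phi> x \<noteq> 0} \<Longrightarrow> norm w \<le> \<rho>'" unfolding bounded_pos by blast
  define \<rho> where "\<rho> = \<rho>' + norm y"
  have \<rho>: "\<rho> > 0" "\<And>w. w \<in> closure {x. \<phi> x \<noteq> 0} \<Longrightarrow> norm (w - y) \<le> \<rho>"
    using \<rho>' norm_triangle_ineq4[of _ y] by (force simp: \<rho>_def intro: add_pos_nonneg order_trans)+
  \<comment> \<open>For t \<le> \<epsilon> the dilated point has distance at least 2 \<rho> from y,
    while the support lies within \<rho>; the 1/2 ensures \<epsilon> < 1.\<close>
  define \<epsilon> where "\<epsilon> = min (1 / 2) (norm (z - y) / (2 * \<rho>))"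
  have \<epsilon>: "0 < \<epsilon>" "\<epsilon> < 1" using z \<rho>(1) by (auto simp: \<epsilon>_def)
  have out: "x t \<notin> closure {x. \<phi> x \<noteq> 0}" if "0 < t" "t \<le> \<epsilon>" for t
  proof
    assume "x t \<in> closure {x. \<phi> x \<noteq> 0}"
    from \<rho>(2)[OF this] that have "norm (z - y) / t \<le> \<rho>"
      unfolding x_def add_diff_cancel_left' norm_scaleR by simp
    then have "norm (z - y) \<le> \<rho> * t" using that by (simp add: field_simps)
    also have "\<dots> \<le> \<rho> * (norm (z - y) / (2 * \<rho>))"
      using that \<rho>(1) by (intro mult_left_mono) (auto simp: \<epsilon>_def)
    finally show False using z \<rho>(1) by simp
  qed
  have zero: "F t = 0" "\<phi> (x t) = 0" if "0 < t" "t \<le> \<epsilon>" for t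
    using out[OF that] closure_subset[of "{x. \<phi> x \<noteq> 0}"] frechet_derivative_eq_0_outside[OF out[OF that]]
    by (auto simp: F_def)
  have x': "(x has_vector_derivative - (1 / t\<^sup>2) *\<^sub>R (z - y)) (at t)" if "t > 0" for t
    unfolding x_def using that
    by (auto intro!: derivative_eq_intros simp: power2_eq_square field_simps)
  have "((\<lambda>t. \<phi> (x t) / t ^ m) has_real_derivative - F t) (at t)" if t: "t > 0" for t
  proof -
    have "((\<lambda>t. \<phi> (x t)) has_derivative
        (\<lambda>s. frechet_derivative \<phi> (at (x t)) (s *\<^sub>R (- (1 / t\<^sup>2) *\<^sub>R (z - y))))) (at t)"
      using diff_chain_at[OF x'[OF t, unfolded has_vector_derivative_def], of \<phi>] diff[of "x t"]
      by (auto simp: o_def frechet_derivative_works)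
    then have "((\<lambda>t. \<phi> (x t)) has_real_derivative - (1 / t\<^sup>2) * frechet_derivative \<phi> (at (x t)) (z - y)) (at t)"
      unfolding has_field_derivative_def scaleR_scaleR lin
      by (rule has_derivative_eq_rhs) (simp add: fun_eq_iff)
    from DERIV_divide[OF this DERIV_pow[of m t UNIV]] t
    have "((\<lambda>t. \<phi> (x t) / t ^ m) has_real_derivative
        (- (1 / t\<^sup>2) * frechet_derivative \<phi> (at (x t)) (z - y) * t ^ m -
         \<phi> (x t) * (real m * t ^ (m - Suc 0))) / (t ^ m * t ^ m)) (at t)" by simp
    moreover have "(- (1 / t\<^sup>2) * frechet_derivative \<phi> (at (x t)) (z - y) * t ^ m -
         \<phi> (x t) * (real m * t ^ (m - Suc 0))) / (t ^ m * t ^ m) = - F t"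
      unfolding F_def lin using t by (cases m) (simp_all add: field_simps power2_eq_square)
    ultimately show ?thesis by simp
  qed
  then have deriv: "((\<lambda>t. - (\<phi> (x t) / t ^ m)) has_vector_derivative F t) (at t within {\<epsilon>..1})"
    if "\<epsilon> \<le> t" for t
    using that \<epsilon>(1) DERIV_minus[of "\<lambda>t. \<phi> (x t) / t ^ m" "- F t" t]
    by (auto simp: has_real_derivative_iff_has_vector_derivative intro: has_vector_derivative_at_within)
  have xc: "continuous_on {\<epsilon>..1} x"
    unfolding x_def using \<epsilon>(1) by (auto intro!: continuous_intros)
  have "continuous_on {\<epsilon>..1} (\<lambda>t. \<phi> (x t))" "continuous_on {\<epsilon>..1} (\<lambda>t. frechet_derivative \<phi> (at (x t)) (z - y))"
    using continuous_on_compose2[OF test_functionD(3)[OF \<phi>] xc]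
      continuous_on_compose2[OF test_functionD(4)[OF \<phi>] xc] by auto
  then have "continuous_on {\<epsilon>..1} F"
    unfolding F_def lin using \<epsilon>(1) by (auto intro!: continuous_intros)
  from integral_FTC_atLeastAtMost[OF less_imp_le[OF \<epsilon>(2)] deriv this]
  have "(\<integral>t. indicator {\<epsilon>..1} t *\<^sub>R F t \<partial>lborel) = - \<phi> z"
    using zero(2)[OF \<epsilon>(1)] by (simp add: x_def)
  moreover have "(\<integral>t. indicator {0<..<1} t * F t \<partial>lborel) = (\<integral>t. indicator {\<epsilon>..1} t *\<^sub>R F t \<partial>lborel)"
  proof (rule integral_cong_AE)
    have "(\<lambda>t. indicator {\<epsilon>..1} t *\<^sub>R F t) \<in> borel_measurable borel"
      by (rule borel_measurable_continuous_on_indicator) (use \<open>continuous_on {\<epsilon>..1} F\<close> in auto)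
    then show 1: "(\<lambda>t. indicator {\<epsilon>..1} t *\<^sub>R F t) \<in> borel_measurable lborel" by simp
    have eq: "indicator {0<..<1} t * F t = indicator {0<..<1} t * (indicator {\<epsilon>..1} t *\<^sub>R F t)" for t
      using zero(1)[of t] by (auto simp: indicator_def)
    show "(\<lambda>t. indicator {0<..<1} t * F t) \<in> borel_measurable lborel"
      unfolding eq using 1 by measurable
    \<comment> \<open>Below \<epsilon> the integrand is 0, and otherwise the two intervals differ
      only in the point t = 1.\<close>
    show "AE t in lborel. indicator {0<..<1} t * F t = indicator {\<epsilon>..1} t *\<^sub>R F t"
      using AE_lborel_singleton[of 1]
      by eventually_elim (use zero(1) \<epsilon> in \<open>auto simp: indicator_def\<close>)
  qed
  ultimately show ?thesis by (simp add: F_def x_def)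
qed

text \<open>\<open>e\<close> is a representative that is Borel measurable on the whole space and 0
  outside K. Integrals over K thus become integrals over the whole space, where dilations about y
  act by a plain change of variables.\<close>

locale homotopy_operator = bounded_open_set K for K :: "'a::euclidean_space set" +
  fixes y :: 'a and k :: nat and e :: "'a form"
  assumes convex_K: "convex K" and y: "y \<in> K" and k: "k < DIM('a)"
    and alt: "\<And>z. alternating (Suc k) (e z)"
    and meas: "\<And>ws. (\<lambda>z. e z ws) \<in> borel_measurable borel"
    and outside: "\<And>z ws. z \<notin> K \<Longrightarrow> e z ws = 0"
    and e_L2: "e \<in> L2_form K (Suc k)"
    and closed: "weak_d K (Suc k) e zero_form"
begin

text \<open>The pointwise squared norm of \<open>e\<close> without the normalisation:
  \<open>form_inner\<close> times (k + 1)!.\<close>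

definition energy :: "'a \<Rightarrow> real" where
  "energy z = (\<Sum>ws\<in>basis_lists (Suc k). (e z ws)\<^sup>2)"

lemma energy_measurable [measurable]: "energy \<in> borel_measurable borel"
  unfolding energy_def using meas by measurable

lemma energy_nonneg: "0 \<le> energy z"
  by (simp add: energy_def sum_nonneg)

definition seg :: "real \<Rightarrow> 'a \<Rightarrow> 'a" where
  "seg t x = y + t *\<^sub>R (x - y)"

lemma seg_measurable [measurable]: "(\<lambda>p. seg (snd p) (fst p)) \<in> borel_measurable (lborel \<Otimes>\<^sub>M lborel)"
  "(\<lambda>t. seg t x) \<in> borel_measurable borel" "seg t \<in> borel_measurable borel"
  unfolding seg_def by measurable

lemma seg_inverse: "t \<noteq> 0 \<Longrightarrow> seg t (seg (1 / t) x) = x" "t \<noteq> 0 \<Longrightarrow> seg (1 / t) (seg t x) = x"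
  by (simp_all add: seg_def)

abbreviation unit_ind :: "real \<Rightarrow> real" where
  "unit_ind \<equiv> indicator {0<..<1}"

text \<open>Points whose segment to y carries finite energy. Elsewhere \<open>potential\<close> is
  set to 0 in all components at once: the default value of a non-integrable integral could hit some
  components and not others and so destroy linearity.\<close>

definition good :: "'a set" where
  "good = {x. (\<integral>\<^sup>+t. indicator {0<..<1} t * ennreal (energy (seg t x)) \<partial>lborel) < \<infinity>}"

definition potential :: "'a form" where
  "potential x us = indicator good x * (\<integral>t. unit_ind t * (t ^ k * e (seg t x) ((x - y) # us)) \<partial>lborel)"

lemma energy_seg_measurable [measurable]:
  "(\<lambda>p. energy (seg (snd p) (fst p))) \<in> borel_measurable (lborel \<Otimes>\<^sub>M lborel)"
  "(\<lambda>t. energy (seg t x)) \<in> borel_measurable borel"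
  by (rule measurable_compose[OF _ energy_measurable]; measurable)+

lemma e_seg_measurable [measurable]:
  "(\<lambda>p. e (seg (snd p) (fst p)) ws) \<in> borel_measurable (lborel \<Otimes>\<^sub>M lborel)"
  "(\<lambda>t. e (seg t x) ws) \<in> borel_measurable borel"
  by (rule measurable_compose[OF _ meas]; measurable)+

text \<open>Measurability of \<open>e\<close> is known for fixed argument lists only; expanding x -
  y in the basis moves the dependence on x into scalar coefficients.\<close>

lemma kernel_measurable [measurable]:
  "(\<lambda>p. e (seg (snd p) (fst p)) ((fst p - y) # us)) \<in> borel_measurable (lborel \<Otimes>\<^sub>M lborel)"
  unfolding alternating_expand[OF alt, of _ "_ - y"] by measurable

lemma good_sets [measurable]: "good \<in> sets borel"
proof -
  have "(\<lambda>x. \<integral>\<^sup>+t. indicator {0<..<1} t * ennreal (energy (seg t x)) \<partial>lborel) \<in> borel_measurable lborel"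
    by (rule lborel.borel_measurable_nn_integral) measurable
  then show ?thesis unfolding good_def by measurable
qed

text \<open>Bounding |a| by 1 + a^2 lets the energy, which is quadratic, serve as majorant for the
  kernel, which is linear in \<open>e\<close>.\<close>

lemma e_bound: "\<bar>e z ws\<bar> \<le> prod_list (map norm ws) * (card (basis_lists (Suc k) :: 'a list set) * (1 + energy z))"
proof -
  have "\<bar>e z bs\<bar> \<le> 1 + energy z" if "bs \<in> basis_lists (Suc k)" for bs
  proof -
    have "\<bar>e z bs\<bar> \<le> 1 + (e z bs)\<^sup>2"
      using zero_le_power2[of "\<bar>e z bs\<bar> - 1 / 2"] by (simp add: power2_diff power_divide)
    also have "(e z bs)\<^sup>2 \<le> energy z"
      unfolding energy_def using that by (intro member_le_sum) auto
    finally show ?thesis by simp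
  qed
  then have "(\<Sum>bs\<in>basis_lists (Suc k). \<bar>e z bs\<bar>) \<le> card (basis_lists (Suc k) :: 'a list set) * (1 + energy z)"
    by (rule sum_bounded_above)
  moreover have "0 \<le> prod_list (map norm ws)" by (induction ws) auto
  ultimately show ?thesis
    using alternating_bound[OF alt, of z ws] by (meson mult_left_mono order_trans)
qed

lemma integrable_seg:
  assumes x: "x \<in> good" and [measurable]: "w \<in> borel_measurable borel"
    and w: "\<And>t. \<bar>w t\<bar> \<le> C * (unit_ind t * (1 + energy (seg t x)))"
  shows "integrable lborel w"
proof (rule Bochner_Integration.integrable_bound)
  have "integrable lborel (\<lambda>t. unit_ind t * energy (seg t x))"
  proof (rule integrableI_nonneg)
    have "(\<integral>\<^sup>+t. ennreal (unit_ind t * energy (seg t x)) \<partial>lborel) =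
        (\<integral>\<^sup>+t. indicator {0<..<1} t * ennreal (energy (seg t x)) \<partial>lborel)"
      by (intro nn_integral_cong) (auto simp: indicator_def)
    then show "(\<integral>\<^sup>+t. ennreal (unit_ind t * energy (seg t x)) \<partial>lborel) < \<infinity>"
      using x by (simp add: good_def)
  qed (auto simp: energy_nonneg)
  then show "integrable lborel (\<lambda>t. C * (unit_ind t + unit_ind t * energy (seg t x)))"
    by (intro integrable_mult_right Bochner_Integration.integrable_add) (auto intro: integrable_real_indicator)
  show "AE t in lborel. norm (w t) \<le> norm (C * (unit_ind t + unit_ind t * energy (seg t x)))"
    using w by (intro AE_I2) (simp add: algebra_simps, smt (verit))
qed auto

lemma integrable_kernel:
  assumes "x \<in> good"
  shows "integrable lborel (\<lambda>t. unit_ind t * (t ^ k * e (seg t x) ws))"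
proof (rule integrable_seg[OF assms])
  let ?C = "prod_list (map norm ws) * card (basis_lists (Suc k) :: 'a list set)"
  show "\<bar>unit_ind t * (t ^ k * e (seg t x) ws)\<bar> \<le> ?C * (unit_ind t * (1 + energy (seg t x)))" for t
  proof (cases "t \<in> {0<..<1}")
    case True
    then have "\<bar>t ^ k\<bar> * \<bar>e (seg t x) ws\<bar> \<le> 1 * \<bar>e (seg t x) ws\<bar>"
      by (intro mult_right_mono) (auto simp: power_le_one)
    with True e_bound[of "seg t x" ws] show ?thesis by (simp add: abs_mult mult.assoc)
  qed simp
qed measurable

lemma potential_alternating: "alternating k (potential x)"
proof (cases "x \<in> good")
  case True
  have "alternating k (\<lambda>us. \<integral>t. unit_ind t * (t ^ k * e (seg t x) ((x - y) # us)) \<partial>lborel)"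
  proof (rule alternating_integral)
    show "alternating k (\<lambda>us. unit_ind t * (t ^ k * e (seg t x) ((x - y) # us)))" for t
      using alternating_lincomb[OF alternating_Cons[OF alt[of "seg t x"], of "x - y"] alternating_zero,
          of "unit_ind t * t ^ k" 0]
      by (simp add: mult.assoc)
  qed (rule integrable_kernel[OF True])
  with True show ?thesis by (simp add: potential_def[abs_def])
next
  case False
  then show ?thesis by (simp add: potential_def[abs_def] alternating_zero)
qed

lemma potential_measurable: "(\<lambda>x. potential x us) \<in> borel_measurable borel"
proof -
  have "(\<lambda>x. \<integral>t. unit_ind t * (t ^ k * e (seg t x) ((x - y) # us)) \<partial>lborel) \<in> borel_measurable lborel"
    by (rule lborel.borel_measurable_lebesgue_integral) (simp add: case_prod_unfold)
  then show ?thesis unfolding potential_def by measurable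
qed

text \<open>The mean-square inequality in t, t^k \<le> 1, and Cauchy-Schwarz over the basis for the
  contraction with x - y. Summing over the remaining slots reassembles the energy.\<close>

lemma potential_square_le:
  assumes x: "x \<in> good" and R: "norm (x - y) \<le> R"
  shows "(\<Sum>us\<in>basis_lists k. (potential x us)\<^sup>2) \<le> R\<^sup>2 * (\<integral>t. unit_ind t * energy (seg t x) \<partial>lborel)"
proof -
  let ?u = "\<lambda>us t. t ^ k * e (seg t x) ((x - y) # us)"
  have pointwise: "(\<Sum>us\<in>basis_lists k. unit_ind t * (?u us t)\<^sup>2) \<le> R\<^sup>2 * (unit_ind t * energy (seg t x))" for t
  proof (cases "t \<in> {0<..<1}")
    case True
    have "(?u us t)\<^sup>2 \<le> R\<^sup>2 * (\<Sum>b\<in>Basis. (e (seg t x) (b # us))\<^sup>2)" for us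
    proof -
      have "(?u us t)\<^sup>2 \<le> (e (seg t x) ((x - y) # us))\<^sup>2"
        using True mult_right_mono[of "(t ^ k)\<^sup>2" 1 "(e (seg t x) ((x - y) # us))\<^sup>2"]
        by (simp add: power_mult_distrib power_le_one)
      also have "\<dots> = (\<Sum>b\<in>Basis. ((x - y) \<bullet> b) * e (seg t x) (b # us))\<^sup>2"
        by (subst alternating_expand[OF alt]) (rule refl)
      also have "\<dots> \<le> (\<Sum>b\<in>Basis. ((x - y) \<bullet> b)\<^sup>2) * (\<Sum>b\<in>Basis. (e (seg t x) (b # us))\<^sup>2)"
        by (rule Cauchy_Schwarz_ineq_sum)
      also have "(\<Sum>b\<in>Basis. ((x - y) \<bullet> b)\<^sup>2) = (norm (x - y))\<^sup>2"
        unfolding power2_norm_eq_inner using euclidean_inner[of "x - y" "x - y"]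
        by (simp only: power2_eq_square)
      also have "\<dots> * (\<Sum>b\<in>Basis. (e (seg t x) (b # us))\<^sup>2) \<le> R\<^sup>2 * (\<Sum>b\<in>Basis. (e (seg t x) (b # us))\<^sup>2)"
        using R by (intro mult_right_mono power_mono sum_nonneg) auto
      finally show ?thesis .
    qed
    then have "(\<Sum>us\<in>basis_lists k. (?u us t)\<^sup>2) \<le> (\<Sum>us\<in>basis_lists k. R\<^sup>2 * (\<Sum>b\<in>Basis. (e (seg t x) (b # us))\<^sup>2))"
      by (rule sum_mono)
    also have "\<dots> = R\<^sup>2 * energy (seg t x)"
      unfolding energy_def sum_basis_lists_Suc by (subst sum.swap) (simp add: sum_distrib_left)
    finally show ?thesis using True by simp
  qed simp
  have int_energy: "integrable lborel (\<lambda>t. unit_ind t * energy (seg t x))"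
    by (rule integrable_seg[OF x, where C = 1]) (auto simp: indicator_def energy_nonneg)
  have int_sq: "integrable lborel (\<lambda>t. unit_ind t * (?u us t)\<^sup>2)" if "us \<in> basis_lists k" for us
  proof (rule integrable_seg[OF x, where C = "R\<^sup>2"])
    fix t
    have "unit_ind t * (?u us t)\<^sup>2 \<le> (\<Sum>us\<in>basis_lists k. unit_ind t * (?u us t)\<^sup>2)"
      using that by (intro member_le_sum) auto
    also note pointwise[of t]
    also have "R\<^sup>2 * (unit_ind t * energy (seg t x)) \<le> R\<^sup>2 * (unit_ind t * (1 + energy (seg t x)))"
      by (intro mult_left_mono) auto
    finally show "\<bar>unit_ind t * (?u us t)\<^sup>2\<bar> \<le> R\<^sup>2 * (unit_ind t * (1 + energy (seg t x)))" by simp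
  qed measurable
  have "(\<Sum>us\<in>basis_lists k. (potential x us)\<^sup>2) \<le>
      (\<Sum>us\<in>basis_lists k. \<integral>t. unit_ind t * (?u us t)\<^sup>2 \<partial>lborel)"
    using x by (intro sum_mono) (simp add: potential_def square_integral_unit_interval_le integrable_kernel int_sq)
  also have "\<dots> = (\<integral>t. (\<Sum>us\<in>basis_lists k. unit_ind t * (?u us t)\<^sup>2) \<partial>lborel)"
    using int_sq by (subst Bochner_Integration.integral_sum) auto
  also have "\<dots> \<le> (\<integral>t. R\<^sup>2 * (unit_ind t * energy (seg t x)) \<partial>lborel)"
    by (intro integral_mono Bochner_Integration.integrable_sum integrable_mult_right int_sq int_energy pointwise)
  finally show ?thesis by simp
qed

end

text \<open>\<open>M\<close> stands for the bound that a well-chosen base point provides.\<close>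

locale homotopy_operator_bounded = homotopy_operator +
  fixes M :: real
  assumes M: "(\<integral>\<^sup>+x. indicator K x * (\<integral>\<^sup>+t. indicator {0<..<1} t * ennreal (energy (seg t x)) \<partial>lborel) \<partial>lborel) \<le> ennreal M"
begin

text \<open>A finite integral over K forces the inner integral to be finite almost everywhere on
  K.\<close>

lemma AE_good: "AE x in lborel. x \<in> K \<longrightarrow> x \<in> good"
proof -
  have "(\<lambda>x. \<integral>\<^sup>+t. indicator {0<..<1} t * ennreal (energy (seg t x)) \<partial>lborel) \<in> borel_measurable lborel"
    by (rule lborel.borel_measurable_nn_integral) measurable
  then have "AE x in lborel. indicator K x * (\<integral>\<^sup>+t. indicator {0<..<1} t * ennreal (energy (seg t x)) \<partial>lborel) \<noteq> \<infinity>"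
    using M by (intro nn_integral_PInf_AE) (auto simp: top_unique)
  then show ?thesis by eventually_elim (auto simp: good_def less_top)
qed

lemma nn_integral_potential_square:
  assumes R: "\<And>x. x \<in> K \<Longrightarrow> norm (x - y) \<le> R"
  shows "(\<integral>\<^sup>+x. ennreal (indicator K x * (\<Sum>us\<in>basis_lists k. (potential x us)\<^sup>2)) \<partial>lborel) \<le> ennreal (R\<^sup>2 * M)"
proof -
  have "(\<integral>\<^sup>+x. ennreal (indicator K x * (\<Sum>us\<in>basis_lists k. (potential x us)\<^sup>2)) \<partial>lborel) \<le>
    (\<integral>\<^sup>+x. ennreal (R\<^sup>2) * (indicator K x * (\<integral>\<^sup>+t. indicator {0<..<1} t * ennreal (energy (seg t x)) \<partial>lborel)) \<partial>lborel)"
  proof (rule nn_integral_mono_AE)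
    show "AE x in lborel. ennreal (indicator K x * (\<Sum>us\<in>basis_lists k. (potential x us)\<^sup>2)) \<le>
      ennreal (R\<^sup>2) * (indicator K x * (\<integral>\<^sup>+t. indicator {0<..<1} t * ennreal (energy (seg t x)) \<partial>lborel))"
      using AE_good
    proof eventually_elim
      case (elim x)
      show ?case
      proof (cases "x \<in> K")
        case True
        with elim have good: "x \<in> good" by simp
        have int: "integrable lborel (\<lambda>t. unit_ind t * energy (seg t x))"
          by (rule integrable_seg[OF good, where C = 1]) (auto simp: indicator_def energy_nonneg)
        have "ennreal (\<Sum>us\<in>basis_lists k. (potential x us)\<^sup>2) \<le> ennreal (R\<^sup>2 * (\<integral>t. unit_ind t * energy (seg t x) \<partial>lborel))"
          by (intro ennreal_leI potential_square_le[OF good R[OF True]])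
        also have "\<dots> = ennreal (R\<^sup>2) * (\<integral>\<^sup>+t. ennreal (unit_ind t * energy (seg t x)) \<partial>lborel)"
          by (subst nn_integral_eq_integral[OF int])
            (auto simp: energy_nonneg ennreal_mult' intro!: integral_nonneg_AE)
        also have "(\<integral>\<^sup>+t. ennreal (unit_ind t * energy (seg t x)) \<partial>lborel) =
            (\<integral>\<^sup>+t. indicator {0<..<1} t * ennreal (energy (seg t x)) \<partial>lborel)"
          by (intro nn_integral_cong) (auto simp: indicator_def)
        finally show ?thesis using True by simp
      qed simp
    qed
  qed
  also have "\<dots> = ennreal (R\<^sup>2) * (\<integral>\<^sup>+x. indicator K x * (\<integral>\<^sup>+t. indicator {0<..<1} t * ennreal (energy (seg t x)) \<partial>lborel) \<partial>lborel)"
  proof (rule nn_integral_cmult)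
    have "(\<lambda>x. \<integral>\<^sup>+t. indicator {0<..<1} t * ennreal (energy (seg t x)) \<partial>lborel) \<in> borel_measurable lborel"
      by (rule lborel.borel_measurable_nn_integral) measurable
    then show "(\<lambda>x. indicator K x * (\<integral>\<^sup>+t. indicator {0<..<1} t * ennreal (energy (seg t x)) \<partial>lborel)) \<in> borel_measurable lborel"
      by measurable
  qed
  also have "\<dots> \<le> ennreal (R\<^sup>2) * ennreal M" by (intro mult_left_mono M) auto
  finally show ?thesis by (simp add: ennreal_mult')
qed

lemma potential_L2:
  assumes R: "\<And>x. x \<in> K \<Longrightarrow> norm (x - y) \<le> R" and M0: "0 \<le> M"
  shows "potential \<in> L2_form K k" "L2_inner K k potential potential \<le> R\<^sup>2 * M / fact k"
proof -
  define q where "q x = (\<Sum>us\<in>basis_lists k. (potential x us)\<^sup>2)" for x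
  have q_meas: "(\<lambda>x. indicator K x * q x) \<in> borel_measurable lborel"
    unfolding q_def using potential_measurable by measurable
  note bound = nn_integral_potential_square[OF R, folded q_def]
  have q0: "0 \<le> q x" for x by (simp add: q_def sum_nonneg)
  have q_int: "integrable lborel (\<lambda>x. indicator K x * q x)"
    by (rule integrableI_nonneg[OF q_meas])
      (use bound q0 in \<open>auto intro: le_less_trans\<close>)
  have "ennreal (\<integral>x. indicator K x * q x \<partial>lborel) \<le> ennreal (R\<^sup>2 * M)"
    using bound nn_integral_eq_integral[OF q_int] q0 by auto
  then have "(\<integral>x. indicator K x * q x \<partial>lborel) \<le> R\<^sup>2 * M"
    using M0 by (simp add: ennreal_le_iff)
  moreover have "L2_inner K k potential potential = (\<integral>x. indicator K x * q x / fact k \<partial>lborel)"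
    unfolding L2_inner_eq form_inner_eq q_def by (simp add: power2_eq_square)
  ultimately show "L2_inner K k potential potential \<le> R\<^sup>2 * M / fact k"
    by (simp add: divide_right_mono)
  show "potential \<in> L2_form K k"
  proof (rule L2_formI)
    fix vs :: "'a list"
    let ?C = "prod_list (map norm vs)" and ?N = "card (basis_lists k :: 'a list set)"
    show "(\<lambda>x. indicator K x * potential x vs) \<in> borel_measurable borel"
      using potential_measurable by measurable
    \<comment> \<open>Arbitrary argument vectors are reduced to the basis components collected in
      \<open>q\<close>.\<close>
    have sq: "(potential x vs)\<^sup>2 \<le> ?C\<^sup>2 * ?N * q x" for x
    proof -
      have "(potential x vs)\<^sup>2 \<le> (?C * (\<Sum>bs\<in>basis_lists k. \<bar>potential x bs\<bar>))\<^sup>2"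
        using power_mono[OF alternating_bound[OF potential_alternating, of x vs], of 2] by simp
      also have "\<dots> = ?C\<^sup>2 * (\<Sum>bs\<in>basis_lists k. \<bar>potential x bs\<bar>)\<^sup>2"
        by (simp add: power_mult_distrib)
      also have "\<dots> \<le> ?C\<^sup>2 * ((\<Sum>bs\<in>basis_lists k. \<bar>potential x bs\<bar>\<^sup>2) * ?N)"
        by (intro mult_left_mono sum_squared_le_sum_of_squares) auto
      finally show ?thesis by (simp add: q_def mult_ac)
    qed
    show "integrable lborel (\<lambda>x. indicator K x * (potential x vs)\<^sup>2)"
    proof (rule Bochner_Integration.integrable_bound)
      show "integrable lborel (\<lambda>x. ?C\<^sup>2 * ?N * (indicator K x * q x))"
        using q_int by simp
      show "(\<lambda>x. indicator K x * (potential x vs)\<^sup>2) \<in> borel_measurable lborel"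
        using potential_measurable by measurable
      show "AE x in lborel. norm (indicator K x * (potential x vs)\<^sup>2) \<le> norm (?C\<^sup>2 * ?N * (indicator K x * q x))"
        using sq q0 by (intro AE_I2) (auto simp: indicator_def)
    qed
  qed (rule potential_alternating)
qed

end

text \<open>The support of \<psi> lies in the support of \<phi> shrunk towards y by the factor t.
  Convexity of K keeps the shrunken set inside K.\<close>

lemma test_function_times_dilation:
  fixes \<phi> :: "'a::euclidean_space \<Rightarrow> real" and j :: 'a
  assumes K: "convex K" "y \<in> K" and t: "0 < t" "t < 1" and \<phi>: "test_function K \<phi>"
  defines "\<psi> \<equiv> \<lambda>z. ((z - y) \<bullet> j) * \<phi> (y + (1 / t) *\<^sub>R (z - y))"
  shows "test_function K \<psi>"
    and "frechet_derivative \<psi> (at z) w = (w \<bullet> j) * \<phi> (y + (1 / t) *\<^sub>R (z - y)) +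
      ((z - y) \<bullet> j) * ((1 / t) * frechet_derivative \<phi> (at (y + (1 / t) *\<^sub>R (z - y))) w)"
proof -
  have affine: "y + (1 / t) *\<^sub>R (z - y) = (y - (1 / t) *\<^sub>R y) + (1 / t) *\<^sub>R z" for z
    by (simp add: algebra_simps)
  have "C_diff m \<psi>" for m
    unfolding \<psi>_def affine
    by (intro C_diff_mult C_diff_inner C_diff_affine test_functionD(1)[OF \<phi>] bounded_linear_scaleR_right)
  moreover have "closure {z. \<psi> z \<noteq> 0} \<subseteq> (\<lambda>x. y + t *\<^sub>R (x - y)) ` closure {x. \<phi> x \<noteq> 0}" (is "_ \<subseteq> ?S")
  proof (rule closure_minimal)
    show "{z. \<psi> z \<noteq> 0} \<subseteq> ?S"
    proof
      fix z assume "z \<in> {z. \<psi> z \<noteq> 0}"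
      then have "y + (1 / t) *\<^sub>R (z - y) \<in> closure {x. \<phi> x \<noteq> 0}"
        using closure_subset[of "{x. \<phi> x \<noteq> 0}"] by (auto simp: \<psi>_def)
      moreover have "z = y + t *\<^sub>R ((y + (1 / t) *\<^sub>R (z - y)) - y)" using t by simp
      ultimately show "z \<in> ?S" by blast
    qed
    have "compact ?S"
      by (intro compact_continuous_image test_functionD(6)[OF \<phi>] continuous_intros)
    then show "closed ?S" by (rule compact_imp_closed)
  qed
  moreover have "compact ?S"
    by (intro compact_continuous_image test_functionD(6)[OF \<phi>] continuous_intros)
  moreover have "?S \<subseteq> K"
  proof
    fix z assume "z \<in> ?S"
    then obtain x where "x \<in> K" "z = y + t *\<^sub>R (x - y)" using \<phi> by (auto simp: test_function_def)
    moreover from this have "z = (1 - t) *\<^sub>R y + t *\<^sub>R x" by (simp add: algebra_simps)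
    ultimately show "z \<in> K" using convexD_alt[OF K, of x t] t by simp
  qed
  ultimately show "test_function K \<psi>"
    unfolding test_function_def by (meson bounded_subset closed_closure compact_eq_bounded_closed order_trans)
  have "((\<lambda>z. \<phi> ((y - (1 / t) *\<^sub>R y) + (1 / t) *\<^sub>R z)) has_derivative
      (\<lambda>w. frechet_derivative \<phi> (at ((y - (1 / t) *\<^sub>R y) + (1 / t) *\<^sub>R z)) ((1 / t) *\<^sub>R w))) (at z)"
    by (intro frechet_derivative_affine bounded_linear_scaleR_right test_functionD(2)[OF \<phi>])
  then have D: "((\<lambda>z. \<phi> (y + (1 / t) *\<^sub>R (z - y))) has_derivative
      (\<lambda>w. (1 / t) * frechet_derivative \<phi> (at (y + (1 / t) *\<^sub>R (z - y))) w)) (at z)"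
    unfolding affine linear_cmul[OF linear_frechet_derivative[OF test_functionD(2)[OF \<phi>]]] by simp
  have "((\<lambda>z. (z - y) \<bullet> j) has_derivative (\<lambda>w. w \<bullet> j)) (at z)"
    by (auto intro!: derivative_eq_intros)
  from frechet_derivative_eqI[OF has_derivative_mult[OF this D]]
  show "frechet_derivative \<psi> (at z) w = (w \<bullet> j) * \<phi> (y + (1 / t) *\<^sub>R (z - y)) +
      ((z - y) \<bullet> j) * ((1 / t) * frechet_derivative \<phi> (at (y + (1 / t) *\<^sub>R (z - y))) w)"
    unfolding \<psi>_def by simp
qed

section \<open>Cartan's formula and the exterior derivative of the potential\<close>

context homotopy_operator
begin

text \<open>Testing \<open>d e = 0\<close> against \<open>(z - y)\<^sub>j \<phi>(seg (1/t) z)\<close> in the components \<open>j, vs\<close> and summing over the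
  basis vectors \<open>j\<close> contracts \<open>e\<close> with \<open>z - y\<close>: this is Cartan's formula in weak form.\<close>

lemma weak_Cartan:
  assumes \<phi>: "test_function K \<phi>" and t: "0 < t" "t < 1" and vs: "length vs = Suc k"
  shows "(\<Sum>i\<le>k. (-1) ^ i * (\<integral>z. e z ((seg (1 / t) z - y) # take i vs @ drop (Suc i) vs) *
       frechet_derivative \<phi> (at (seg (1 / t) z)) (vs ! i) \<partial>lborel)) =
    (\<integral>z. e z vs * (real (DIM('a) - Suc k) * \<phi> (seg (1 / t) z) +
       frechet_derivative \<phi> (at (seg (1 / t) z)) (seg (1 / t) z - y)) \<partial>lborel)"
proof -
  define x where "x z = seg (1 / t) z" for z
  define del where "del i = take i vs @ drop (Suc i) vs" for i
  define \<psi> where "\<psi> j z = ((z - y) \<bullet> j) * \<phi> (x z)" for j z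
  define D where "D z = frechet_derivative \<phi> (at (x z))" for z
  have x: "x z = y + (1 / t) *\<^sub>R (z - y)" for z by (simp add: x_def seg_def)
  have test: "test_function K (\<psi> j)" for j
    unfolding \<psi>_def x by (rule test_function_times_dilation(1)[OF convex_K y t \<phi>])
  have D\<psi>: "frechet_derivative (\<psi> j) (at z) w = (w \<bullet> j) * \<phi> (x z) + ((z - y) \<bullet> j) * ((1 / t) * D z w)" for j z w
    unfolding \<psi>_def x D_def by (rule test_function_times_dilation(2)[OF convex_K y t \<phi>])
  have linD: "linear (D z)" for z
    unfolding D_def by (rule linear_frechet_derivative[OF test_functionD(2)[OF \<phi>]])
  have ind: "indicator K z * (e z us * c) = e z us * c" for z us c
    using outside[of z us] by (auto simp: indicator_def)
  have int\<psi>: "integrable lborel (\<lambda>z. e z us * frechet_derivative (\<psi> j) (at z) w)" for us j w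
    using L2_form_integrable_test(2)[OF e_L2 test] by (simp add: ind)
  have [measurable]: "x \<in> borel_measurable borel" unfolding x_def by measurable
  have int\<phi>: "integrable lborel (\<lambda>z. e z us * \<phi> (x z))" for us
  proof -
    obtain B where "\<And>w. \<bar>\<phi> w\<bar> \<le> B" using test_function_bounded[OF \<phi>] by blast
    moreover have "(\<lambda>z. \<phi> (x z)) \<in> borel_measurable borel"
      by (rule measurable_compose[OF _ test_function_measurable(1)[OF \<phi>]]) measurable
    ultimately show ?thesis
      using L2_form_integrable_times[OF e_L2, of "\<lambda>z. \<phi> (x z)" B us] by (simp add: ind)
  qed
  \<comment> \<open>The term i = 0 deletes j from the list and differentiates in direction j. It is
    split off next; the other terms keep j in front.\<close>
  have "(\<Sum>i\<le>Suc k. (-1) ^ i * (\<integral>z. e z (take i (j # vs) @ drop (Suc i) (j # vs)) *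
      frechet_derivative (\<psi> j) (at z) ((j # vs) ! i) \<partial>lborel)) = 0" for j
    using closed[unfolded weak_d_eq ind, rule_format, of "\<psi> j" "j # vs"] test[of j] vs
    by (simp add: zero_form_def del: sum.atMost_Suc)
  then have closed_j: "(\<integral>z. e z vs * frechet_derivative (\<psi> j) (at z) j \<partial>lborel) =
      (\<Sum>i\<le>k. (-1) ^ i * (\<integral>z. e z (j # del i) * frechet_derivative (\<psi> j) (at z) (vs ! i) \<partial>lborel))" for j
    by (simp add: sum.atMost_Suc_shift del_def sum_negf del: sum.atMost_Suc)
  have xz: "(x z - y) \<bullet> j = ((z - y) \<bullet> j) * (1 / t)" for z j by (simp add: x)
  \<comment> \<open>Differentiating (z - y)_j puts w into the first slot; differentiating \<phi>
    gives a factor 1/t, which turns z - y into \<open>x z - y\<close>.\<close>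
  have sum_front: "(\<Sum>j\<in>Basis. e z (j # us) * frechet_derivative (\<psi> j) (at z) w) =
      e z (w # us) * \<phi> (x z) + e z ((x z - y) # us) * D z w" for z us w
  proof -
    have "(\<Sum>j\<in>Basis. e z (j # us) * frechet_derivative (\<psi> j) (at z) w) =
      (\<Sum>j\<in>Basis. (w \<bullet> j) * e z (j # us)) * \<phi> (x z) + (\<Sum>j\<in>Basis. ((x z - y) \<bullet> j) * e z (j # us)) * D z w"
      unfolding sum_distrib_right sum.distrib[symmetric]
      unfolding D\<psi> xz by (intro sum.cong refl) (simp add: distrib_left mult_ac)
    then show ?thesis by (simp flip: alternating_expand[OF alt])
  qed
  \<comment> \<open>The derivative of (z - y)_j in direction j is 1, and summing over the basis
    produces the dimension n.\<close>
  have sum_div: "(\<Sum>j\<in>Basis. e z vs * frechet_derivative (\<psi> j) (at z) j) =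
      e z vs * (DIM('a) * \<phi> (x z) + D z (x z - y))" for z
  proof -
    have "D z (x z - y) = D z (\<Sum>j\<in>Basis. ((x z - y) \<bullet> j) *\<^sub>R j)" by (subst euclidean_representation) (rule refl)
    also have "\<dots> = (\<Sum>j\<in>Basis. ((x z - y) \<bullet> j) * D z j)"
      by (subst linear_sum[OF linD]) (simp add: linear_cmul[OF linD])
    finally have Dx: "D z (x z - y) = (\<Sum>j\<in>Basis. ((z - y) \<bullet> j) * ((1 / t) * D z j))"
      by (simp add: x algebra_simps)
    show ?thesis unfolding D\<psi> Dx by (simp add: sum.distrib flip: sum_distrib_left)
  qed
  define I where "I i = (\<integral>z. e z ((x z - y) # del i) * D z (vs ! i) \<partial>lborel)" for i
  define J where "J = (\<integral>z. e z vs * \<phi> (x z) \<partial>lborel)"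
  have front: "(\<Sum>j\<in>Basis. \<integral>z. e z (j # del i) * frechet_derivative (\<psi> j) (at z) (vs ! i) \<partial>lborel) =
      (-1) ^ i * J + I i" if i: "i \<le> k" for i
  proof -
    have e_del: "e z (vs ! i # del i) = (-1) ^ i * e z vs" for z
      unfolding del_def using i vs by (intro alternating_move_nth[OF alt]) auto
    have int_sum: "integrable lborel (\<lambda>z. \<Sum>j\<in>Basis. e z (j # del i) * frechet_derivative (\<psi> j) (at z) (vs ! i))"
      by (intro Bochner_Integration.integrable_sum int\<psi>)
    \<comment> \<open>Integrability of the contracted term is obtained by subtracting the
      \<phi>-term from the full sum.\<close>
    have "integrable lborel (\<lambda>z. (e z (vs ! i # del i) * \<phi> (x z) + e z ((x z - y) # del i) * D z (vs ! i))
        - e z (vs ! i # del i) * \<phi> (x z))"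
      using int_sum by (intro Bochner_Integration.integrable_diff int\<phi>) (simp add: sum_front)
    then have int2: "integrable lborel (\<lambda>z. e z ((x z - y) # del i) * D z (vs ! i))" by simp
    have "(\<Sum>j\<in>Basis. \<integral>z. e z (j # del i) * frechet_derivative (\<psi> j) (at z) (vs ! i) \<partial>lborel) =
        (\<integral>z. (\<Sum>j\<in>Basis. e z (j # del i) * frechet_derivative (\<psi> j) (at z) (vs ! i)) \<partial>lborel)"
      using int\<psi> by simp
    also have "\<dots> = (\<integral>z. e z (vs ! i # del i) * \<phi> (x z) \<partial>lborel) + I i"
      unfolding sum_front I_def using int\<phi> int2 by simp
    also have "(\<integral>z. e z (vs ! i # del i) * \<phi> (x z) \<partial>lborel) = (-1) ^ i * J"
      unfolding e_del J_def by (simp add: mult.assoc)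
    finally show ?thesis .
  qed
  have int_div: "integrable lborel (\<lambda>z. e z vs * (DIM('a) * \<phi> (x z) + D z (x z - y)))"
    unfolding sum_div[symmetric] by (intro Bochner_Integration.integrable_sum int\<psi>)
  have "(\<integral>z. e z vs * (DIM('a) * \<phi> (x z) + D z (x z - y)) \<partial>lborel) =
      (\<Sum>j\<in>Basis. \<integral>z. e z vs * frechet_derivative (\<psi> j) (at z) j \<partial>lborel)"
    unfolding sum_div[symmetric] using int\<psi> by simp
  also have "\<dots> = (\<Sum>i\<le>k. (-1) ^ i * (\<Sum>j\<in>Basis. \<integral>z. e z (j # del i) * frechet_derivative (\<psi> j) (at z) (vs ! i) \<partial>lborel))"
    unfolding closed_j by (subst sum.swap) (simp add: sum_distrib_left)
  also have "\<dots> = (\<Sum>i\<le>k. (-1) ^ i * ((-1) ^ i * J + I i))"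
    by (intro sum.cong refl) (simp add: front)
  \<comment> \<open>The two signs cancel, leaving one \<open>J\<close> for each of the k + 1 slots.
    Taken from the n copies of the divergence term they leave the weight n - k - 1.\<close>
  also have "\<dots> = Suc k * J + (\<Sum>i\<le>k. (-1) ^ i * I i)"
    by (simp add: distrib_left sum.distrib flip: mult.assoc power_add)
  finally have "(\<Sum>i\<le>k. (-1) ^ i * I i) = (\<integral>z. e z vs * (DIM('a) * \<phi> (x z) + D z (x z - y)) \<partial>lborel) - Suc k * J"
    by simp
  also have "\<dots> = (\<integral>z. e z vs * (DIM('a) * \<phi> (x z) + D z (x z - y)) - Suc k * (e z vs * \<phi> (x z)) \<partial>lborel)"
    unfolding J_def using int_div int\<phi> by simp
  also have "\<dots> = (\<integral>z. e z vs * (real (DIM('a) - Suc k) * \<phi> (x z) + D z (x z - y)) \<partial>lborel)"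
    using k by (simp add: of_nat_diff algebra_simps)
  finally show ?thesis by (simp add: I_def D_def del_def x_def)
qed

lemma integral_seg:
  assumes [measurable]: "f \<in> borel_measurable borel" and "0 < t"
  shows "(\<integral>z. f z \<partial>lborel) = t ^ DIM('a) * (\<integral>x. f (seg t x) \<partial>lborel)"
  using integral_lborel_affine[of f t "y - t *\<^sub>R y"] assms
  by (simp add: seg_def algebra_simps)

end

context homotopy_operator_bounded
begin

text \<open>The joint majorant that justifies exchanging the x- and t-integrals; it is integrable
  since \<open>M\<close> and the measure of K are finite.\<close>

lemma integrable_kernel_pair:
  fixes w :: "'a \<times> real \<Rightarrow> real"
  assumes [measurable]: "w \<in> borel_measurable (lborel \<Otimes>\<^sub>M lborel)"
    and w: "\<And>x t. \<bar>w (x, t)\<bar> \<le> C * (indicator K x * (unit_ind t * (1 + energy (seg t x))))" and C: "0 \<le> C"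
  shows "integrable (lborel \<Otimes>\<^sub>M lborel) w"
proof (rule integrableI_bounded)
  have "(\<integral>\<^sup>+p. ennreal (norm (w p)) \<partial>(lborel \<Otimes>\<^sub>M lborel)) = (\<integral>\<^sup>+x. \<integral>\<^sup>+t. ennreal (norm (w (x, t))) \<partial>lborel \<partial>lborel)"
    by (rule lborel.nn_integral_fst[symmetric]) measurable
  also have "\<dots> \<le> (\<integral>\<^sup>+x. ennreal C * (indicator K x * (1 + (\<integral>\<^sup>+t. indicator {0<..<1} t * ennreal (energy (seg t x)) \<partial>lborel))) \<partial>lborel)"
  proof (rule nn_integral_mono)
    fix x
    have "(\<integral>\<^sup>+t. ennreal (norm (w (x, t))) \<partial>lborel) \<le>
        (\<integral>\<^sup>+t. ennreal C * (indicator K x * (indicator {0<..<1} t + indicator {0<..<1} t * ennreal (energy (seg t x)))) \<partial>lborel)"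
    proof (rule nn_integral_mono)
      fix t
      have "ennreal (norm (w (x, t))) \<le> ennreal (C * (indicator K x * (unit_ind t * (1 + energy (seg t x)))))"
        using w[of x t] by (intro ennreal_leI) simp
      also have "\<dots> = ennreal C * (indicator K x * (indicator {0<..<1} t + indicator {0<..<1} t * ennreal (energy (seg t x))))"
        using C energy_nonneg[of "seg t x"] ennreal_plus[of 1 "energy (seg t x)"]
        by (auto simp: indicator_def ennreal_mult)
      finally show "ennreal (norm (w (x, t))) \<le> ennreal C * (indicator K x * (indicator {0<..<1} t + indicator {0<..<1} t * ennreal (energy (seg t x))))" .
    qed
    also have "\<dots> = ennreal C * (indicator K x * (1 + (\<integral>\<^sup>+t. indicator {0<..<1} t * ennreal (energy (seg t x)) \<partial>lborel)))"
      by (simp add: nn_integral_cmult nn_integral_add)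
    finally show "(\<integral>\<^sup>+t. ennreal (norm (w (x, t))) \<partial>lborel) \<le>
      ennreal C * (indicator K x * (1 + (\<integral>\<^sup>+t. indicator {0<..<1} t * ennreal (energy (seg t x)) \<partial>lborel)))" .
  qed
  also have "\<dots> = ennreal C * (emeasure lborel K + (\<integral>\<^sup>+x. indicator K x * (\<integral>\<^sup>+t. indicator {0<..<1} t * ennreal (energy (seg t x)) \<partial>lborel) \<partial>lborel))"
  proof -
    have [measurable]: "(\<lambda>x. \<integral>\<^sup>+t. indicator {0<..<1} t * ennreal (energy (seg t x)) \<partial>lborel) \<in> borel_measurable borel"
      using lborel.borel_measurable_nn_integral[of "\<lambda>x t. indicator {0<..<1} t * ennreal (energy (seg t x))" lborel]
      by measurable
    show ?thesis by (simp add: nn_integral_cmult nn_integral_add distrib_left)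
  qed
  also have "\<dots> < \<infinity>"
    using M emeasure_D_finite by (auto simp: ennreal_mult_less_top intro: le_less_trans)
  finally show "(\<integral>\<^sup>+p. ennreal (norm (w p)) \<partial>(lborel \<Otimes>\<^sub>M lborel)) < \<infinity>" .
qed measurable

text \<open>The two kernels in play: the contracted one, paired with a derivative of a test
  function, and the uncontracted one that Cartan's formula leaves. The bound on \<psi> confines x to
  K, where |x - y| \<le> R.\<close>

lemma integrable_kernel_pair_times:
  assumes R: "\<And>x. x \<in> K \<Longrightarrow> norm (x - y) \<le> R"
    and \<psi> [measurable]: "\<psi> \<in> borel_measurable borel" and B: "\<And>x. \<bar>\<psi> x\<bar> \<le> B * indicator K x"
  shows "integrable (lborel \<Otimes>\<^sub>M lborel) (\<lambda>(x, t). unit_ind t * (t ^ k * e (seg t x) ((x - y) # us)) * \<psi> x)"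
    and "integrable (lborel \<Otimes>\<^sub>M lborel) (\<lambda>(x, t). unit_ind t * (t ^ k * e (seg t x) vs) * \<psi> x)"
proof -
  let ?N = "real (card (basis_lists (Suc k) :: 'a list set))"
  have R0: "0 \<le> R" using R[OF y] by simp
  have B0: "0 \<le> B" using B[of y] y by simp
  have pl: "0 \<le> prod_list (map norm ws)" for ws :: "'a list" by (induction ws) auto
  have bound: "\<bar>unit_ind t * (t ^ k * e (seg t x) ws) * \<psi> x\<bar> \<le>
      (L * ?N * B) * (indicator K x * (unit_ind t * (1 + energy (seg t x))))"
    if L: "x \<in> K \<Longrightarrow> prod_list (map norm ws) \<le> L" for L ws x t
  proof (cases "x \<in> K \<and> t \<in> {0<..<1}")
    case True
    then have "\<bar>t ^ k * e (seg t x) ws\<bar> \<le> 1 * (prod_list (map norm ws) * (?N * (1 + energy (seg t x))))"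
      unfolding abs_mult by (intro mult_mono e_bound) (auto simp: power_le_one)
    also have "\<dots> \<le> L * (?N * (1 + energy (seg t x)))"
      using True L energy_nonneg[of "seg t x"] by (auto intro!: mult_right_mono)
    finally have "\<bar>t ^ k * e (seg t x) ws\<bar> * \<bar>\<psi> x\<bar> \<le> L * (?N * (1 + energy (seg t x))) * B"
      using B[of x] True by (intro mult_mono) (auto intro: order_trans[OF abs_ge_zero])
    with True show ?thesis by (simp add: abs_mult mult_ac)
  next
    case False
    with B[of x] show ?thesis by auto
  qed
  show "integrable (lborel \<Otimes>\<^sub>M lborel) (\<lambda>(x, t). unit_ind t * (t ^ k * e (seg t x) ((x - y) # us)) * \<psi> x)"
  proof (rule integrable_kernel_pair)
    show "(\<lambda>(x, t). unit_ind t * (t ^ k * e (seg t x) ((x - y) # us)) * \<psi> x) \<in> borel_measurable (lborel \<Otimes>\<^sub>M lborel)"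
      unfolding case_prod_unfold by measurable
    show "\<bar>case (x, t) of (x, t) \<Rightarrow> unit_ind t * (t ^ k * e (seg t x) ((x - y) # us)) * \<psi> x\<bar> \<le>
      ((R * prod_list (map norm us)) * ?N * B) * (indicator K x * (unit_ind t * (1 + energy (seg t x))))" for x t
      using bound[of x "(x - y) # us" "R * prod_list (map norm us)" t] R[of x] pl[of us] by (simp add: mult_right_mono)
  qed (use R0 B0 pl in auto)
  show "integrable (lborel \<Otimes>\<^sub>M lborel) (\<lambda>(x, t). unit_ind t * (t ^ k * e (seg t x) vs) * \<psi> x)"
  proof (rule integrable_kernel_pair)
    show "(\<lambda>(x, t). unit_ind t * (t ^ k * e (seg t x) vs) * \<psi> x) \<in> borel_measurable (lborel \<Otimes>\<^sub>M lborel)"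
      unfolding case_prod_unfold by measurable
    show "\<bar>case (x, t) of (x, t) \<Rightarrow> unit_ind t * (t ^ k * e (seg t x) vs) * \<psi> x\<bar> \<le>
      (prod_list (map norm vs) * ?N * B) * (indicator K x * (unit_ind t * (1 + energy (seg t x))))" for x t
      using bound[of x vs "prod_list (map norm vs)" t] by simp
  qed (use B0 pl in auto)
qed

end

lemma test_function_bounded_indicator:
  assumes "test_function K \<phi>"
  shows "\<exists>B. \<forall>x. \<bar>\<phi> x\<bar> \<le> B * indicator K x"
proof -
  obtain B where B: "\<And>x. \<bar>\<phi> x\<bar> \<le> B" using test_function_bounded[OF assms] by blast
  have "\<bar>\<phi> x\<bar> \<le> B * indicator K x" for x
    using B[of x] test_functionD(5)[OF assms, of x] by (cases "x \<in> K") auto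
  then show ?thesis by blast
qed

context homotopy_operator_bounded
begin

text \<open>Almost every point of K is good, and \<psi> vanishes off K, so the cut-off to
  \<open>good\<close> does not change the integral and Fubini applies.\<close>

lemma potential_integral:
  assumes R: "\<And>x. x \<in> K \<Longrightarrow> norm (x - y) \<le> R"
    and \<psi> [measurable]: "\<psi> \<in> borel_measurable borel" and B: "\<And>x. \<bar>\<psi> x\<bar> \<le> B * indicator K x"
  shows "integrable lborel (\<lambda>t. \<integral>x. unit_ind t * (t ^ k * e (seg t x) ((x - y) # us)) * \<psi> x \<partial>lborel)"
    and "(\<integral>x. indicator K x * (potential x us * \<psi> x) \<partial>lborel) =
      (\<integral>t. \<integral>x. unit_ind t * (t ^ k * e (seg t x) ((x - y) # us)) * \<psi> x \<partial>lborel \<partial>lborel)"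
proof -
  let ?w = "\<lambda>x t. unit_ind t * (t ^ k * e (seg t x) ((x - y) # us)) * \<psi> x"
  have int: "integrable (lborel \<Otimes>\<^sub>M lborel) (\<lambda>(x, t). ?w x t)"
    by (rule integrable_kernel_pair_times(1)[OF R \<psi> B])
  from lborel_pair.integrable_snd[OF int] show "integrable lborel (\<lambda>t. \<integral>x. ?w x t \<partial>lborel)" .
  have "(\<integral>x. indicator K x * (potential x us * \<psi> x) \<partial>lborel) = (\<integral>x. \<integral>t. ?w x t \<partial>lborel \<partial>lborel)"
  proof (rule integral_cong_AE)
    show "(\<lambda>x. indicator K x * (potential x us * \<psi> x)) \<in> borel_measurable lborel"
      using potential_measurable[of us] by measurable
    show "(\<lambda>x. \<integral>t. ?w x t \<partial>lborel) \<in> borel_measurable lborel"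
      using lborel_pair.integrable_fst[OF int] by auto
    show "AE x in lborel. indicator K x * (potential x us * \<psi> x) = (\<integral>t. ?w x t \<partial>lborel)"
      using AE_good
    proof eventually_elim
      case (elim x)
      show ?case
      proof (cases "x \<in> K")
        case True
        then show ?thesis using elim by (simp add: potential_def)
      next
        case False
        with B[of x] have "\<psi> x = 0" by simp
        then show ?thesis by simp
      qed
    qed
  qed
  also have "\<dots> = (\<integral>t. \<integral>x. ?w x t \<partial>lborel \<partial>lborel)"
    by (rule lborel_pair.Fubini_integral[OF int, symmetric])
  finally show "(\<integral>x. indicator K x * (potential x us * \<psi> x) \<partial>lborel) = (\<integral>t. \<integral>x. ?w x t \<partial>lborel \<partial>lborel)" .
qed

text \<open>For fixed t the substitution x = seg (1/t) z has Jacobian t^(-n), and t^k t^(-n) = 1 /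
  t^(m + 1) because n = k + m + 1. After exchanging the integrals the inner t-integral involves
  \<open>H\<close> alone.\<close>

lemma integral_dilation:
  assumes R: "\<And>x. x \<in> K \<Longrightarrow> norm (x - y) \<le> R"
    and H [measurable]: "H \<in> borel_measurable borel" and B: "\<And>x. \<bar>H x\<bar> \<le> B * indicator K x"
    and m: "DIM('a) = k + Suc m"
  shows "(\<integral>t. \<integral>x. unit_ind t * (t ^ k * e (seg t x) vs) * H x \<partial>lborel \<partial>lborel) =
    (\<integral>z. (\<integral>t. unit_ind t * (1 / t ^ Suc m * H (seg (1 / t) z)) \<partial>lborel) * e z vs \<partial>lborel)"
proof -
  define W where "W x t = unit_ind t * (t ^ k * e (seg t x) vs) * H x" for x t
  define W' where "W' z t = unit_ind t * (1 / t ^ Suc m * H (seg (1 / t) z)) * e z vs" for z t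
  have int: "integrable (lborel \<Otimes>\<^sub>M lborel) (\<lambda>(x, t). W x t)"
    unfolding W_def by (rule integrable_kernel_pair_times(2)[OF R H B])
  have [measurable]: "(\<lambda>p. e (fst p) vs) \<in> borel_measurable (lborel \<Otimes>\<^sub>M lborel)"
    by (rule measurable_compose[OF _ meas]) measurable
  have [measurable]: "(\<lambda>p. H (seg (1 / snd p) (fst p))) \<in> borel_measurable (lborel \<Otimes>\<^sub>M lborel)"
    unfolding seg_def by measurable
  have W'_meas [measurable]: "(\<lambda>(z, t). W' z t) \<in> borel_measurable (lborel \<Otimes>\<^sub>M lborel)"
    unfolding W'_def case_prod_unfold by measurable
  have W'_meas_z [measurable]: "(\<lambda>z. W' z t) \<in> borel_measurable borel" for t
    using measurable_Pair1[OF W'_meas, of t] by simp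
  have W: "t ^ DIM('a) * W' (seg t x) t = W x t" if "0 < t" for t x
    using that by (simp add: W_def W'_def seg_inverse m power_add)
  have W'_eq: "W' z t = 0" "W x t = 0" if "\<not> 0 < t" for z t x
    using that by (auto simp: W_def W'_def)
  \<comment> \<open>In place of a majorant for the singular weight, integrability of
    \<open>W'\<close> is inherited from \<open>W\<close> by the same substitution applied to
    absolute values.\<close>
  have int': "integrable (lborel \<Otimes>\<^sub>M lborel) (\<lambda>(z, t). W' z t)"
  proof (rule integrableI_bounded[OF W'_meas])
    have "(\<integral>\<^sup>+z. ennreal \<bar>W' z t\<bar> \<partial>lborel) = (\<integral>\<^sup>+x. ennreal \<bar>W x t\<bar> \<partial>lborel)" for t
    proof (cases "0 < t")
      case True
      have "(\<integral>\<^sup>+z. ennreal \<bar>W' z t\<bar> \<partial>lborel) =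
          ennreal (\<bar>t\<bar> ^ DIM('a)) * (\<integral>\<^sup>+x. ennreal \<bar>W' ((y - t *\<^sub>R y) + t *\<^sub>R x) t\<bar> \<partial>lborel)"
        using True by (intro nn_integral_lborel_affine) auto
      also have "\<dots> = (\<integral>\<^sup>+x. ennreal (\<bar>t\<bar> ^ DIM('a)) * ennreal \<bar>W' ((y - t *\<^sub>R y) + t *\<^sub>R x) t\<bar> \<partial>lborel)"
        by (rule nn_integral_cmult[symmetric]) measurable
      also have "\<dots> = (\<integral>\<^sup>+x. ennreal \<bar>W x t\<bar> \<partial>lborel)"
      proof (rule nn_integral_cong)
        fix x
        have "(y - t *\<^sub>R y) + t *\<^sub>R x = seg t x" by (simp add: seg_def algebra_simps)
        then show "ennreal (\<bar>t\<bar> ^ DIM('a)) * ennreal \<bar>W' ((y - t *\<^sub>R y) + t *\<^sub>R x) t\<bar> = ennreal \<bar>W x t\<bar>"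
          using True by (simp add: abs_mult ennreal_mult flip: W)
      qed
      finally show ?thesis .
    qed (simp add: W'_eq)
    then have "(\<integral>\<^sup>+t. \<integral>\<^sup>+z. ennreal \<bar>W' z t\<bar> \<partial>lborel \<partial>lborel) = (\<integral>\<^sup>+t. \<integral>\<^sup>+x. ennreal \<bar>W x t\<bar> \<partial>lborel \<partial>lborel)"
      by simp
    moreover have "(\<integral>\<^sup>+t. \<integral>\<^sup>+z. ennreal \<bar>W' z t\<bar> \<partial>lborel \<partial>lborel) =
        (\<integral>\<^sup>+p. ennreal (norm (case p of (z, t) \<Rightarrow> W' z t)) \<partial>(lborel \<Otimes>\<^sub>M lborel))"
      by (subst lborel_pair.nn_integral_snd[symmetric]) (use W'_meas in \<open>auto simp: case_prod_unfold\<close>)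
    moreover have "(\<integral>\<^sup>+t. \<integral>\<^sup>+x. ennreal \<bar>W x t\<bar> \<partial>lborel \<partial>lborel) =
        (\<integral>\<^sup>+p. ennreal (norm (case p of (x, t) \<Rightarrow> W x t)) \<partial>(lborel \<Otimes>\<^sub>M lborel))"
      by (subst lborel_pair.nn_integral_snd[symmetric])
        (use borel_measurable_integrable[OF int] in \<open>auto simp: case_prod_unfold\<close>)
    ultimately show "(\<integral>\<^sup>+p. ennreal (norm (case p of (z, t) \<Rightarrow> W' z t)) \<partial>(lborel \<Otimes>\<^sub>M lborel)) < \<infinity>"
      using int by (simp add: integrable_iff_bounded)
  qed
  have "(\<integral>x. W x t \<partial>lborel) = (\<integral>z. W' z t \<partial>lborel)" for t
    using integral_seg[of "\<lambda>z. W' z t" t] by (cases "0 < t") (simp_all add: W W'_eq flip: integral_mult_right_zero)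
  then have "(\<integral>t. \<integral>x. W x t \<partial>lborel \<partial>lborel) = (\<integral>t. \<integral>z. W' z t \<partial>lborel \<partial>lborel)" by simp
  also have "\<dots> = (\<integral>z. \<integral>t. W' z t \<partial>lborel \<partial>lborel)"
    by (rule lborel_pair.Fubini_integral[OF int'])
  finally show ?thesis unfolding W_def W'_def integral_mult_left_zero .
qed

text \<open>Fubini exposes each t separately. Cartan's formula replaces the contractions by
  \<open>H\<close>, the substitution moves the dilation onto \<open>H\<close>, and
  \<open>FTC_inverse_dilation\<close> evaluates the t-integral to -\<phi>(z), which leaves the
  pairing of \<open>e\<close> with \<phi>.\<close>

lemma weak_d_potential:
  assumes R: "\<And>x. x \<in> K \<Longrightarrow> norm (x - y) \<le> R"
  shows "weak_d K k potential e"
  unfolding weak_d_eq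
proof (intro allI impI, elim conjE)
  fix \<phi> and vs :: "'a list" assume \<phi>: "test_function K \<phi>" and vs: "length vs = Suc k"
  \<comment> \<open>Both the weight in Cartan's formula and the exponent left by the Jacobian; their
    agreement makes the t-integrand a total derivative.\<close>
  define m where "m = DIM('a) - Suc k"
  have m: "DIM('a) = k + Suc m" using k by (simp add: m_def)
  define D where "D x = frechet_derivative \<phi> (at x)" for x
  define del where "del i = take i vs @ drop (Suc i) vs" for i
  define H where "H x = m * \<phi> x + D x (x - y)" for x
  have test_D: "test_function K (\<lambda>x. D x v)" for v
    unfolding D_def by (rule test_function_frechet_derivative[OF \<phi>])
  have D_meas [measurable]: "(\<lambda>x. D x v) \<in> borel_measurable borel" for v
    by (rule test_function_measurable(1)[OF test_D])
  have [measurable]: "\<phi> \<in> borel_measurable borel" by (rule test_function_measurable(1)[OF \<phi>])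
  have "D x v = (\<Sum>b\<in>Basis. (v \<bullet> b) * D x b)" for x v
  proof -
    have lin: "linear (D x)"
      unfolding D_def by (rule linear_frechet_derivative[OF test_functionD(2)[OF \<phi>]])
    have "D x v = D x (\<Sum>b\<in>Basis. (v \<bullet> b) *\<^sub>R b)" by (subst euclidean_representation) (rule refl)
    then show ?thesis by (simp add: linear_sum[OF lin] linear_cmul[OF lin])
  qed
  \<comment> \<open>Derivatives in fixed directions are known to be measurable and bounded, and this
    writes \<open>H\<close> in terms of them.\<close>
  then have H: "H x = m * \<phi> x + (\<Sum>b\<in>Basis. ((x - y) \<bullet> b) * D x b)" for x unfolding H_def by metis
  have H_meas: "H \<in> borel_measurable borel" unfolding H[abs_def] by measurable
  obtain B\<phi> where B\<phi>: "\<And>x. \<bar>\<phi> x\<bar> \<le> B\<phi> * indicator K x"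
    using test_function_bounded_indicator[OF \<phi>] by blast
  obtain BD where BD: "\<And>v x. \<bar>D x v\<bar> \<le> BD v * indicator K x"
    using test_function_bounded_indicator[OF test_D] by metis
  have H_bound: "\<bar>H x\<bar> \<le> (m * B\<phi> + (\<Sum>b\<in>Basis. R * BD b)) * indicator K x" for x
  proof (cases "x \<in> K")
    case True
    have "\<bar>H x\<bar> \<le> \<bar>m * \<phi> x\<bar> + (\<Sum>b\<in>Basis. \<bar>((x - y) \<bullet> b) * D x b\<bar>)"
      unfolding H by (rule order_trans[OF abs_triangle_ineq add_left_mono[OF sum_abs]])
    also have "\<dots> \<le> m * B\<phi> + (\<Sum>b\<in>Basis. R * BD b)"
    proof (rule add_mono)
      show "\<bar>m * \<phi> x\<bar> \<le> m * B\<phi>" using B\<phi>[of x] True by (simp add: abs_mult mult_left_mono)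
      show "(\<Sum>b\<in>Basis. \<bar>((x - y) \<bullet> b) * D x b\<bar>) \<le> (\<Sum>b\<in>Basis. R * BD b)"
      proof (rule sum_mono)
        fix b :: 'a assume "b \<in> Basis"
        then have "\<bar>(x - y) \<bullet> b\<bar> \<le> R" using R[OF True] Basis_le_norm order_trans by blast
        then show "\<bar>((x - y) \<bullet> b) * D x b\<bar> \<le> R * BD b"
          unfolding abs_mult using BD[of x b] True by (intro mult_mono) (auto intro: order_trans[OF norm_ge_zero])
      qed
    qed
    finally show ?thesis using True by simp
  next
    case False
    with B\<phi>[of x] BD[of x] show ?thesis unfolding H by (simp add: sum.neutral)
  qed
  note pot = potential_integral[OF R D_meas BD]
  \<comment> \<open>Cartan's formula is stated in z = seg t x. Changing variables gives both sides
    the Jacobian t^n, which cancels as t > 0.\<close>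
  have slice: "(\<Sum>i\<le>k. (-1) ^ i * (\<integral>x. unit_ind t * (t ^ k * e (seg t x) ((x - y) # del i)) * D x (vs ! i) \<partial>lborel)) =
      (\<integral>x. unit_ind t * (t ^ k * e (seg t x) vs) * H x \<partial>lborel)" for t
  proof (cases "t \<in> {0<..<1}")
    case True
    then have t: "0 < t" "t < 1" by auto
    define f where "f i z = e z ((seg (1 / t) z - y) # del i) * D (seg (1 / t) z) (vs ! i)" for i z
    have [measurable]: "(\<lambda>z. e z ws) \<in> borel_measurable borel" for ws by (rule meas)
    have D_comp [measurable]: "(\<lambda>z. D (seg (1 / t) z) v) \<in> borel_measurable borel" for v
      by (rule measurable_compose[OF _ D_meas]) measurable
    have f_meas: "f i \<in> borel_measurable borel" for i
      unfolding f_def alternating_expand[OF alt, of _ "_ - y"] by measurable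
    have g_meas: "(\<lambda>z. e z vs * H (seg (1 / t) z)) \<in> borel_measurable borel"
      by (intro borel_measurable_times measurable_compose[OF _ H_meas]) measurable
    have "(\<Sum>i\<le>k. (-1) ^ i * (\<integral>z. f i z \<partial>lborel)) = (\<integral>z. e z vs * H (seg (1 / t) z) \<partial>lborel)"
      using weak_Cartan[OF \<phi> t vs] by (simp add: f_def del_def D_def H_def m_def)
    then have "(\<Sum>i\<le>k. (-1) ^ i * (t ^ DIM('a) * (\<integral>x. f i (seg t x) \<partial>lborel))) =
        t ^ DIM('a) * (\<integral>x. e (seg t x) vs * H x \<partial>lborel)"
      using t by (simp add: integral_seg[OF f_meas t(1)] integral_seg[OF g_meas t(1)] seg_inverse)
    then have "t ^ DIM('a) * (\<Sum>i\<le>k. (-1) ^ i * (\<integral>x. f i (seg t x) \<partial>lborel)) =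
        t ^ DIM('a) * (\<integral>x. e (seg t x) vs * H x \<partial>lborel)"
      by (simp add: sum_distrib_left mult.left_commute)
    then have *: "(\<Sum>i\<le>k. (-1) ^ i * (\<integral>x. f i (seg t x) \<partial>lborel)) = (\<integral>x. e (seg t x) vs * H x \<partial>lborel)"
      using t by simp
    have "(\<Sum>i\<le>k. (-1) ^ i * (\<integral>x. unit_ind t * (t ^ k * e (seg t x) ((x - y) # del i)) * D x (vs ! i) \<partial>lborel)) =
        (\<Sum>i\<le>k. (-1) ^ i * (t ^ k * (\<integral>x. f i (seg t x) \<partial>lborel)))"
      using True t by (simp add: f_def seg_inverse mult.assoc)
    also have "\<dots> = t ^ k * (\<Sum>i\<le>k. (-1) ^ i * (\<integral>x. f i (seg t x) \<partial>lborel))"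
      by (simp add: sum_distrib_left mult.left_commute)
    finally show ?thesis unfolding * using True by (simp add: mult.assoc)
  qed simp
  have "(\<Sum>i\<le>k. (-1) ^ i * (\<integral>x. indicator K x * (potential x (del i) * D x (vs ! i)) \<partial>lborel)) =
      (\<Sum>i\<le>k. \<integral>t. (-1) ^ i * (\<integral>x. unit_ind t * (t ^ k * e (seg t x) ((x - y) # del i)) * D x (vs ! i) \<partial>lborel) \<partial>lborel)"
    by (simp add: pot(2))
  also have "\<dots> = (\<integral>t. (\<Sum>i\<le>k. (-1) ^ i * (\<integral>x. unit_ind t * (t ^ k * e (seg t x) ((x - y) # del i)) * D x (vs ! i) \<partial>lborel)) \<partial>lborel)"
    by (rule Bochner_Integration.integral_sum[symmetric]) (intro integrable_mult_right pot(1))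
  also have "\<dots> = (\<integral>t. \<integral>x. unit_ind t * (t ^ k * e (seg t x) vs) * H x \<partial>lborel \<partial>lborel)"
    by (simp only: slice)
  also have "\<dots> = (\<integral>z. (\<integral>t. unit_ind t * (1 / t ^ Suc m * H (seg (1 / t) z)) \<partial>lborel) * e z vs \<partial>lborel)"
    by (rule integral_dilation[OF R H_meas H_bound m])
  also have "\<dots> = (\<integral>z. - (e z vs * \<phi> z) \<partial>lborel)"
  proof -
    \<comment> \<open>The fixed point z = y of the dilations is excluded; it is a null set.\<close>
    have ftc: "(\<integral>t. unit_ind t * (1 / t ^ Suc m * H (seg (1 / t) z)) \<partial>lborel) = - \<phi> z" if "z \<noteq> y" for z
      using FTC_inverse_dilation[OF \<phi> that, of m] by (simp add: H_def D_def seg_def)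
    show ?thesis
    proof (rule integral_cong_AE)
      have [measurable]: "(\<lambda>z. e z vs) \<in> borel_measurable borel" by (rule meas)
      show "(\<lambda>z. - (e z vs * \<phi> z)) \<in> borel_measurable lborel" by measurable
      have "(\<lambda>p. H (seg (1 / snd p) (fst p))) \<in> borel_measurable (lborel \<Otimes>\<^sub>M lborel)"
        by (rule measurable_compose[OF _ H_meas]) (unfold seg_def, measurable)
      then have "(\<lambda>z. \<integral>t. unit_ind t * (1 / t ^ Suc m * H (seg (1 / t) z)) \<partial>lborel) \<in> borel_measurable lborel"
        by (intro lborel.borel_measurable_lebesgue_integral) (simp add: case_prod_unfold)
      then show "(\<lambda>z. (\<integral>t. unit_ind t * (1 / t ^ Suc m * H (seg (1 / t) z)) \<partial>lborel) * e z vs) \<in> borel_measurable lborel"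
        by measurable
      show "AE z in lborel. (\<integral>t. unit_ind t * (1 / t ^ Suc m * H (seg (1 / t) z)) \<partial>lborel) * e z vs = - (e z vs * \<phi> z)"
        using AE_lborel_singleton[of y] by eventually_elim (subst ftc, simp_all)
    qed
  qed
  also have "\<dots> = - (\<integral>z. indicator K z * (e z vs * \<phi> z) \<partial>lborel)"
  proof -
    have "indicator K z * (e z vs * \<phi> z) = e z vs * \<phi> z" for z
      using outside[of z vs] by (auto simp: indicator_def)
    then show ?thesis by (simp only: Bochner_Integration.integral_minus)
  qed
  finally show "(\<integral>x. indicator K x * (e x vs * \<phi> x) \<partial>lborel) =
     - (\<Sum>i\<le>k. (-1) ^ i * (\<integral>x. indicator K x * (potential x (take i vs @ drop (Suc i) vs) *
        frechet_derivative \<phi> (at x) (vs ! i)) \<partial>lborel))"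
    by (simp add: del_def D_def)
qed

end

text \<open>In the constant, R^2 comes from contracting with x - y, 2^n from averaging over base
  points, and k + 1 = (k + 1)! / k! from the normalisations of \<open>form_inner\<close> in degrees
  k + 1 and k.\<close>

lemma L2_Poincare:
  fixes K :: "'a::euclidean_space set"
  assumes K: "open K" "convex K" "bounded K" "K \<noteq> {}" and R: "\<And>x y. x \<in> K \<Longrightarrow> y \<in> K \<Longrightarrow> norm (x - y) \<le> R"
    and k: "k < DIM('a)" and \<eta>: "\<eta> \<in> L2_form K (Suc k)" and closed: "weak_d K (Suc k) \<eta> zero_form"
  shows "\<exists>\<tau>\<in>L2_form K k. weak_d K k \<tau> \<eta> \<and>
    L2_norm K k \<tau> \<le> sqrt (R\<^sup>2 * 2 ^ DIM('a) * Suc k) * L2_norm K (Suc k) \<eta>"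
proof -
  interpret K: bounded_open_set K by unfold_locales (use K in auto)
  \<comment> \<open>Truncation by 0 yields a representative that is alternating and Borel measurable
    on the whole space.\<close>
  define e :: "'a form" where "e x ws = indicator K x * \<eta> x ws" for x ws
  define g where "g x = (\<Sum>ws\<in>basis_lists (Suc k). (e x ws)\<^sup>2)" for x
  have alt: "alternating (Suc k) (e x)" for x
    using K.L2_form_alternating[OF \<eta>, of x] alternating_zero
    by (cases "x \<in> K") (simp_all add: e_def[abs_def])
  have meas: "(\<lambda>x. e x ws) \<in> borel_measurable borel" for ws
    unfolding e_def by (rule K.L2_form_measurable[OF \<eta>])
  have "(\<lambda>x. indicator K x * e x vs) = (\<lambda>x. indicator K x * \<eta> x vs)"
    "(\<lambda>x. indicator K x * (e x vs)\<^sup>2) = (\<lambda>x. indicator K x * (\<eta> x vs)\<^sup>2)" for vs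
    by (auto simp: e_def indicator_def)
  then have e_L2: "e \<in> L2_form K (Suc k)"
    by (intro K.L2_formI alt) (simp_all add: K.L2_form_measurable[OF \<eta>] K.L2_form_integrable_square[OF \<eta>])
  have eq: "form_eq K e \<eta>" unfolding form_eq_def by (intro AE_I2) (simp add: e_def fun_eq_iff)
  have closed_e: "weak_d K (Suc k) e zero_form"
    using K.weak_d_cong[OF \<eta> e_L2 K.form_eq_sym[OF eq] K.zero_form_L2 K.zero_form_L2 K.form_eq_refl closed] .
  define I where "I = L2_inner K (Suc k) \<eta> \<eta>"
  have I0: "0 \<le> I" unfolding I_def by (rule K.L2_inner_nonneg)
  have g_eq: "g x = fact (Suc k) * (indicator K x * form_inner (Suc k) (\<eta> x) (\<eta> x))" for x
    by (auto simp: g_def e_def form_inner_eq power2_eq_square indicator_def simp del: fact_Suc)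
  have g_int: "integrable lborel g" "(\<integral>x. g x \<partial>lborel) = fact (Suc k) * I"
    unfolding g_eq[abs_def] I_def K.L2_inner_eq using K.integrable_form_inner[OF \<eta> \<eta>] by simp_all
  have g0: "0 \<le> g x" for x by (simp add: g_def sum_nonneg)
  have g_nn: "(\<integral>\<^sup>+x. ennreal (g x) \<partial>lborel) = ennreal (fact (Suc k) * I)"
    using nn_integral_eq_integral[OF g_int(1)] g0 g_int(2) by simp
  have g_meas: "(\<lambda>x. ennreal (g x)) \<in> borel_measurable borel" using g_int(1) by auto
  obtain y where y: "y \<in> K" and base: "(\<integral>\<^sup>+x. indicator K x * (\<integral>\<^sup>+t. indicator {0<..<1} t *
      ennreal (g (y + t *\<^sub>R (x - y))) \<partial>lborel) \<partial>lborel) \<le> 2 ^ DIM('a) * (\<integral>\<^sup>+x. ennreal (g x) \<partial>lborel)"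
    using good_base_point[OF K(1,3,4) g_meas] by (auto simp: g_nn)
  define M where "M = 2 ^ DIM('a) * (fact (Suc k) * I)"
  have M0: "0 \<le> M" using I0 by (simp add: M_def)
  interpret P: homotopy_operator K y k e
    by unfold_locales (use K y k alt meas e_L2 closed_e in \<open>auto simp: e_def\<close>)
  interpret P: homotopy_operator_bounded K y k e M
  proof
    have "2 ^ DIM('a) * ennreal (fact (Suc k) * I) = ennreal M"
      unfolding M_def using I0 by (subst ennreal_mult) (simp_all flip: ennreal_power)
    with base show "(\<integral>\<^sup>+x. indicator K x * (\<integral>\<^sup>+t. indicator {0<..<1} t * ennreal (P.energy (P.seg t x)) \<partial>lborel) \<partial>lborel) \<le> ennreal M"
      unfolding g_nn by (simp add: P.energy_def P.seg_def g_def)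
  qed
  have Ry: "norm (x - y) \<le> R" if "x \<in> K" for x using R[OF that y] .
  show ?thesis
  proof (intro bexI conjI)
    show pot: "P.potential \<in> L2_form K k" by (rule P.potential_L2(1)[OF Ry M0])
    show "weak_d K k P.potential \<eta>"
      using K.weak_d_cong[OF pot pot K.form_eq_refl e_L2 \<eta> eq P.weak_d_potential[OF Ry]] .
    have "L2_inner K k P.potential P.potential \<le> R\<^sup>2 * M / fact k" by (rule P.potential_L2(2)[OF Ry M0])
    also have "\<dots> = R\<^sup>2 * 2 ^ DIM('a) * Suc k * I" by (simp add: M_def field_simps)
    finally show "L2_norm K k P.potential \<le> sqrt (R\<^sup>2 * 2 ^ DIM('a) * Suc k) * L2_norm K (Suc k) \<eta>"
      unfolding L2_norm_def I_def[symmetric] real_sqrt_mult[symmetric] by simp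
  qed
qed

section \<open>Extension and projection\<close>

context bounded_open_set
begin

lemma restrict_subset:
  assumes K: "bounded_open_set K" "D \<subseteq> K" and \<omega>: "\<omega> \<in> L2_form K k"
  shows L2_form_subset: "\<omega> \<in> L2_form D k" and L2_norm_subset: "L2_norm D k \<omega> \<le> L2_norm K k \<omega>"
proof -
  interpret K: bounded_open_set K by fact
  have eq: "indicator D x * c = indicator D x * (indicator K x * c)" for x and c :: real
    using K(2) by (auto simp: indicator_def)
  show sub: "\<omega> \<in> L2_form D k"
  proof (rule L2_formI)
    show "(\<lambda>x. indicator D x * \<omega> x vs) \<in> borel_measurable borel" for vs
      by (subst eq) (intro borel_measurable_times borel_measurable_indicator D_sets K.L2_form_measurable[OF \<omega>])
    show "integrable lborel (\<lambda>x. indicator D x * (\<omega> x vs)\<^sup>2)" for vs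
      using integrable_mult_indicator[OF _ K.L2_form_integrable_square[OF \<omega>, of vs], of D]
      by (subst eq) simp
  qed (use K.L2_form_alternating[OF \<omega>] K(2) in auto)
  have "L2_inner D k \<omega> \<omega> \<le> L2_inner K k \<omega> \<omega>"
    unfolding L2_inner_eq K.L2_inner_eq
    by (intro integral_mono integrable_form_inner K.integrable_form_inner sub \<omega>)
      (use K(2) form_inner_nonneg[of k] in \<open>auto simp: indicator_def\<close>)
  then show "L2_norm D k \<omega> \<le> L2_norm K k \<omega>" by (simp add: L2_norm_def)
qed

text \<open>A test function on D is also one on K and vanishes with its derivatives off D.\<close>

lemma weak_d_subset:
  assumes K: "bounded_open_set K" "D \<subseteq> K" and d: "weak_d K k \<omega> \<eta>"
  shows "weak_d D k \<omega> \<eta>"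
  unfolding weak_d_eq
proof (intro allI impI, elim conjE)
  interpret K: bounded_open_set K by fact
  fix \<phi> and vs :: "'a list" assume \<phi>: "test_function D \<phi>" and vs: "length vs = Suc k"
  have ind: "indicator K x * (c * \<psi> x) = indicator D x * (c * \<psi> x)" if "test_function D \<psi>" for x c \<psi>
    using test_functionD(5)[OF that, of x] K(2) by (auto simp: indicator_def)
  show "(\<integral>x. indicator D x * (\<eta> x vs * \<phi> x) \<partial>lborel) =
     - (\<Sum>i\<le>k. (-1) ^ i * (\<integral>x. indicator D x *
         (\<omega> x (take i vs @ drop (Suc i) vs) * frechet_derivative \<phi> (at x) (vs ! i)) \<partial>lborel))"
    using d[unfolded K.weak_d_eq, rule_format, of \<phi> vs] test_function_subset[OF \<phi> K(2)] vs
    by (simp add: ind[OF \<phi>] ind[OF test_function_frechet_derivative[OF \<phi>]])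
qed

end

text \<open>d E \<eta> = E (d \<eta>), where d \<eta> vanishes only almost everywhere. Being exact,
  d \<eta> lies in the domain of E; its graph norm is 0, so boundedness of E makes its image
  null.\<close>

lemma extension_closed:
  assumes "bounded_open_set D" "bounded_open_set K" and E: "cochain_extension D K E"
    and \<omega>: "\<omega> \<in> H_form D k"
  defines "\<eta> \<equiv> ext_d D k \<omega>"
  shows "weak_d K (Suc k) (E (Suc k) \<eta>) zero_form"
proof -
  interpret D: bounded_open_set D by fact
  interpret K: bounded_open_set K by fact
  define \<zeta> where "\<zeta> = ext_d D (Suc k) \<eta>"
  have \<eta>: "\<eta> \<in> H_perp_form D (Suc k)" "\<eta> \<in> H_form D (Suc k)"
    unfolding \<eta>_def using D.ext_d_H_perp[OF \<omega>] D.ext_d_H_form[OF \<omega>] by auto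
  have \<zeta>: "\<zeta> \<in> H_perp_form D (Suc (Suc k))" "H_norm D (Suc (Suc k)) \<zeta> = 0"
    unfolding \<zeta>_def \<eta>_def
    using D.ext_d_H_perp[OF D.ext_d_H_form[OF \<omega>]] D.H_form_null(2)[OF _ D.ext_d_ext_d[OF \<omega>]]
      D.ext_d_L2[OF D.ext_d_H_form[OF \<omega>]] by auto
  have E\<eta>: "E (Suc k) \<eta> \<in> H_form K (Suc k)"
    using E \<eta>(1) unfolding cochain_extension_def by blast
  have E\<zeta>: "E (Suc (Suc k)) \<zeta> \<in> H_form K (Suc (Suc k))"
    using E \<zeta>(1) unfolding cochain_extension_def by blast
  obtain B where "H_norm K (Suc (Suc k)) (E (Suc (Suc k)) \<zeta>) \<le> B * H_norm D (Suc (Suc k)) \<zeta>"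
    using E \<zeta>(1) unfolding cochain_extension_def by blast
  then have "L2_norm K (Suc (Suc k)) (E (Suc (Suc k)) \<zeta>) = 0"
    using \<zeta>(2) K.L2_norm_le_H_norm[of "Suc (Suc k)" "E (Suc (Suc k)) \<zeta>"]
      K.L2_norm_nonneg[of "Suc (Suc k)" "E (Suc (Suc k)) \<zeta>"] by simp
  then have "form_eq K (E (Suc (Suc k)) \<zeta>) zero_form"
    by (rule K.L2_norm_eq_0D[OF K.H_form_L2[OF E\<zeta>]])
  moreover have "form_eq K (ext_d K (Suc k) (E (Suc k) \<eta>)) (E (Suc (Suc k)) \<zeta>)"
    using E \<eta>(1) unfolding cochain_extension_def \<zeta>_def by blast
  ultimately have "form_eq K (ext_d K (Suc k) (E (Suc k) \<eta>)) zero_form"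
    using K.form_eq_trans by blast
  then show ?thesis
    using K.weak_d_cong[OF K.H_form_L2[OF E\<eta>] K.H_form_L2[OF E\<eta>] K.form_eq_refl
        K.ext_d_L2[OF E\<eta>] K.zero_form_L2 _ K.weak_d_ext_d[OF E\<eta>]] by blast
qed

text \<open>As d \<tau> = d \<omega> holds only almost everywhere, the commuting property is
  combined with well-definedness of the projection on classes. The bound is in the graph norm, which
  brings d \<omega> in beside \<tau>; the absolute value covers \<open>C\<close> of either
  sign.\<close>

lemma projection_potential:
  assumes "bounded_open_set D" and P: "bounded_cochain_projection D \<Lambda> C P"
    and \<Lambda>: "\<And>k. \<Lambda> k \<subseteq> H_form D k" and \<omega>: "\<omega> \<in> \<Lambda> k"
    and \<tau>: "\<tau> \<in> L2_form D k" and d\<tau>: "weak_d D k \<tau> (ext_d D k \<omega>)"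
  shows "P k \<tau> \<in> \<Lambda> k" "form_eq D (ext_d D k (P k \<tau>)) (ext_d D k \<omega>)"
    "L2_norm D k (P k \<tau>) \<le> \<bar>C\<bar> * sqrt ((L2_norm D k \<tau>)\<^sup>2 + (L2_norm D (Suc k) (ext_d D k \<omega>))\<^sup>2)"
proof -
  interpret D: bounded_open_set D by fact
  have \<omega>H: "\<omega> \<in> H_form D k" using \<omega> \<Lambda> by blast
  define \<eta> where "\<eta> = ext_d D k \<omega>"
  have \<eta>: "\<eta> \<in> H_form D (Suc k)" "\<eta> \<in> L2_form D (Suc k)"
    unfolding \<eta>_def using D.ext_d_H_form[OF \<omega>H] D.ext_d_L2[OF \<omega>H] by auto
  have \<tau>H: "\<tau> \<in> H_form D k" by (rule D.H_formI[OF \<tau> \<eta>(2)[unfolded \<eta>_def] d\<tau>])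
  have ext\<tau>: "form_eq D (ext_d D k \<tau>) \<eta>"
    unfolding \<eta>_def by (rule D.ext_d_unique[OF \<tau> \<eta>(2)[unfolded \<eta>_def] d\<tau>])
  have P_in: "P j \<zeta> \<in> \<Lambda> j" if "\<zeta> \<in> H_form D j" for j \<zeta>
    using P that unfolding bounded_cochain_projection_def by blast
  have P_norm: "H_norm D j (P j \<zeta>) \<le> C * H_norm D j \<zeta>" if "\<zeta> \<in> H_form D j" for j \<zeta>
    using P that unfolding bounded_cochain_projection_def by blast
  have P_d: "form_eq D (ext_d D k (P k \<zeta>)) (P (Suc k) (ext_d D k \<zeta>))" if "\<zeta> \<in> H_form D k" for \<zeta>
    using P that unfolding bounded_cochain_projection_def by blast
  have P_null: "form_eq D (P (Suc k) \<zeta>) zero_form"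
    if \<zeta>: "\<zeta> \<in> L2_form D (Suc k)" "form_eq D \<zeta> zero_form" for \<zeta>
  proof (rule D.L2_norm_eq_0D)
    note null = D.H_form_null[OF \<zeta>]
    show "P (Suc k) \<zeta> \<in> L2_form D (Suc k)" using P_in[OF null(1)] \<Lambda> D.H_form_L2 by blast
    show "L2_norm D (Suc k) (P (Suc k) \<zeta>) = 0"
      using P_norm[OF null(1)] null(2) D.L2_norm_le_H_norm[of "Suc k" "P (Suc k) \<zeta>"]
        D.L2_norm_nonneg[of "Suc k" "P (Suc k) \<zeta>"] by simp
  qed
  show "P k \<tau> \<in> \<Lambda> k" by (rule P_in[OF \<tau>H])
  have "form_eq D (P (Suc k) (ext_d D k \<tau>)) (P (Suc k) \<eta>)"
  proof (rule D.bounded_linear_forms_cong[where A = "P (Suc k)" and S = "H_form D (Suc k)" and k = "Suc k"])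
    show "linear_forms D (H_form D (Suc k)) (P (Suc k))"
      using P unfolding bounded_cochain_projection_def by blast
  qed (use D.ext_d_H_form[OF \<tau>H] D.ext_d_L2[OF \<tau>H] \<eta> ext\<tau> P_null in auto)
  moreover have "form_eq D (ext_d D k (P k \<omega>)) (ext_d D k \<omega>)"
    using D.ext_d_cong[of "P k \<omega>" k \<omega>] P_in[OF \<omega>H] \<omega>H \<Lambda> P \<omega>
    unfolding bounded_cochain_projection_def by blast
  ultimately show "form_eq D (ext_d D k (P k \<tau>)) (ext_d D k \<omega>)"
    using P_d[OF \<tau>H] P_d[OF \<omega>H] unfolding \<eta>_def
    by (meson D.form_eq_sym D.form_eq_trans)
  have "L2_norm D k (P k \<tau>) \<le> C * H_norm D k \<tau>"
    using D.L2_norm_le_H_norm P_norm[OF \<tau>H] by (rule order_trans)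
  also have "\<dots> \<le> \<bar>C\<bar> * H_norm D k \<tau>"
    using D.H_norm_nonneg by (intro mult_right_mono) auto
  finally show "L2_norm D k (P k \<tau>) \<le> \<bar>C\<bar> * sqrt ((L2_norm D k \<tau>)\<^sup>2 + (L2_norm D (Suc k) (ext_d D k \<omega>))\<^sup>2)"
    using D.L2_norm_cong[OF D.ext_d_L2[OF \<tau>H] \<eta>(2) ext\<tau>] by (simp add: H_norm_def \<eta>_def)
qed

theorem theorem13:
  fixes K :: "'a::euclidean_space set" and Ctilde Cproj :: real
  assumes "open K" and "convex K" and "bounded K"
  shows "\<exists>CDP::real. \<forall>(\<Omega> :: 'a set) (\<Omega>h :: real \<Rightarrow> 'a set) (T :: real \<Rightarrow> 'a set set)
      (\<Lambda> :: real \<Rightarrow> nat \<Rightarrow> 'a form set) (P :: real \<Rightarrow> nat \<Rightarrow> 'a form \<Rightarrow> 'a form).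
    bounded_lipschitz_domain \<Omega> \<and>
    (\<forall>h>0. polytopal_domain (\<Omega>h h)) \<and>
    uniform_lipschitz_character \<Omega>h \<and>
    (\<forall>h>0. \<Omega> \<subseteq> \<Omega>h h \<and> \<Omega>h h \<subseteq> K) \<and>
    (\<forall>h>0. extension_constant (\<Omega>h h) K Ctilde) \<and>
    (\<forall>h>0. \<forall>k. discrete_form_space (\<Omega>h h) (T h) k (\<Lambda> h k)) \<and>
    (\<forall>h>0. bounded_cochain_projection (\<Omega>h h) (\<Lambda> h) Cproj (P h))
    \<longrightarrow>
    (\<forall>h>0. \<forall>k<DIM('a). \<forall>\<omega>h \<in> \<Lambda> h k. \<exists>\<tau>h \<in> \<Lambda> h k.
       form_eq (\<Omega>h h) (ext_d (\<Omega>h h) k \<tau>h) (ext_d (\<Omega>h h) k \<omega>h) \<and>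
       L2_norm (\<Omega>h h) k \<tau>h \<le> CDP * L2_norm (\<Omega>h h) (Suc k) (ext_d (\<Omega>h h) k \<omega>h))"
proof -
  obtain R where R: "\<And>x y. x \<in> K \<Longrightarrow> y \<in> K \<Longrightarrow> norm (x - y) \<le> R"
    using diameter_bounded_bound[OF assms(3)] by (auto simp: dist_norm)
  \<comment> \<open>The Poincare constant with k + 1 replaced by its maximum n, so that one bound
    serves all degrees k < n.\<close>
  define CP where "CP = sqrt (R\<^sup>2 * 2 ^ DIM('a) * DIM('a))"
  \<comment> \<open>The summand 1 is the share of d \<tau> = \<eta> in the graph norm of \<tau>. The
    constant is fixed before any domain or discrete space is introduced.\<close>
  define CDP where "CDP = \<bar>Cproj\<bar> * sqrt ((CP * \<bar>1 + Ctilde\<bar>)\<^sup>2 + 1)"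
  have K: "bounded_open_set K" by unfold_locales fact+
  interpret K: bounded_open_set K by fact
  have "\<exists>\<tau>\<in>\<Lambda> k. form_eq D (ext_d D k \<tau>) (ext_d D k \<omega>) \<and>
      L2_norm D k \<tau> \<le> CDP * L2_norm D (Suc k) (ext_d D k \<omega>)"
    if D: "polytopal_domain D" "D \<subseteq> K" and ext: "extension_constant D K Ctilde"
      and \<Lambda>: "\<forall>k. discrete_form_space D T k (\<Lambda> k)" and P: "bounded_cochain_projection D \<Lambda> Cproj P"
      and k: "k < DIM('a)" and \<omega>: "\<omega> \<in> \<Lambda> k"
    for D T \<Lambda> P k \<omega>
  proof -
    have D_set: "bounded_open_set D"
      by unfold_locales (use D assms(3) bounded_subset in \<open>auto simp: polytopal_domain_def\<close>)
    interpret D: bounded_open_set D by fact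
    have nonempty: "K \<noteq> {}" using D by (auto simp: polytopal_domain_def)
    have \<Lambda>_sub: "\<Lambda> j \<subseteq> H_form D j" for j using \<Lambda> by (auto simp: discrete_form_space_def)
    then have \<omega>H: "\<omega> \<in> H_form D k" using \<omega> by blast
    define \<eta> where "\<eta> = ext_d D k \<omega>"
    define N where "N = L2_norm D (Suc k) \<eta>"
    have N: "0 \<le> N" by (simp add: N_def D.L2_norm_nonneg)
    from ext obtain E where E: "cochain_extension D K E"
      and E_exact: "\<And>k \<omega>. \<omega> \<in> exact_form D k \<Longrightarrow> H_norm K k (E k \<omega>) \<le> (1 + Ctilde) * H_norm D k \<omega>"
      unfolding extension_constant_def by blast
    have \<eta>: "\<eta> \<in> H_perp_form D (Suc k)" "\<eta> \<in> H_form D (Suc k)" "\<eta> \<in> L2_form D (Suc k)"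
      unfolding \<eta>_def using D.ext_d_H_perp[OF \<omega>H] D.ext_d_H_form[OF \<omega>H] D.ext_d_L2[OF \<omega>H] by auto
    define \<epsilon> where "\<epsilon> = E (Suc k) \<eta>"
    have \<epsilon>: "\<epsilon> \<in> H_form K (Suc k)" "form_eq D \<epsilon> \<eta>"
      unfolding \<epsilon>_def using E \<eta>(1) unfolding cochain_extension_def by blast+
    \<comment> \<open>The discrete form \<open>\<omega>\<close> is itself the potential that
      exactness asks for, so the bound with \<open>Ctilde\<close> applies.\<close>
    have "\<eta> \<in> exact_form D (Suc k)"
      using \<eta>(2) \<omega>H D.form_eq_refl by (auto simp: exact_form_def \<eta>_def)
    \<comment> \<open>As d \<eta> = 0, the graph norm of \<eta> is its L2 norm
      \<open>N\<close>.\<close>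
    from E_exact[OF this] have "H_norm K (Suc k) \<epsilon> \<le> (1 + Ctilde) * N"
      unfolding N_def \<epsilon>_def using D.H_norm_closed[OF \<eta>(2)] D.ext_d_ext_d[OF \<omega>H] by (simp add: \<eta>_def)
    also have "\<dots> \<le> \<bar>1 + Ctilde\<bar> * N" using N by (intro mult_right_mono) auto
    finally have \<epsilon>_norm: "L2_norm K (Suc k) \<epsilon> \<le> \<bar>1 + Ctilde\<bar> * N"
      using K.L2_norm_le_H_norm[of "Suc k" \<epsilon>] by linarith
    have "weak_d K (Suc k) \<epsilon> zero_form"
      unfolding \<epsilon>_def \<eta>_def by (rule extension_closed[OF D_set K E \<omega>H])
    from L2_Poincare[OF assms nonempty R k K.H_form_L2[OF \<epsilon>(1)] this] obtain \<tau> where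
      \<tau>: "\<tau> \<in> L2_form K k" "weak_d K k \<tau> \<epsilon>"
      and \<tau>_norm: "L2_norm K k \<tau> \<le> sqrt (R\<^sup>2 * 2 ^ DIM('a) * Suc k) * L2_norm K (Suc k) \<epsilon>" by blast
    have \<tau>D: "\<tau> \<in> L2_form D k" by (rule D.L2_form_subset[OF K D(2) \<tau>(1)])
    \<comment> \<open>On D the derivative \<epsilon> of \<tau> may be exchanged for \<eta>, since E
      extends forms from D.\<close>
    have d\<tau>: "weak_d D k \<tau> (ext_d D k \<omega>)"
      using D.weak_d_cong[OF \<tau>D \<tau>D D.form_eq_refl D.L2_form_subset[OF K D(2) K.H_form_L2[OF \<epsilon>(1)]]
          \<eta>(3) \<epsilon>(2) D.weak_d_subset[OF K D(2) \<tau>(2)]] by (simp add: \<eta>_def)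
    have "L2_norm D k \<tau> \<le> sqrt (R\<^sup>2 * 2 ^ DIM('a) * Suc k) * L2_norm K (Suc k) \<epsilon>"
      using D.L2_norm_subset[OF K D(2) \<tau>(1)] \<tau>_norm by linarith
    also have "\<dots> \<le> CP * (\<bar>1 + Ctilde\<bar> * N)"
      unfolding CP_def using k K.L2_norm_nonneg
      by (intro mult_mono \<epsilon>_norm real_sqrt_le_mono mult_left_mono) auto
    finally have "(L2_norm D k \<tau>)\<^sup>2 + N\<^sup>2 \<le> (CP * (\<bar>1 + Ctilde\<bar> * N))\<^sup>2 + N\<^sup>2"
      using D.L2_norm_nonneg by (simp add: power_mono)
    also have "\<dots> = ((CP * \<bar>1 + Ctilde\<bar>)\<^sup>2 + 1) * N\<^sup>2"
      by (simp add: power_mult_distrib algebra_simps)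
    finally have "sqrt ((L2_norm D k \<tau>)\<^sup>2 + N\<^sup>2) \<le> sqrt (((CP * \<bar>1 + Ctilde\<bar>)\<^sup>2 + 1) * N\<^sup>2)"
      by (rule real_sqrt_le_mono)
    also have "\<dots> = sqrt ((CP * \<bar>1 + Ctilde\<bar>)\<^sup>2 + 1) * N"
      using N by (simp add: real_sqrt_mult)
    finally have "sqrt ((L2_norm D k \<tau>)\<^sup>2 + N\<^sup>2) \<le> sqrt ((CP * \<bar>1 + Ctilde\<bar>)\<^sup>2 + 1) * N" .
    then have "\<bar>Cproj\<bar> * sqrt ((L2_norm D k \<tau>)\<^sup>2 + N\<^sup>2) \<le> CDP * N"
      unfolding CDP_def mult.assoc by (intro mult_left_mono) auto
    with projection_potential[OF D_set P \<Lambda>_sub \<omega> \<tau>D d\<tau>] show ?thesis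
      unfolding N_def \<eta>_def by (meson order_trans)
  qed
  note main = this
  show ?thesis
  proof (intro exI[of _ CDP] allI impI ballI, elim conjE)
    fix \<Omega> \<Omega>h T \<Lambda> P and h :: real and k \<omega>h
    assume h: "0 < h" and k: "k < DIM('a)" and \<omega>h: "\<omega>h \<in> \<Lambda> h k"
      and "\<forall>h>0. polytopal_domain (\<Omega>h h)" "\<forall>h>0. \<Omega> \<subseteq> \<Omega>h h \<and> \<Omega>h h \<subseteq> K"
      "\<forall>h>0. extension_constant (\<Omega>h h) K Ctilde" "\<forall>h>0. \<forall>k. discrete_form_space (\<Omega>h h) (T h) k (\<Lambda> h k)"
      "\<forall>h>0. bounded_cochain_projection (\<Omega>h h) (\<Lambda> h) Cproj (P h)"
    then show "\<exists>\<tau>h\<in>\<Lambda> h k. form_eq (\<Omega>h h) (ext_d (\<Omega>h h) k \<tau>h) (ext_d (\<Omega>h h) k \<omega>h) \<and>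
       L2_norm (\<Omega>h h) k \<tau>h \<le> CDP * L2_norm (\<Omega>h h) (Suc k) (ext_d (\<Omega>h h) k \<omega>h)"
      by (intro main[of "\<Omega>h h" "T h" "\<Lambda> h" "P h" k \<omega>h]) simp_all
  qed
qed

end
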